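(* Let $K$ be a normal Hopf subalgebra of $H$. Then the image of the restriction map $\mathrm{res}^H_K:C(H)\to C(K)$ equals $$\Big\{f\in K^*:\ f\Big(\sum a_1xS(a_2)\Big)=\epsilon(a)f(x)\ \text{for all }a\in H,\ x\in K\Big\};$$ in particular this set is a subalgebra of $C(K)$ and the image of $\mathrm{res}^H_K$ is isomorphic to it as a $k$-algebra.
   Context: Let $k$ be an algebraically closed field of characteristic $0$ and $H$ a finite-dimensional semisimple Hopf algebra over $k$ (comultiplication $\Delta(h)=\sum h_1\otimes h_2$, counit $\epsilon$, antipode $S$). A Hopf subalgebra $K$ is normal if $\sum h_1xS(h_2)\in K$ for all $h\in H$, $x\in K$. $C(H)\subseteq H^*$ and $C(K)\subseteq K^*$ are the character rings, and $\mathrm{res}^H_K$ sends $\chi\in C(H)$ to its restriction $\chi|_K$. *)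

theory Defs
  imports "HOL-Library.FuncSet" "HOL-Library.Function_Algebras"
          "HOL-Computational_Algebra.Polynomial"
begin

text \<open>H is identified with k^I for a finite basis index type 'i: an element is a
coordinate function x :: 'i => 'k (x = sum of x i * b_i). H (x) H is identified with
('i * 'i) => 'k. The structure is given by structure constants:
 mc i j l : coefficient of b_l in b_i b_j;  uc : coordinates of 1;
 dc i a b : coefficient of b_a (x) b_b in Delta(b_i);  ec i = epsilon(b_i);
 sc i j : coefficient of b_j in S(b_i).\<close>

record ('i, 'k) hopf_data =
  mc :: "'i \<Rightarrow> 'i \<Rightarrow> 'i \<Rightarrow> 'k"
  uc :: "'i \<Rightarrow> 'k"
  dc :: "'i \<Rightarrow> 'i \<Rightarrow> 'i \<Rightarrow> 'k"
  ec :: "'i \<Rightarrow> 'k"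
  sc :: "'i \<Rightarrow> 'i \<Rightarrow> 'k"

definition bv :: "'i \<Rightarrow> 'i \<Rightarrow> 'k::field" where
  "bv a = (\<lambda>i. if i = a then 1 else 0)"

definition svec :: "'k::field \<Rightarrow> ('a \<Rightarrow> 'k) \<Rightarrow> ('a \<Rightarrow> 'k)" where
  "svec c x = (\<lambda>i. c * x i)"

definition hmul :: "('i::finite, 'k::field) hopf_data \<Rightarrow> ('i \<Rightarrow> 'k) \<Rightarrow> ('i \<Rightarrow> 'k) \<Rightarrow> ('i \<Rightarrow> 'k)" where
  "hmul H x y = (\<lambda>l. \<Sum>i\<in>UNIV. \<Sum>j\<in>UNIV. x i * y j * mc H i j l)"

definition hone :: "('i::finite, 'k::field) hopf_data \<Rightarrow> ('i \<Rightarrow> 'k)" where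
  "hone H = uc H"

definition hcomul :: "('i::finite, 'k::field) hopf_data \<Rightarrow> ('i \<Rightarrow> 'k) \<Rightarrow> ('i \<times> 'i \<Rightarrow> 'k)" where
  "hcomul H x = (\<lambda>(a, b). \<Sum>i\<in>UNIV. x i * dc H i a b)"

definition heps :: "('i::finite, 'k::field) hopf_data \<Rightarrow> ('i \<Rightarrow> 'k) \<Rightarrow> 'k" where
  "heps H x = (\<Sum>i\<in>UNIV. x i * ec H i)"

definition hanti :: "('i::finite, 'k::field) hopf_data \<Rightarrow> ('i \<Rightarrow> 'k) \<Rightarrow> ('i \<Rightarrow> 'k)" where
  "hanti H x = (\<lambda>j. \<Sum>i\<in>UNIV. x i * sc H i j)"

definition tensor :: "('i \<Rightarrow> 'k::field) \<Rightarrow> ('i \<Rightarrow> 'k) \<Rightarrow> ('i \<times> 'i \<Rightarrow> 'k)" where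
  "tensor x y = (\<lambda>(a, b). x a * y b)"

definition tmul :: "('i::finite, 'k::field) hopf_data \<Rightarrow> ('i \<times> 'i \<Rightarrow> 'k) \<Rightarrow> ('i \<times> 'i \<Rightarrow> 'k) \<Rightarrow> ('i \<times> 'i \<Rightarrow> 'k)" where
  "tmul H t u = (\<lambda>(a, b). \<Sum>a1\<in>UNIV. \<Sum>b1\<in>UNIV. \<Sum>a2\<in>UNIV. \<Sum>b2\<in>UNIV.
      t (a1, b1) * u (a2, b2) * mc H a1 a2 a * mc H b1 b2 b)"

definition is_hopf_algebra :: "('i::finite, 'k::field) hopf_data \<Rightarrow> bool" where
  "is_hopf_algebra H \<longleftrightarrow>
     (\<forall>x y z. hmul H (hmul H x y) z = hmul H x (hmul H y z)) \<and>
     (\<forall>x. hmul H (hone H) x = x \<and> hmul H x (hone H) = x) \<and>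
     (\<forall>x. (\<lambda>(a, b, c). \<Sum>p\<in>UNIV. hcomul H x (p, c) * dc H p a b)
         = (\<lambda>(a, b, c). \<Sum>p\<in>UNIV. hcomul H x (a, p) * dc H p b c)) \<and>
     (\<forall>x. (\<lambda>c. \<Sum>a\<in>UNIV. ec H a * hcomul H x (a, c)) = x \<and>
          (\<lambda>a. \<Sum>b\<in>UNIV. hcomul H x (a, b) * ec H b) = x) \<and>
     (\<forall>x y. hcomul H (hmul H x y) = tmul H (hcomul H x) (hcomul H y)) \<and>
     hcomul H (hone H) = tensor (hone H) (hone H) \<and>
     (\<forall>x y. heps H (hmul H x y) = heps H x * heps H y) \<and>
     heps H (hone H) = 1 \<and>
     (\<forall>x. (\<Sum>a\<in>UNIV. \<Sum>b\<in>UNIV. svec (hcomul H x (a, b)) (hmul H (hanti H (bv a)) (bv b)))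
            = svec (heps H x) (hone H) \<and>
          (\<Sum>a\<in>UNIV. \<Sum>b\<in>UNIV. svec (hcomul H x (a, b)) (hmul H (bv a) (hanti H (bv b))))
            = svec (heps H x) (hone H))"

definition is_subspace :: "('a \<Rightarrow> 'k::field) set \<Rightarrow> bool" where
  "is_subspace V \<longleftrightarrow> 0 \<in> V \<and> (\<forall>x\<in>V. \<forall>y\<in>V. x + y \<in> V) \<and> (\<forall>c. \<forall>x\<in>V. svec c x \<in> V)"

definition left_ideal :: "('i::finite, 'k::field) hopf_data \<Rightarrow> ('i \<Rightarrow> 'k) set \<Rightarrow> bool" where
  "left_ideal H L \<longleftrightarrow> is_subspace L \<and> (\<forall>x. \<forall>l\<in>L. hmul H x l \<in> L)"

definition semisimple :: "('i::finite, 'k::field) hopf_data \<Rightarrow> bool" where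
  "semisimple H \<longleftrightarrow> (\<forall>L. left_ideal H L \<longrightarrow>
      (\<exists>L'. left_ideal H L' \<and> L \<inter> L' = {0} \<and> (\<forall>x. \<exists>u\<in>L. \<exists>v\<in>L'. x = u + v)))"

definition alg_closed :: "'k::field itself \<Rightarrow> bool" where
  "alg_closed _ \<longleftrightarrow> (\<forall>p :: 'k poly. degree p > 0 \<longrightarrow> (\<exists>z. poly p z = 0))"

definition tspan :: "('a \<Rightarrow> 'k::field) set \<Rightarrow> ('a \<Rightarrow> 'k) set" where
  "tspan S = module.span (\<lambda>c t. svec c t) S"

definition hopf_subalgebra :: "('i::finite, 'k::field) hopf_data \<Rightarrow> ('i \<Rightarrow> 'k) set \<Rightarrow> bool" where
  "hopf_subalgebra H K \<longleftrightarrow> is_subspace K \<and> hone H \<in> K \<and>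
     (\<forall>x\<in>K. \<forall>y\<in>K. hmul H x y \<in> K) \<and>
     (\<forall>x\<in>K. hcomul H x \<in> tspan {tensor u v | u v. u \<in> K \<and> v \<in> K}) \<and>
     (\<forall>x\<in>K. hanti H x \<in> K)"

definition hadj :: "('i::finite, 'k::field) hopf_data \<Rightarrow> ('i \<Rightarrow> 'k) \<Rightarrow> ('i \<Rightarrow> 'k) \<Rightarrow> ('i \<Rightarrow> 'k)" where
  "hadj H h x = (\<Sum>a\<in>UNIV. \<Sum>b\<in>UNIV.
      svec (hcomul H h (a, b)) (hmul H (hmul H (bv a) x) (hanti H (bv b))))"

definition normal_hopf_subalgebra :: "('i::finite, 'k::field) hopf_data \<Rightarrow> ('i \<Rightarrow> 'k) set \<Rightarrow> bool" where
  "normal_hopf_subalgebra H K \<longleftrightarrow> hopf_subalgebra H K \<and> (\<forall>h. \<forall>x\<in>K. hadj H h x \<in> K)"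

text \<open>Restriction to a set, extended by zero (functionals on A are represented as
functions on H vanishing outside A).\<close>
definition zrestr :: "('a \<Rightarrow> 'k::zero) \<Rightarrow> 'a set \<Rightarrow> ('a \<Rightarrow> 'k)" where
  "zrestr f A = (\<lambda>x. if x \<in> A then f x else 0)"

definition lin_on :: "('a \<Rightarrow> 'k::field) set \<Rightarrow> (('a \<Rightarrow> 'k) \<Rightarrow> 'k) \<Rightarrow> bool" where
  "lin_on A f \<longleftrightarrow> (\<forall>x\<in>A. \<forall>y\<in>A. f (x + y) = f x + f y) \<and> (\<forall>c. \<forall>x\<in>A. f (svec c x) = c * f x)"

definition dual_sp :: "('a \<Rightarrow> 'k::field) set \<Rightarrow> (('a \<Rightarrow> 'k) \<Rightarrow> 'k) set" where
  "dual_sp A = {f. lin_on A f \<and> (\<forall>x. x \<notin> A \<longrightarrow> f x = 0)}"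

definition is_rep :: "('i::finite, 'k::field) hopf_data \<Rightarrow> ('i \<Rightarrow> 'k) set \<Rightarrow> nat
    \<Rightarrow> (('i \<Rightarrow> 'k) \<Rightarrow> nat \<Rightarrow> nat \<Rightarrow> 'k) \<Rightarrow> bool" where
  "is_rep H A n \<rho> \<longleftrightarrow> (\<forall>p<n. \<forall>q<n.
      (\<forall>x\<in>A. \<forall>y\<in>A. \<rho> (x + y) p q = \<rho> x p q + \<rho> y p q) \<and>
      (\<forall>c. \<forall>x\<in>A. \<rho> (svec c x) p q = c * \<rho> x p q) \<and>
      (\<forall>x\<in>A. \<forall>y\<in>A. \<rho> (hmul H x y) p q = (\<Sum>r<n. \<rho> x p r * \<rho> y r q)) \<and>
      \<rho> (hone H) p q = (if p = q then 1 else 0))"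

definition character :: "('i \<Rightarrow> 'k::field) set \<Rightarrow> nat \<Rightarrow> (('i \<Rightarrow> 'k) \<Rightarrow> nat \<Rightarrow> nat \<Rightarrow> 'k)
    \<Rightarrow> (('i \<Rightarrow> 'k) \<Rightarrow> 'k)" where
  "character A n \<rho> = zrestr (\<lambda>x. \<Sum>p<n. \<rho> x p p) A"

definition char_ring :: "('i::finite, 'k::field) hopf_data \<Rightarrow> ('i \<Rightarrow> 'k) set \<Rightarrow> (('i \<Rightarrow> 'k) \<Rightarrow> 'k) set" where
  "char_ring H A = tspan {character A n \<rho> | n \<rho>. is_rep H A n \<rho>}"

text \<open>Convolution product on H^*: (F*G)(x) = sum F(x_1) G(x_2). For f, g in K^*
the product in K^* is the restriction to K of F*G for any linear extensions F, G.\<close>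
definition conv :: "('i::finite, 'k::field) hopf_data \<Rightarrow> (('i \<Rightarrow> 'k) \<Rightarrow> 'k) \<Rightarrow> (('i \<Rightarrow> 'k) \<Rightarrow> 'k)
    \<Rightarrow> (('i \<Rightarrow> 'k) \<Rightarrow> 'k)" where
  "conv H F G = (\<lambda>x. \<Sum>a\<in>UNIV. \<Sum>b\<in>UNIV. hcomul H x (a, b) * F (bv a) * G (bv b))"

definition inv_set :: "('i::finite, 'k::field) hopf_data \<Rightarrow> ('i \<Rightarrow> 'k) set \<Rightarrow> (('i \<Rightarrow> 'k) \<Rightarrow> 'k) set" where
  "inv_set H K = {f \<in> dual_sp K. \<forall>a. \<forall>x\<in>K. f (hadj H a x) = heps H a * f x}"

end

theory Submission
  imports Defs
begin

text \<open>The case where \<open>K\<close> is all of \<open>H\<close> already contains the theorem of Larson and Radford that \<open>S\<^sup>2 = id\<close>, so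
  this is where the work lies. Let \<open>\<Lambda>\<close> be the normalised integral, \<open>\<chi>(h) = tr L\<^sub>h\<close> the regular
  character and \<open>\<lambda>(h) = tr (L\<^sub>h S\<^sup>2)\<close>. The functional \<open>\<lambda>\<close> is a left integral on \<open>H\<close> with \<open>\<lambda>(\<Lambda>) = 1\<close>,
  hence a Frobenius form; its behaviour under \<open>S\<close> gives Radford's formula \<open>S\<^sup>4 = Ad g\<close> with \<open>g\<close>
  grouplike, so \<open>S\<close> has finite order, and comparing \<open>\<lambda>\<close> with \<open>\<chi>\<close> shows that \<open>S\<^sup>2\<close> is inner.
  Writing \<open>1\<close> as a sum of primitive idempotents that are eigenvectors of the implementing element, the
  trace of \<open>S\<^sup>2\<close> becomes a sum of terms \<open>|z|\<^sup>2\<close> with \<open>z\<close> a sum of roots of unity, one of them being \<open>1\<close>.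
  Thus \<open>\<lambda>(1) = tr S\<^sup>2\<close> is nonzero, which forces \<open>g = 1\<close> and \<open>S\<^sup>4 = id\<close>. Finally \<open>\<chi> / dim H\<close> is an
  idempotent of the dual algebra, and the trace of \<open>S\<^sup>2\<close> on the ideal it generates is both an integer and
  \<open>tr S\<^sup>2 / dim H\<close>, whence \<open>S\<^sup>2 = id\<close>.

  Characters of \<open>H\<close> span the trace functions, and these are invariant under the adjoint action because
  \<open>S(a\<^sub>2) a\<^sub>1 = \<epsilon>(a)\<close>. Conversely an invariant functional on \<open>K\<close> is extended linearly to \<open>H\<close> and then
  averaged over the adjoint action of \<open>\<Lambda>\<close>, which yields a trace function.\<close>

section \<open>Linear algebra in coordinates\<close>

lemma sum_fun_apply: "(\<Sum>a\<in>A. f a) x = (\<Sum>a\<in>A. f a x)"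
  for f :: "'a \<Rightarrow> 'b \<Rightarrow> 'c::comm_monoid_add"
  by (induction A rule: infinite_finite_induct) auto

lemma svec_apply [simp]: "svec c x i = c * x i"
  by (simp add: svec_def)

lemma svec_simps [simp]:
  "svec 1 x = x" "svec 0 x = 0" "svec c 0 = 0" "svec c (svec d x) = svec (c * d) x"
  by (auto simp: svec_def fun_eq_iff mult.assoc)

lemma svec_distrib:
  "svec c (x + y) = svec c x + svec c y" "svec c (x - y) = svec c x - svec c y"
  "svec (c + d) x = svec c x + svec d x" "svec (c - d) x = svec c x - svec d x"
  by (auto simp: fun_eq_iff algebra_simps)

lemma bv_sum:
  fixes f :: "'i::finite \<Rightarrow> 'k::field"
  shows "(\<Sum>j\<in>UNIV. bv i j * f j) = f i" "(\<Sum>j\<in>UNIV. f j * bv i j) = f i"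
    "(\<Sum>j\<in>UNIV. bv j i * f j) = f i" "(\<Sum>j\<in>UNIV. f j * bv j i) = f i"
  by (simp_all add: bv_def if_distrib[of "\<lambda>x. x * _"] if_distrib[of "\<lambda>x. _ * x"] cong: if_cong)

lemma svec_eq_0_iff: "svec c x = 0 \<longleftrightarrow> c = 0 \<or> x = 0"
  by (auto simp: fun_eq_iff)

lemma vec_expand: "x = (\<Sum>i\<in>UNIV. svec (x i) (bv i))" for x :: "'i::finite \<Rightarrow> 'k::field"
  by (auto simp: fun_eq_iff sum_fun_apply bv_sum)

abbreviation lin :: "(('a \<Rightarrow> 'k::field) \<Rightarrow> 'k) \<Rightarrow> bool" where
  "lin \<equiv> lin_on UNIV"

definition linop :: "(('a \<Rightarrow> 'k::field) \<Rightarrow> ('b \<Rightarrow> 'k)) \<Rightarrow> bool" where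
  "linop f \<longleftrightarrow> (\<forall>x y. f (x + y) = f x + f y) \<and> (\<forall>c x. f (svec c x) = svec c (f x))"

lemma linI: "(\<And>x y. f (x + y) = f x + f y) \<Longrightarrow> (\<And>c x. f (svec c x) = c * f x) \<Longrightarrow> lin f"
  by (simp add: lin_on_def)

lemma linD: "lin f \<Longrightarrow> f (x + y) = f x + f y" "lin f \<Longrightarrow> f (svec c x) = c * f x"
  by (simp_all add: lin_on_def)

lemma lin_0: "lin f \<Longrightarrow> f 0 = 0"
  using linD(2)[of f 0 0] by simp

lemma lin_diff: "lin f \<Longrightarrow> f (x - y) = f x - f y"
  using linD(1)[of f "x - y" y] by simp

lemma lin_sum: "lin f \<Longrightarrow> f (\<Sum>a\<in>A. g a) = (\<Sum>a\<in>A. f (g a))"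
  by (induction A rule: infinite_finite_induct) (auto simp: lin_0 linD)

lemma lin_expand: "lin f \<Longrightarrow> f x = (\<Sum>i\<in>UNIV. x i * f (bv i))"
  for x :: "'i::finite \<Rightarrow> 'k::field"
  by (subst vec_expand) (simp add: lin_sum linD)

lemma lin_coord: "lin (\<lambda>x. x i)"
  by (simp add: lin_on_def)

lemma linopI:
  "(\<And>x y. f (x + y) = f x + f y) \<Longrightarrow> (\<And>c x. f (svec c x) = svec c (f x)) \<Longrightarrow> linop f"
  by (simp add: linop_def)

lemma linopD: "linop f \<Longrightarrow> f (x + y) = f x + f y" "linop f \<Longrightarrow> f (svec c x) = svec c (f x)"
  by (simp_all add: linop_def)

lemma linop_0: "linop f \<Longrightarrow> f 0 = 0"
  using linopD(2)[of f 0 0] by simp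

lemma linop_diff: "linop f \<Longrightarrow> f (x - y) = f x - f y"
  using linopD(1)[of f "x - y" y] by simp

lemma linop_sum: "linop f \<Longrightarrow> f (\<Sum>a\<in>A. g a) = (\<Sum>a\<in>A. f (g a))"
  by (induction A rule: infinite_finite_induct) (auto simp: linop_0 linopD)

lemma lin_comp: "lin f \<Longrightarrow> linop g \<Longrightarrow> lin (\<lambda>x. f (g x))"
  by (simp add: lin_on_def linop_def)

lemma linop_comp: "linop f \<Longrightarrow> linop g \<Longrightarrow> linop (\<lambda>x. f (g x))"
  by (simp add: linop_def)

lemma linop_id: "linop (\<lambda>x. x)"
  by (simp add: linop_def)

lemma linop_add: "linop f \<Longrightarrow> linop g \<Longrightarrow> linop (\<lambda>x. f x + g x)"
  by (simp add: linop_def svec_distrib)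

lemma linop_diff_op: "linop f \<Longrightarrow> linop g \<Longrightarrow> linop (\<lambda>x. f x - g x)"
  by (simp add: linop_def svec_distrib)

lemma linop_svec: "linop f \<Longrightarrow> linop (\<lambda>x. svec c (f x))"
  by (simp add: linop_def svec_distrib mult.commute)

lemma linop_rank_one: "lin f \<Longrightarrow> linop (\<lambda>x. svec (f x) v)"
  by (simp add: linop_def lin_on_def svec_distrib)

lemma lin_times:
  "lin f \<Longrightarrow> lin (\<lambda>x. f x * c)" "lin f \<Longrightarrow> lin (\<lambda>x. c * f x)"
  by (simp_all add: lin_on_def algebra_simps)

section \<open>Traces and idempotent operators\<close>

definition trace :: "(('i::finite \<Rightarrow> 'k::field) \<Rightarrow> ('i \<Rightarrow> 'k)) \<Rightarrow> 'k" where
  "trace f = (\<Sum>i\<in>UNIV. f (bv i) i)"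

lemma trace_comm:
  fixes f g :: "('i::finite \<Rightarrow> 'k::field) \<Rightarrow> ('i \<Rightarrow> 'k)"
  assumes "linop f" "linop g"
  shows "trace (\<lambda>x. f (g x)) = trace (\<lambda>x. g (f x))"
proof -
  have e: "h x i = (\<Sum>j\<in>UNIV. x j * h (bv j) i)" if "linop h"
    for h :: "('i \<Rightarrow> 'k) \<Rightarrow> ('i \<Rightarrow> 'k)" and x i
    by (rule lin_expand) (use lin_comp[OF lin_coord that] in simp)
  show ?thesis
    unfolding trace_def e[OF assms(1), of "g _"] e[OF assms(2), of "f _"]
    by (subst sum.swap) (simp add: mult.commute)
qed

lemma trace_add: "trace (\<lambda>x. f x + g x) = trace f + trace g"
  by (simp add: trace_def sum.distrib)

lemma trace_diff: "trace (\<lambda>x. f x - g x) = trace f - trace g"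
  by (simp add: trace_def sum_subtractf)

lemma trace_svec: "trace (\<lambda>x. svec c (f x)) = c * trace f"
  by (simp add: trace_def sum_distrib_left)

lemma trace_sum: "trace (\<lambda>x. \<Sum>a\<in>A. f a x) = (\<Sum>a\<in>A. trace (f a))"
  unfolding trace_def sum_fun_apply by (rule sum.swap)

lemma trace_id: "trace (\<lambda>x. x :: 'i::finite \<Rightarrow> 'k::field) = of_nat (card (UNIV :: 'i set))"
  by (simp add: trace_def bv_def)

lemma trace_rank_one: "lin f \<Longrightarrow> trace (\<lambda>x. svec (f x) v) = f v"
  by (simp add: trace_def mult.commute[of "f _"] flip: lin_expand)

text \<open>A nonzero \<open>P\<close> fixes some \<open>v\<close> with \<open>v i\<close> nonzero.
  The \<open>i\<close>-th coordinate of \<open>P\<close>, scaled to be 1 at \<open>v\<close>, is a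
  functional \<open>\<phi>\<close>, and subtracting the rank-one map given by \<open>\<phi>\<close>
  and \<open>v\<close> leaves an idempotent whose image has vanishing coordinate \<open>i\<close>.
  The induction counts the coordinates that occur in the image.\<close>

lemma idempotent_operator_decomp:
  fixes P :: "('i::finite \<Rightarrow> 'k::field) \<Rightarrow> ('i \<Rightarrow> 'k)"
  assumes "linop P" "\<And>x. P (P x) = P x"
  shows "\<exists>(r::nat) \<phi> v. (\<forall>m<r. lin (\<phi> m)) \<and> (\<forall>m<r. \<forall>l<r. \<phi> m (v l) = of_bool (m = l))
          \<and> (\<forall>x. P x = (\<Sum>m<r. svec (\<phi> m x) (v m)))"
  using assms
proof (induction "card {i. \<exists>x. P x i \<noteq> 0}" arbitrary: P rule: less_induct)
  case less
  note P = less.prems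
  show ?case
  proof (cases "\<forall>x. P x = 0")
    case True
    then show ?thesis by (intro exI[of _ 0]) auto
  next
    case False
    then obtain x0 i where "P x0 i \<noteq> 0" by (auto simp: fun_eq_iff)
    define v where "v = P x0"
    have vi: "v i \<noteq> 0" and Pv: "P v = v"
      using \<open>P x0 i \<noteq> 0\<close> P(2) by (auto simp: v_def)
    define \<phi> where "\<phi> = (\<lambda>x. P x i / v i)"
    have \<phi>: "lin \<phi>"
      using linopD[OF P(1)] by (auto simp: \<phi>_def lin_on_def add_divide_distrib)
    have \<phi>v: "\<phi> v = 1" using vi by (simp add: \<phi>_def Pv)
    have \<phi>P: "\<phi> (P x) = \<phi> x" for x by (simp add: \<phi>_def P)
    define Q where "Q = (\<lambda>x. P x - svec (\<phi> x) v)"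
    have Q: "linop Q" unfolding Q_def by (intro linop_diff_op linop_rank_one P \<phi>)
    have \<phi>Q: "\<phi> (Q x) = 0" for x
      by (simp add: Q_def lin_diff[OF \<phi>] linD[OF \<phi>] \<phi>v \<phi>P)
    have PQ: "P (Q x) = Q x" for x
      by (simp add: Q_def linop_diff[OF P(1)] linopD[OF P(1)] P Pv)
    have QQ: "Q (Q x) = Q x" for x
      using PQ[of x] \<phi>Q[of x] by (simp add: Q_def fun_eq_iff)
    have Qv: "Q v = 0" by (simp add: Q_def \<phi>v Pv)
    have Qi: "Q x i = 0" for x using vi by (simp add: Q_def \<phi>_def)
    have "{j. \<exists>x. Q x j \<noteq> 0} \<subseteq> {j. \<exists>x. P x j \<noteq> 0} - {i}"
      using PQ Qi by (smt (verit, best) Diff_iff mem_Collect_eq singletonD subsetI)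
    also have "\<dots> \<subset> {j. \<exists>x. P x j \<noteq> 0}"
      using \<open>P x0 i \<noteq> 0\<close> by auto
    finally have "card {j. \<exists>x. Q x j \<noteq> 0} < card {j. \<exists>x. P x j \<noteq> 0}"
      by (intro psubset_card_mono) auto
    from less.hyps[OF this Q QQ] obtain r \<psi> u where
      ih: "\<forall>m<r. lin (\<psi> m)" "\<forall>m<r. \<forall>l<r. \<psi> m (u l) = of_bool (m = l)"
        "\<forall>x. Q x = (\<Sum>m<(r::nat). svec (\<psi> m x) (u m))" by blast
    have Qu: "Q (u l) = u l" if "l < r" for l
    proof -
      have "Q (u l) = (\<Sum>m<r. if m = l then u m else 0)"
        unfolding ih(3)[rule_format] using ih(2) that by (intro sum.cong) auto
      then show ?thesis using that by simp
    qed
    have \<phi>u: "\<phi> (u l) = 0" if "l < r" for l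
      using \<phi>Q[of "u l"] Qu[OF that] by simp
    have \<psi>Q: "\<psi> m (Q x) = \<psi> m x" if "m < r" for m x
    proof -
      have "\<psi> m (Q x) = (\<Sum>l<r. if l = m then \<psi> l x else 0)"
        unfolding ih(3)[rule_format] using ih that
        by (subst lin_sum) (auto intro!: sum.cong simp: linD)
      then show ?thesis using that by simp
    qed
    have \<psi>v: "\<psi> m v = 0" if "m < r" for m
      using \<psi>Q[OF that, of v] ih(1) that by (simp add: Qv lin_0)
    have 3: "P x = (\<Sum>m<Suc r. svec ((\<psi>(r := \<phi>)) m x) ((u(r := v)) m))" for x
    proof -
      have "P x = Q x + svec (\<phi> x) v" by (simp add: Q_def)
      moreover have "Q x = (\<Sum>m<r. svec ((\<psi>(r := \<phi>)) m x) ((u(r := v)) m))"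
        unfolding ih(3)[rule_format] by (intro sum.cong) auto
      ultimately show ?thesis by simp
    qed
    show ?thesis
      by (rule exI[of _ "Suc r"], rule exI[of _ "\<psi>(r := \<phi>)"], rule exI[of _ "u(r := v)"])
        (use 3 ih \<phi> \<phi>v \<phi>u \<psi>v in \<open>auto simp: less_Suc_eq\<close>)
  qed
qed

text \<open>The trace counts the rank-one terms of the decomposition, so in characteristic 0 an
  idempotent operator of trace 0 vanishes.\<close>

lemma trace_idempotent:
  fixes P :: "('i::finite \<Rightarrow> 'k::field_char_0) \<Rightarrow> ('i \<Rightarrow> 'k)"
  assumes "linop P" "\<And>x. P (P x) = P x"
  shows "\<exists>r::nat. trace P = of_nat r \<and> (r = 0 \<longrightarrow> (\<forall>x. P x = 0))"
proof -
  obtain r :: nat and \<phi> v where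
    d: "\<forall>m<r. lin (\<phi> m)" "\<forall>m<r. \<forall>l<r. \<phi> m (v l) = of_bool (m = l)"
       "\<forall>x. P x = (\<Sum>m<r. svec (\<phi> m x) (v m))"
    using idempotent_operator_decomp[OF assms] by blast
  have "trace P = trace (\<lambda>x. \<Sum>m<r. svec (\<phi> m x) (v m))"
    using d(3) by (simp add: trace_def)
  also have "\<dots> = (\<Sum>m<r. 1)"
    unfolding trace_sum using d by (intro sum.cong) (auto simp: trace_rank_one)
  finally show ?thesis using d(3) by (intro exI[of _ r]) auto
qed

text \<open>Gaussian elimination: a pivot vector \<open>b\<close> clears coordinate \<open>i\<close>
  from all the others, so one vector and one coordinate drop out together.\<close>

lemma nontrivial_relation:
  fixes v :: "'a \<Rightarrow> 'b \<Rightarrow> 'k::field"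
  assumes "finite I" "finite A" "card I < card A"
  shows "\<exists>c. (\<exists>a\<in>A. c a \<noteq> 0) \<and> (\<forall>i\<in>I. (\<Sum>a\<in>A. c a * v a i) = 0)"
  using assms
proof (induction I arbitrary: A v rule: finite_induct)
  case empty
  then have "\<exists>a. a \<in> A" by (metis all_not_in_conv card.empty less_irrefl)
  then show ?case by (intro exI[of _ "\<lambda>_. 1"]) auto
next
  case (insert i I)
  show ?case
  proof (cases "\<forall>a\<in>A. v a i = 0")
    case True
    then show ?thesis using insert.IH[of A v] insert.prems insert.hyps by auto
  next
    case False
    then obtain b where b: "b \<in> A" "v b i \<noteq> 0" by auto
    define w where "w = (\<lambda>a j. v a j - v a i / v b i * v b j)"
    have "card I < card (A - {b})" using insert b by simp
    from insert.IH[of "A - {b}" w, OF _ this] insert.prems obtain c where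
      c: "\<exists>a\<in>A - {b}. c a \<noteq> 0" "\<forall>j\<in>I. (\<Sum>a\<in>A - {b}. c a * w a j) = 0" by auto
    \<comment> \<open>The coefficient of the pivot accounts for the multiples of \<open>v b\<close>
      subtracted in \<open>w\<close>, so a relation for \<open>w\<close> becomes one for
      \<open>v\<close>.\<close>
    define d where "d = c(b := - (\<Sum>a\<in>A - {b}. c a * v a i / v b i))"
    have e: "(\<Sum>a\<in>A. d a * v a j) = (\<Sum>a\<in>A - {b}. c a * w a j)" for j
    proof -
      have "(\<Sum>a\<in>A. d a * v a j) = d b * v b j + (\<Sum>a\<in>A - {b}. c a * v a j)"
        using b insert.prems by (subst sum.remove[of _ b]) (auto simp: d_def intro!: sum.cong)
      also have "\<dots> = (\<Sum>a\<in>A - {b}. c a * w a j)"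
        by (simp add: d_def w_def algebra_simps sum_subtractf sum_distrib_left)
      finally show ?thesis .
    qed
    have "w a i = 0" for a using b by (simp add: w_def)
    then have "(\<Sum>a\<in>A. d a * v a j) = 0" if "j \<in> insert i I" for j
      using that c(2) unfolding e by auto
    moreover have "\<exists>a\<in>A. d a \<noteq> 0" using c(1) by (auto simp: d_def)
    ultimately show ?thesis by blast
  qed
qed

lemma is_subspace_diff: "is_subspace V \<Longrightarrow> x \<in> V \<Longrightarrow> y \<in> V \<Longrightarrow> x - y \<in> V"
proof -
  assume "is_subspace V" "x \<in> V" "y \<in> V"
  then have "x + svec (- 1) y \<in> V" by (simp add: is_subspace_def)
  moreover have "x + svec (- 1) y = x - y" by (simp add: fun_eq_iff)
  ultimately show ?thesis by simp
qed

text \<open>Take a nonzero polynomial \<open>p\<close> of least degree with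
  \<open>p(f) v = 0\<close>. A root of \<open>p\<close> splits off a linear factor; the cofactor,
  evaluated at \<open>f\<close> and applied to \<open>v\<close>, is nonzero by minimality and is the
  eigenvector sought.\<close>

lemma eigenvector_exists:
  fixes f :: "('i::finite \<Rightarrow> 'k::field) \<Rightarrow> ('i \<Rightarrow> 'k)"
  assumes ac: "alg_closed TYPE('k)" and f: "linop f"
    and V: "is_subspace V" "\<And>x. x \<in> V \<Longrightarrow> f x \<in> V" and v: "v \<in> V" "v \<noteq> 0"
  shows "\<exists>w z. w \<in> V \<and> w \<noteq> 0 \<and> f w = svec z w"
proof -
  \<comment> \<open>Horner's scheme: \<open>ev p\<close> is \<open>p(f)\<close> applied to
    \<open>v\<close>.\<close>
  define ev where "ev = (\<lambda>p. fold_coeffs (\<lambda>a w. svec a v + f w) p 0)"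
  have ev_0: "ev 0 = 0" by (simp add: ev_def)
  have ev_pCons: "ev (pCons a p) = svec a v + f (ev p)" for a p
    by (cases "p = 0"; cases "a = 0") (auto simp: ev_def linop_0[OF f])
  have ev_add: "ev (p + q) = ev p + ev q" for p q
  proof (induction p q rule: poly_induct2)
    case (pCons a p b q)
    then show ?case
      by (simp only: add_pCons ev_pCons linopD[OF f] svec_distrib add_ac)
  qed (simp add: ev_0)
  have ev_smult: "ev (smult c p) = svec c (ev p)" for c p
  proof (induction p)
    case (pCons a p)
    then show ?case
      by (simp only: smult_pCons ev_pCons linopD[OF f] svec_distrib svec_simps)
  qed (simp add: ev_0)
  have ev_monom: "ev (monom c n) = svec c ((f ^^ n) v)" for c n
  proof (induction n)
    case (Suc n)
    then show ?case
      by (simp only: monom_Suc ev_pCons linopD[OF f] svec_simps funpow.simps o_apply add_0)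
  qed (simp add: monom_0 ev_pCons ev_0 linop_0[OF f])
  have ev_sum: "ev (\<Sum>a\<in>A. g a) = (\<Sum>a\<in>A. ev (g a))" for g :: "nat \<Rightarrow> 'k poly" and A
    by (induction A rule: infinite_finite_induct) (auto simp: ev_0 ev_add)
  have ev_V: "ev p \<in> V" for p
  proof (induction p)
    case 0
    show ?case unfolding ev_0 using V(1) unfolding is_subspace_def by blast
  next
    case (pCons a p)
    then show ?case unfolding ev_pCons using V v unfolding is_subspace_def by blast
  qed
  \<comment> \<open>The range includes both ends, so there is one iterate of \<open>f\<close> at
    \<open>v\<close> more than there are coordinates.\<close>
  obtain c where c: "\<exists>a\<in>{..card (UNIV :: 'i set)}. c a \<noteq> 0"
      "\<forall>i\<in>UNIV. (\<Sum>a\<in>{..card (UNIV :: 'i set)}. c a * (f ^^ a) v i) = 0"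
    using nontrivial_relation[of "UNIV :: 'i set" "{..card (UNIV :: 'i set)}" "\<lambda>a. (f ^^ a) v"] by auto
  define p0 where "p0 = (\<Sum>a\<le>card (UNIV :: 'i set). monom (c a) a)"
  have "ev p0 = 0"
    using c(2) by (simp add: p0_def ev_sum ev_monom fun_eq_iff sum_fun_apply)
  moreover have "p0 \<noteq> 0"
  proof -
    from c(1) obtain a where a: "a \<le> card (UNIV :: 'i set)" "c a \<noteq> 0" by auto
    then have "coeff p0 a = c a" by (simp add: p0_def coeff_sum)
    then show ?thesis using a by auto
  qed
  ultimately obtain p where p: "p \<noteq> 0" "ev p = 0"
    and min: "\<And>q. q \<noteq> 0 \<Longrightarrow> ev q = 0 \<Longrightarrow> degree p \<le> degree q"
    using arg_min_nat_lemma[of "\<lambda>p. p \<noteq> 0 \<and> ev p = 0" p0 degree] by blast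
  have "degree p > 0"
  proof (rule ccontr)
    assume "\<not> degree p > 0"
    then obtain a where a: "p = [:a:]" using degree_eq_zeroE by auto
    then have "svec a v = 0" using p by (simp add: ev_pCons ev_0 linop_0[OF f])
    then show False using p a v by (auto simp: svec_eq_0_iff)
  qed
  then obtain z where "poly p z = 0" using ac by (auto simp: alg_closed_def)
  then obtain q where q: "p = [:- z, 1:] * q" by (auto simp: poly_eq_0_iff_dvd)
  then have "q \<noteq> 0" using p by auto
  then have "degree p = Suc (degree q)" unfolding q by (subst degree_mult_eq) auto
  with min[of q] \<open>q \<noteq> 0\<close> have "ev q \<noteq> 0" by auto
  moreover have "p = smult (- z) q + pCons 0 q" by (simp add: q)
  then have "ev p = svec (- z) (ev q) + f (ev q)" by (simp only: ev_add ev_smult ev_pCons svec_simps add_0)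
  with p have "f (ev q) = svec z (ev q)" by (simp add: fun_eq_iff)
  ultimately show ?thesis using ev_V by blast
qed

section \<open>Sweedler calculus\<close>

lemma sum_swap_pairs:
  "(\<Sum>a\<in>A. \<Sum>b\<in>B. \<Sum>c\<in>C. \<Sum>d\<in>D. f a b c d) = (\<Sum>c\<in>C. \<Sum>d\<in>D. \<Sum>a\<in>A. \<Sum>b\<in>B. f a b c d)"
  for f :: "_ \<Rightarrow> _ \<Rightarrow> _ \<Rightarrow> _ \<Rightarrow> _::comm_monoid_add"
proof -
  have "(\<Sum>a\<in>A. \<Sum>b\<in>B. \<Sum>c\<in>C. \<Sum>d\<in>D. f a b c d) = (\<Sum>a\<in>A. \<Sum>c\<in>C. \<Sum>b\<in>B. \<Sum>d\<in>D. f a b c d)"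
    by (rule sum.cong[OF refl], rule sum.swap)
  also have "\<dots> = (\<Sum>c\<in>C. \<Sum>a\<in>A. \<Sum>d\<in>D. \<Sum>b\<in>B. f a b c d)"
    by (subst sum.swap, rule sum.cong[OF refl], rule sum.cong[OF refl], rule sum.swap)
  also have "\<dots> = (\<Sum>c\<in>C. \<Sum>d\<in>D. \<Sum>a\<in>A. \<Sum>b\<in>B. f a b c d)"
    by (rule sum.cong[OF refl], rule sum.swap)
  finally show ?thesis .
qed

locale hopf =
  fixes H :: "('i::finite, 'k::field) hopf_data"
  assumes hopf: "is_hopf_algebra H"
begin

abbreviation mul (infixl "\<cdot>" 70) where "x \<cdot> y \<equiv> hmul H x y"
abbreviation one ("\<one>") where "\<one> \<equiv> hone H"
abbreviation eps ("\<epsilon>") where "\<epsilon> \<equiv> heps H"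
abbreviation antip ("\<S>") where "\<S> \<equiv> hanti H"

lemma mul_assoc: "x \<cdot> y \<cdot> z = x \<cdot> (y \<cdot> z)"
  and one_mul [simp]: "\<one> \<cdot> x = x" and mul_one [simp]: "x \<cdot> \<one> = x"
  and eps_mul [simp]: "\<epsilon> (x \<cdot> y) = \<epsilon> x * \<epsilon> y" and eps_one [simp]: "\<epsilon> \<one> = 1"
  using hopf by (auto simp: is_hopf_algebra_def)

lemma linop_mul_left: "linop f \<Longrightarrow> linop (\<lambda>x. f x \<cdot> y)"
  by (rule linopI)
    (auto simp: linop_def hmul_def fun_eq_iff algebra_simps sum.distrib sum_distrib_left)

lemma linop_mul_right: "linop f \<Longrightarrow> linop (\<lambda>x. y \<cdot> f x)"
  by (rule linopI)
    (auto simp: linop_def hmul_def fun_eq_iff algebra_simps sum.distrib sum_distrib_left)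

lemma linop_antip: "linop f \<Longrightarrow> linop (\<lambda>x. \<S> (f x))"
  by (rule linopI)
    (auto simp: linop_def hanti_def fun_eq_iff algebra_simps sum.distrib sum_distrib_left)

lemma lin_eps: "linop f \<Longrightarrow> lin (\<lambda>x. \<epsilon> (f x))"
  by (rule linI)
    (auto simp: linop_def heps_def algebra_simps sum.distrib sum_distrib_left)

lemmas linop_intros = linop_id linop_mul_left linop_mul_right linop_antip

lemma mul_simps [simp]:
  "0 \<cdot> y = 0" "y \<cdot> 0 = 0" "svec c x \<cdot> y = svec c (x \<cdot> y)" "y \<cdot> svec c x = svec c (y \<cdot> x)"
  using linop_0[OF linop_mul_left[OF linop_id], of y] linop_0[OF linop_mul_right[OF linop_id], of y]
    linopD(2)[OF linop_mul_left[OF linop_id], of c x y]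
    linopD(2)[OF linop_mul_right[OF linop_id], of y c x] by auto

lemma mul_distrib:
  "(x + x') \<cdot> y = x \<cdot> y + x' \<cdot> y" "y \<cdot> (x + x') = y \<cdot> x + y \<cdot> x'"
  "(x - x') \<cdot> y = x \<cdot> y - x' \<cdot> y" "y \<cdot> (x - x') = y \<cdot> x - y \<cdot> x'"
  by (rule linopD(1)[OF linop_mul_left[OF linop_id]] linopD(1)[OF linop_mul_right[OF linop_id]]
      linop_diff[OF linop_mul_left[OF linop_id]] linop_diff[OF linop_mul_right[OF linop_id]])+

lemma mul_sum: "(\<Sum>a\<in>A. f a) \<cdot> y = (\<Sum>a\<in>A. f a \<cdot> y)" "y \<cdot> (\<Sum>a\<in>A. f a) = (\<Sum>a\<in>A. y \<cdot> f a)"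
  by (rule linop_sum[OF linop_mul_left[OF linop_id]] linop_sum[OF linop_mul_right[OF linop_id]])+

text \<open>\<open>sw x F\<close> is the Sweedler sum \<open>F(x\<^sub>1, x\<^sub>2)\<close>. Identities between vectors are proved by applying an
  arbitrary linear functional to both sides.\<close>

definition sw :: "('i \<Rightarrow> 'k) \<Rightarrow> (('i \<Rightarrow> 'k) \<Rightarrow> ('i \<Rightarrow> 'k) \<Rightarrow> 'k) \<Rightarrow> 'k" where
  "sw x F = (\<Sum>a\<in>UNIV. \<Sum>b\<in>UNIV. hcomul H x (a, b) * F (bv a) (bv b))"

lemma hcomul_bv: "hcomul H (bv i) (a, b) = dc H i a b"
  by (simp add: hcomul_def bv_sum)

lemma hcomul_linear:
  "hcomul H (x + y) ab = hcomul H x ab + hcomul H y ab"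
  "hcomul H (svec c x) ab = c * hcomul H x ab"
  by (cases ab; simp add: hcomul_def algebra_simps sum.distrib sum_distrib_left)+

lemma sw_cong: "(\<And>p q. F p q = G p q) \<Longrightarrow> sw x F = sw x G"
  by (simp add: sw_def)

lemma lin_sw: "linop f \<Longrightarrow> lin (\<lambda>x. sw (f x) F)"
  by (rule linI)
    (auto simp: linop_def sw_def hcomul_linear algebra_simps sum.distrib sum_distrib_left)

lemma lin_sw_fun: "(\<And>p q. lin (\<lambda>x. F x p q)) \<Longrightarrow> lin (\<lambda>x. sw y (F x))"
  by (rule linI)
    (auto simp: lin_on_def sw_def algebra_simps sum.distrib sum_distrib_left)

lemma sw_times: "sw x (\<lambda>p q. c * F p q) = c * sw x F" "sw x (\<lambda>p q. F p q * c) = sw x F * c"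
  by (auto simp: sw_def algebra_simps sum_distrib_left)

lemma sw_commute:
  "sw x (\<lambda>p q. sw y (\<lambda>r s. G p q r s)) = sw y (\<lambda>r s. sw x (\<lambda>p q. G p q r s))"
  unfolding sw_def sum_distrib_left by (subst sum_swap_pairs) (simp add: mult.left_commute)

text \<open>The arguments of \<open>G\<close> are only ever basis vectors, so this is
  coassociativity of the structure constants summed against the values of \<open>G\<close>.\<close>

lemma sw_coassoc:
  "sw x (\<lambda>p q. sw p (\<lambda>r s. G r s q)) = sw x (\<lambda>p q. sw q (\<lambda>r s. G p r s))"
proof -
  have c: "(\<Sum>p\<in>UNIV. hcomul H x (p, c) * dc H p a b) = (\<Sum>p\<in>UNIV. hcomul H x (a, p) * dc H p b c)"
    for a b c
  proof -
    have "(\<lambda>(a, b, c). \<Sum>p\<in>UNIV. hcomul H x (p, c) * dc H p a b)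
        = (\<lambda>(a, b, c). \<Sum>p\<in>UNIV. hcomul H x (a, p) * dc H p b c)"
      using hopf unfolding is_hopf_algebra_def by blast
    from fun_cong[OF this, of "(a, b, c)"] show ?thesis by simp
  qed
  have "sw x (\<lambda>p q. sw p (\<lambda>r s. G r s q)) = (\<Sum>p\<in>UNIV. \<Sum>c\<in>UNIV. \<Sum>a\<in>UNIV. \<Sum>b\<in>UNIV.
     hcomul H x (p, c) * dc H p a b * G (bv a) (bv b) (bv c))"
    by (simp add: sw_def hcomul_bv sum_distrib_left mult.assoc)
  also have "\<dots> = (\<Sum>a\<in>UNIV. \<Sum>b\<in>UNIV. \<Sum>c\<in>UNIV. \<Sum>p\<in>UNIV.
     hcomul H x (p, c) * dc H p a b * G (bv a) (bv b) (bv c))"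
    by (rule trans[OF sum_swap_pairs], rule sum.cong[OF refl], rule sum.cong[OF refl], rule sum.swap)
  also have "\<dots> = (\<Sum>a\<in>UNIV. \<Sum>b\<in>UNIV. \<Sum>c\<in>UNIV. \<Sum>p\<in>UNIV.
     hcomul H x (a, p) * dc H p b c * G (bv a) (bv b) (bv c))"
    by (simp only: c flip: sum_distrib_right)
  also have "\<dots> = (\<Sum>a\<in>UNIV. \<Sum>p\<in>UNIV. \<Sum>b\<in>UNIV. \<Sum>c\<in>UNIV.
     hcomul H x (a, p) * dc H p b c * G (bv a) (bv b) (bv c))"
    by (rule sum.cong[OF refl], rule trans[OF _ sum.swap], rule sum.cong[OF refl], rule sum.swap)
  also have "\<dots> = sw x (\<lambda>p q. sw q (\<lambda>r s. G p r s))"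
    by (simp add: sw_def hcomul_bv sum_distrib_left mult.assoc)
  finally show ?thesis .
qed

lemma sw_counit_left: "lin F \<Longrightarrow> sw x (\<lambda>p q. \<epsilon> p * F q) = F x"
proof -
  assume F: "lin F"
  have "(\<lambda>c. \<Sum>a\<in>UNIV. ec H a * hcomul H x (a, c)) = x"
    using hopf by (auto simp: is_hopf_algebra_def)
  then have x: "x c = (\<Sum>a\<in>UNIV. ec H a * hcomul H x (a, c))" for c
    by (metis (no_types, lifting))
  have "sw x (\<lambda>p q. \<epsilon> p * F q) = (\<Sum>b\<in>UNIV. \<Sum>a\<in>UNIV. ec H a * hcomul H x (a, b) * F (bv b))"
    unfolding sw_def heps_def bv_sum by (subst sum.swap) (simp add: mult_ac)
  also have "\<dots> = F x"
    unfolding lin_expand[OF F, of x] by (subst x) (simp add: sum_distrib_right)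
  finally show ?thesis .
qed

lemma sw_counit_right: "lin F \<Longrightarrow> sw x (\<lambda>p q. \<epsilon> q * F p) = F x"
proof -
  assume F: "lin F"
  have "(\<lambda>a. \<Sum>b\<in>UNIV. hcomul H x (a, b) * ec H b) = x"
    using hopf by (auto simp: is_hopf_algebra_def)
  then have x: "x a = (\<Sum>b\<in>UNIV. hcomul H x (a, b) * ec H b)" for a
    by (metis (no_types, lifting))
  have "sw x (\<lambda>p q. \<epsilon> q * F p) = (\<Sum>a\<in>UNIV. \<Sum>b\<in>UNIV. hcomul H x (a, b) * ec H b * F (bv a))"
    unfolding sw_def heps_def bv_sum by (simp add: mult_ac)
  also have "\<dots> = F x"
    unfolding lin_expand[OF F, of x] by (subst x) (simp add: sum_distrib_right)
  finally show ?thesis .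
qed

text \<open>Evaluates a bilinear form on a pure tensor; it turns the tensor identities among the
  Hopf axioms into Sweedler identities.\<close>

lemma pairing_tensor:
  fixes F :: "('i \<Rightarrow> 'k) \<Rightarrow> ('i \<Rightarrow> 'k) \<Rightarrow> 'k"
  assumes "\<And>y. lin (\<lambda>x. F x y)" "\<And>x. lin (F x)"
  shows "(\<Sum>a\<in>UNIV. \<Sum>b\<in>UNIV. x a * y b * F (bv a) (bv b)) = F x y"
  by (subst lin_expand[OF assms(1)], subst lin_expand[OF assms(2)])
    (simp add: sum_distrib_left mult.assoc)

lemma sw_one:
  fixes F :: "('i \<Rightarrow> 'k) \<Rightarrow> ('i \<Rightarrow> 'k) \<Rightarrow> 'k"
  assumes "\<And>y. lin (\<lambda>x. F x y)" "\<And>x. lin (F x)"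
  shows "sw \<one> F = F \<one> \<one>"
proof -
  have "hcomul H \<one> = tensor \<one> \<one>" using hopf by (auto simp: is_hopf_algebra_def)
  then show ?thesis using pairing_tensor[OF assms, of \<one> \<one>] by (simp add: sw_def tensor_def)
qed

lemma bv_mul: "bv a \<cdot> bv b = mc H a b"
  by (simp add: hmul_def fun_eq_iff bv_sum mult.assoc flip: sum_distrib_left)

lemma sw_mul:
  fixes F :: "('i \<Rightarrow> 'k) \<Rightarrow> ('i \<Rightarrow> 'k) \<Rightarrow> 'k"
  assumes "\<And>y. lin (\<lambda>x. F x y)" "\<And>x. lin (F x)"
  shows "sw (x \<cdot> y) F = sw x (\<lambda>p q. sw y (\<lambda>r s. F (p \<cdot> r) (q \<cdot> s)))"
proof -
  have "hcomul H (x \<cdot> y) = tmul H (hcomul H x) (hcomul H y)"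
    using hopf by (auto simp: is_hopf_algebra_def)
  then have "sw (x \<cdot> y) F = (\<Sum>a\<in>UNIV. \<Sum>b\<in>UNIV. \<Sum>a1\<in>UNIV. \<Sum>b1\<in>UNIV. \<Sum>a2\<in>UNIV. \<Sum>b2\<in>UNIV.
      hcomul H x (a1, b1) * hcomul H y (a2, b2) * (mc H a1 a2 a * mc H b1 b2 b * F (bv a) (bv b)))"
    by (simp add: sw_def tmul_def sum_distrib_right mult.assoc)
  also have "\<dots> = (\<Sum>a1\<in>UNIV. \<Sum>b1\<in>UNIV. \<Sum>a2\<in>UNIV. \<Sum>b2\<in>UNIV. \<Sum>a\<in>UNIV. \<Sum>b\<in>UNIV.
      hcomul H x (a1, b1) * hcomul H y (a2, b2) * (mc H a1 a2 a * mc H b1 b2 b * F (bv a) (bv b)))"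
    by (rule trans[OF sum_swap_pairs], rule sum.cong[OF refl], rule sum.cong[OF refl], rule sum_swap_pairs)
  also have "\<dots> = sw x (\<lambda>p q. sw y (\<lambda>r s. F (p \<cdot> r) (q \<cdot> s)))" (is "?L = _")
  proof -
    have "(\<Sum>a\<in>UNIV. \<Sum>b\<in>UNIV. k * (m a * n b * F (bv a) (bv b))) = k * F m n" for k m n
      by (simp only: pairing_tensor[OF assms] flip: sum_distrib_left)
    then have "?L = (\<Sum>a1\<in>UNIV. \<Sum>b1\<in>UNIV. \<Sum>a2\<in>UNIV. \<Sum>b2\<in>UNIV.
        hcomul H x (a1, b1) * hcomul H y (a2, b2) * F (mc H a1 a2) (mc H b1 b2))"
      by simp
    then show ?thesis by (simp add: sw_def bv_mul sum_distrib_left mult.assoc)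
  qed
  finally show ?thesis .
qed

lemma lin_sw_vector:
  assumes "lin F"
  shows "F (\<Sum>a\<in>UNIV. \<Sum>b\<in>UNIV. svec (hcomul H x (a, b)) (G (bv a) (bv b))) = sw x (\<lambda>p q. F (G p q))"
  by (simp add: lin_sum[OF assms] linD[OF assms] sw_def)

lemma sw_antipode_left: "lin F \<Longrightarrow> sw x (\<lambda>p q. F (\<S> p \<cdot> q)) = \<epsilon> x * F \<one>"
proof -
  assume F: "lin F"
  have "(\<Sum>a\<in>UNIV. \<Sum>b\<in>UNIV. svec (hcomul H x (a, b)) (\<S> (bv a) \<cdot> bv b)) = svec (\<epsilon> x) \<one>"
    using hopf by (auto simp: is_hopf_algebra_def)
  with lin_sw_vector[OF F, of x "\<lambda>p q. \<S> p \<cdot> q"] show ?thesis by (simp add: linD[OF F])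
qed

lemma sw_antipode_right: "lin F \<Longrightarrow> sw x (\<lambda>p q. F (p \<cdot> \<S> q)) = \<epsilon> x * F \<one>"
proof -
  assume F: "lin F"
  have "(\<Sum>a\<in>UNIV. \<Sum>b\<in>UNIV. svec (hcomul H x (a, b)) (bv a \<cdot> \<S> (bv b))) = svec (\<epsilon> x) \<one>"
    using hopf by (auto simp: is_hopf_algebra_def)
  with lin_sw_vector[OF F, of x "\<lambda>p q. p \<cdot> \<S> q"] show ?thesis by (simp add: linD[OF F])
qed

lemma vec_eqI:
  fixes x y :: "'i \<Rightarrow> 'k"
  assumes "\<And>F. lin F \<Longrightarrow> F x = F y"
  shows "x = y"
  by (rule ext) (rule assms[OF lin_coord])

section \<open>The antipode reverses products and coproducts\<close>

lemma antip_one [simp]: "\<S> \<one> = \<one>"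
proof (rule vec_eqI)
  fix F :: "('i \<Rightarrow> 'k) \<Rightarrow> 'k" assume F: "lin F"
  have "sw \<one> (\<lambda>p q. F (\<S> p \<cdot> q)) = F (\<S> \<one> \<cdot> \<one>)"
    by (rule sw_one) (intro lin_comp[OF F] linop_intros)+
  then show "F (\<S> \<one>) = F \<one>" by (simp add: sw_antipode_left[OF F])
qed

lemma eps_antip [simp]: "\<epsilon> (\<S> x) = \<epsilon> x"
proof -
  have "sw x (\<lambda>p q. \<epsilon> (\<S> p \<cdot> q)) = sw x (\<lambda>p q. \<epsilon> q * \<epsilon> (\<S> p))"
    by (rule sw_cong) simp
  also have "\<dots> = \<epsilon> (\<S> x)"
    by (rule sw_counit_right) (intro lin_eps linop_intros)
  finally show ?thesis
    using sw_antipode_left[OF lin_eps[OF linop_id], of x] by simp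
qed

text \<open>Both sides are convolution inverses of the multiplication. The sixfold sum over
  \<open>G\<close> is evaluated twice: cancelling the second components of \<open>x\<close> and
  \<open>y\<close> against the third ones leaves \<open>\<S> (x \<cdot> y)\<close>, cancelling the
  first against the second ones leaves \<open>\<S> y \<cdot> \<S> x\<close>.\<close>

lemma antip_mul: "\<S> (x \<cdot> y) = \<S> y \<cdot> \<S> x"
proof (rule vec_eqI)
  fix F :: "('i \<Rightarrow> 'k) \<Rightarrow> 'k" assume F: "lin F"
  define G where "G = (\<lambda>x1 x2 x3 y1 y2 y3. F (\<S> (x1 \<cdot> y1) \<cdot> (x2 \<cdot> y2) \<cdot> (\<S> y3 \<cdot> \<S> x3)))"
  have 1: "sw y' (\<lambda>y2 y3. F (A \<cdot> (x2 \<cdot> y2) \<cdot> (\<S> y3 \<cdot> \<S> x3))) = \<epsilon> y' * F (A \<cdot> (x2 \<cdot> \<S> x3))"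
    for A x2 x3 y'
  proof -
    have "lin (\<lambda>z. F (A \<cdot> x2 \<cdot> z \<cdot> \<S> x3))" by (intro lin_comp[OF F] linop_intros)
    from sw_antipode_right[OF this, of y'] show ?thesis by (simp add: mul_assoc)
  qed
  have 2: "sw x' (\<lambda>x2 x3. F (A \<cdot> (x2 \<cdot> \<S> x3))) = \<epsilon> x' * F A" for A x'
  proof -
    have "lin (\<lambda>z. F (A \<cdot> z))" by (intro lin_comp[OF F] linop_intros)
    from sw_antipode_right[OF this, of x'] show ?thesis by simp
  qed
  have "sw x (\<lambda>x1 x'. sw y (\<lambda>y1 y'. sw x' (\<lambda>x2 x3. sw y' (\<lambda>y2 y3. G x1 x2 x3 y1 y2 y3))))
      = sw x (\<lambda>x1 x'. \<epsilon> x' * sw y (\<lambda>y1 y'. \<epsilon> y' * F (\<S> (x1 \<cdot> y1))))"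
    unfolding G_def 1 sw_times 2 by (simp only: mult.left_commute sw_times)
  also have "\<dots> = sw x (\<lambda>x1 x'. \<epsilon> x' * F (\<S> (x1 \<cdot> y)))"
    by (intro sw_cong arg_cong2[of _ _ _ _ "(*)"] refl sw_counit_right lin_comp[OF F] linop_intros)
  also have "\<dots> = F (\<S> (x \<cdot> y))"
    by (intro sw_counit_right lin_comp[OF F] linop_intros)
  finally have A: "sw x (\<lambda>x1 x'. sw y (\<lambda>y1 y'. sw x' (\<lambda>x2 x3. sw y' (\<lambda>y2 y3.
      G x1 x2 x3 y1 y2 y3)))) = F (\<S> (x \<cdot> y))" .
  have 3: "sw u (\<lambda>x1 x2. sw v (\<lambda>y1 y2. G x1 x2 x3 y1 y2 y3)) = \<epsilon> v * (\<epsilon> u * F (\<S> y3 \<cdot> \<S> x3))"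
    for u v x3 y3
  proof -
    have "sw (u \<cdot> v) (\<lambda>p q. F (\<S> p \<cdot> q \<cdot> (\<S> y3 \<cdot> \<S> x3))) =
        sw u (\<lambda>x1 x2. sw v (\<lambda>y1 y2. G x1 x2 x3 y1 y2 y3))"
      unfolding G_def by (intro sw_mul lin_comp[OF F] linop_intros)
    moreover have "lin (\<lambda>z. F (z \<cdot> (\<S> y3 \<cdot> \<S> x3)))" by (intro lin_comp[OF F] linop_intros)
    ultimately show ?thesis
      using sw_antipode_left[of "\<lambda>z. F (z \<cdot> (\<S> y3 \<cdot> \<S> x3))" "u \<cdot> v"] by (simp add: mult_ac)
  qed
  have "sw x (\<lambda>x1 x'. sw y (\<lambda>y1 y'. sw x' (\<lambda>x2 x3. sw y' (\<lambda>y2 y3. G x1 x2 x3 y1 y2 y3))))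
      = sw x (\<lambda>x1 x'. sw x' (\<lambda>x2 x3. sw y (\<lambda>y1 y'. sw y' (\<lambda>y2 y3. G x1 x2 x3 y1 y2 y3))))"
    by (intro sw_cong sw_commute)
  also have "\<dots> = sw x (\<lambda>u x3. sw u (\<lambda>x1 x2. sw y (\<lambda>v y3. sw v (\<lambda>y1 y2. G x1 x2 x3 y1 y2 y3))))"
    unfolding sw_coassoc[symmetric] ..
  also have "\<dots> = sw x (\<lambda>u x3. sw y (\<lambda>v y3. sw u (\<lambda>x1 x2. sw v (\<lambda>y1 y2. G x1 x2 x3 y1 y2 y3))))"
    by (intro sw_cong sw_commute)
  also have "\<dots> = sw x (\<lambda>u x3. sw y (\<lambda>v y3. \<epsilon> v * (\<epsilon> u * F (\<S> y3 \<cdot> \<S> x3))))"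
    unfolding 3 ..
  also have "\<dots> = sw x (\<lambda>u x3. \<epsilon> u * F (\<S> y \<cdot> \<S> x3))"
    by (intro sw_cong sw_counit_left lin_times(2) lin_comp[OF F] linop_intros)
  also have "\<dots> = F (\<S> y \<cdot> \<S> x)"
    by (intro sw_counit_left lin_comp[OF F] linop_intros)
  finally show "F (\<S> (x \<cdot> y)) = F (\<S> y \<cdot> \<S> x)" using A by simp
qed

text \<open>Again uniqueness of convolution inverses, now of the comultiplication. In a sum over
  five components of \<open>x\<close>, with \<open>(s, t)\<close> the coproduct of
  \<open>\<S> x\<^sub>1\<close>, the last four cancel as \<open>x\<^sub>3\<close> against
  \<open>\<S> x\<^sub>4\<close> and then \<open>x\<^sub>2\<close> against
  \<open>\<S> x\<^sub>5\<close>; alternatively \<open>\<S> x\<^sub>1 \<cdot> x\<^sub>2\<close>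
  collapses before the coproduct is taken.\<close>

lemma sw_antip:
  fixes F :: "('i \<Rightarrow> 'k) \<Rightarrow> ('i \<Rightarrow> 'k) \<Rightarrow> 'k"
  assumes F1: "\<And>y. lin (\<lambda>x. F x y)" and F2: "\<And>x. lin (F x)"
  shows "sw (\<S> x) F = sw x (\<lambda>p q. F (\<S> q) (\<S> p))"
proof -
  define G where "G = (\<lambda>s t x2 x3 x4 x5. F (s \<cdot> x2 \<cdot> \<S> x5) (t \<cdot> x3 \<cdot> \<S> x4))"
  have 1: "sw m (\<lambda>x3 x4. F a (t \<cdot> x3 \<cdot> \<S> x4)) = \<epsilon> m * F a t" for m a t
  proof -
    have "lin (\<lambda>z. F a (t \<cdot> z))" by (intro lin_comp[OF F2] linop_intros)
    from sw_antipode_right[OF this, of m] show ?thesis by (simp add: mul_assoc)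
  qed
  have 2: "sw z (\<lambda>x2 x5. F (s \<cdot> x2 \<cdot> \<S> x5) t) = \<epsilon> z * F s t" for z s t
  proof -
    have "lin (\<lambda>z. F (s \<cdot> z) t)" by (intro lin_comp[OF F1] linop_intros)
    from sw_antipode_right[OF this, of z] show ?thesis by (simp add: mul_assoc)
  qed
  have 3: "sw x' (\<lambda>y z. sw y (\<lambda>x2 x3. sw z (\<lambda>x4 x5. G s t x2 x3 x4 x5))) = \<epsilon> x' * F s t" for x' s t
  proof -
    have "sw x' (\<lambda>y z. sw y (\<lambda>x2 x3. sw z (\<lambda>x4 x5. G s t x2 x3 x4 x5)))
        = sw x' (\<lambda>x2 r. sw r (\<lambda>x3 z. sw z (\<lambda>x4 x5. G s t x2 x3 x4 x5)))"
      by (rule sw_coassoc)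
    also have "\<dots> = sw x' (\<lambda>x2 r. sw r (\<lambda>m x5. sw m (\<lambda>x3 x4. G s t x2 x3 x4 x5)))"
      by (intro sw_cong sw_coassoc[symmetric])
    also have "\<dots> = sw x' (\<lambda>x2 r. sw r (\<lambda>m x5. \<epsilon> m * F (s \<cdot> x2 \<cdot> \<S> x5) t))"
      unfolding G_def 1 ..
    also have "\<dots> = sw x' (\<lambda>x2 x5. F (s \<cdot> x2 \<cdot> \<S> x5) t)"
      by (intro sw_cong sw_counit_left lin_comp[OF F1] linop_intros)
    finally show ?thesis unfolding 2 .
  qed
  have 4: "sw w (\<lambda>x1 y. sw (\<S> x1) (\<lambda>s t. sw y (\<lambda>x2 x3. G s t x2 x3 x4 x5))) = \<epsilon> w * F (\<S> x5) (\<S> x4)"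
    for w x4 x5
  proof -
    have "sw w (\<lambda>x1 y. sw (\<S> x1) (\<lambda>s t. sw y (\<lambda>x2 x3. G s t x2 x3 x4 x5)))
        = sw w (\<lambda>x1 y. sw (\<S> x1 \<cdot> y) (\<lambda>s t. F (s \<cdot> \<S> x5) (t \<cdot> \<S> x4)))"
      unfolding G_def by (intro sw_cong sw_mul[symmetric] lin_comp[OF F1] lin_comp[OF F2] linop_intros)
    also have "\<dots> = \<epsilon> w * sw \<one> (\<lambda>s t. F (s \<cdot> \<S> x5) (t \<cdot> \<S> x4))"
      by (intro sw_antipode_left lin_sw linop_intros)
    also have "sw \<one> (\<lambda>s t. F (s \<cdot> \<S> x5) (t \<cdot> \<S> x4)) = F (\<one> \<cdot> \<S> x5) (\<one> \<cdot> \<S> x4)"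
      by (intro sw_one lin_comp[OF F1] lin_comp[OF F2] linop_intros)
    finally show ?thesis by simp
  qed
  have "sw (\<S> x) F = sw x (\<lambda>x1 x'. \<epsilon> x' * sw (\<S> x1) F)"
    by (intro sw_counit_right[symmetric] lin_sw linop_intros)
  also have "\<dots> = sw x (\<lambda>x1 x'. sw (\<S> x1) (\<lambda>s t. sw x' (\<lambda>y z. sw y (\<lambda>x2 x3. sw z (\<lambda>x4 x5.
      G s t x2 x3 x4 x5)))))"
    unfolding 3 sw_times ..
  also have "\<dots> = sw x (\<lambda>x1 x'. sw x' (\<lambda>y z. sw (\<S> x1) (\<lambda>s t. sw y (\<lambda>x2 x3. sw z (\<lambda>x4 x5.
      G s t x2 x3 x4 x5)))))"
    by (intro sw_cong sw_commute)
  also have "\<dots> = sw x (\<lambda>w z. sw w (\<lambda>x1 y. sw (\<S> x1) (\<lambda>s t. sw y (\<lambda>x2 x3. sw z (\<lambda>x4 x5.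
      G s t x2 x3 x4 x5)))))"
    by (rule sw_coassoc[symmetric])
  also have "\<dots> = sw x (\<lambda>w z. sw z (\<lambda>x4 x5. sw w (\<lambda>x1 y. sw (\<S> x1) (\<lambda>s t. sw y (\<lambda>x2 x3.
      G s t x2 x3 x4 x5)))))"
  proof (intro sw_cong)
    fix w z
    have "sw w (\<lambda>x1 y. sw (\<S> x1) (\<lambda>s t. sw y (\<lambda>x2 x3. sw z (\<lambda>x4 x5. G s t x2 x3 x4 x5))))
        = sw w (\<lambda>x1 y. sw (\<S> x1) (\<lambda>s t. sw z (\<lambda>x4 x5. sw y (\<lambda>x2 x3. G s t x2 x3 x4 x5))))"
      by (intro sw_cong sw_commute)
    also have "\<dots> = sw w (\<lambda>x1 y. sw z (\<lambda>x4 x5. sw (\<S> x1) (\<lambda>s t. sw y (\<lambda>x2 x3. G s t x2 x3 x4 x5))))"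
      by (intro sw_cong sw_commute)
    also have "\<dots> = sw z (\<lambda>x4 x5. sw w (\<lambda>x1 y. sw (\<S> x1) (\<lambda>s t. sw y (\<lambda>x2 x3. G s t x2 x3 x4 x5))))"
      by (rule sw_commute)
    finally show "sw w (\<lambda>x1 y. sw (\<S> x1) (\<lambda>s t. sw y (\<lambda>x2 x3. sw z (\<lambda>x4 x5. G s t x2 x3 x4 x5)))) = \<dots>" .
  qed
  also have "\<dots> = sw x (\<lambda>w z. \<epsilon> w * sw z (\<lambda>x4 x5. F (\<S> x5) (\<S> x4)))"
    unfolding 4 sw_times ..
  also have "\<dots> = sw x (\<lambda>p q. F (\<S> q) (\<S> p))"
    by (intro sw_counit_left lin_sw linop_intros)
  finally show ?thesis .
qed

end

section \<open>Integrals\<close>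

text \<open>The vector \<open>y\<close> and the images of the basis are linearly dependent, and
  injectivity forces the coefficient of \<open>y\<close> to be nonzero.\<close>

lemma linop_injective_imp_surjective:
  fixes f :: "('i::finite \<Rightarrow> 'k::field) \<Rightarrow> ('i \<Rightarrow> 'k)"
  assumes f: "linop f" and inj: "\<And>x. f x = 0 \<Longrightarrow> x = 0"
  shows "\<exists>x. f x = y"
proof -
  \<comment> \<open>The option type indexes one vector more than the dimension, with
    \<open>None\<close> standing for \<open>y\<close>.\<close>
  let ?v = "\<lambda>a. case a of None \<Rightarrow> y | Some i \<Rightarrow> f (bv i)"
  have "card (UNIV :: 'i set) < card (UNIV :: 'i option set)"
    by (simp add: UNIV_option_conv card_image)
  from nontrivial_relation[OF _ _ this, of ?v] obtain c where
    c: "\<exists>a. c a \<noteq> 0" "\<And>i. (\<Sum>a\<in>UNIV. c a * ?v a i) = 0" by auto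
  define x where "x = (\<lambda>i. c (Some i))"
  have "(\<Sum>i\<in>UNIV. svec (x i) (f (bv i))) = f x"
    by (subst (2) vec_expand) (simp add: linop_sum[OF f] linopD[OF f])
  moreover have "(\<Sum>a\<in>UNIV. c a * ?v a i) = c None * y i + (\<Sum>j\<in>UNIV. svec (x j) (f (bv j))) i" for i
    by (simp add: UNIV_option_conv sum.reindex sum_fun_apply x_def)
  ultimately have e: "c None * y i + f x i = 0" for i using c(2)[of i] by simp
  have "c None \<noteq> 0"
  proof
    assume 0: "c None = 0"
    then have "f x = 0" using e by (simp add: fun_eq_iff)
    then have "x = 0" by (rule inj)
    then have "c (Some i) = 0" for i by (simp add: x_def fun_eq_iff)
    then show False using c(1) 0 by (metis option.exhaust)
  qed
  then have "f (svec (- 1 / c None) x) = y"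
    using e by (simp add: linopD[OF f] fun_eq_iff field_simps neg_eq_iff_add_eq_0)
  then show ?thesis by blast
qed

context hopf
begin

lemma left_ideal_principal: "left_ideal H (range (\<lambda>h. h \<cdot> y))"
proof -
  have "0 \<in> range (\<lambda>h. h \<cdot> y)" by (rule image_eqI[of _ _ 0]) auto
  moreover have "a \<cdot> y + b \<cdot> y \<in> range (\<lambda>h. h \<cdot> y)" for a b
    by (rule image_eqI[of _ _ "a + b"]) (auto simp: mul_distrib)
  moreover have "svec c (a \<cdot> y) \<in> range (\<lambda>h. h \<cdot> y)" for c a
    by (rule image_eqI[of _ _ "svec c a"]) auto
  moreover have "b \<cdot> (a \<cdot> y) \<in> range (\<lambda>h. h \<cdot> y)" for a b
    by (rule image_eqI[of _ _ "b \<cdot> a"]) (auto simp: mul_assoc)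
  ultimately show ?thesis by (auto simp: left_ideal_def is_subspace_def)
qed

lemma sw_sum: "sw x (\<lambda>p q. \<Sum>k\<in>A. F k p q) = (\<Sum>k\<in>A. sw x (F k))"
proof -
  have "sw x (\<lambda>p q. \<Sum>k\<in>A. F k p q)
      = (\<Sum>a\<in>UNIV. \<Sum>b\<in>UNIV. \<Sum>k\<in>A. hcomul H x (a, b) * F k (bv a) (bv b))"
    by (simp add: sw_def sum_distrib_left)
  also have "\<dots> = (\<Sum>a\<in>UNIV. \<Sum>k\<in>A. \<Sum>b\<in>UNIV. hcomul H x (a, b) * F k (bv a) (bv b))"
    by (rule sum.cong[OF refl], rule sum.swap)
  also have "\<dots> = (\<Sum>k\<in>A. sw x (F k))"
    unfolding sw_def by (rule sum.swap)
  finally show ?thesis .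
qed

lemma sw_expand: "sw x F = (\<Sum>m\<in>UNIV. x m * sw (bv m) F)"
  by (rule lin_expand[OF lin_sw[OF linop_id]])

definition swv :: "('i \<Rightarrow> 'k) \<Rightarrow> (('i \<Rightarrow> 'k) \<Rightarrow> ('i \<Rightarrow> 'k) \<Rightarrow> ('i \<Rightarrow> 'k)) \<Rightarrow> ('i \<Rightarrow> 'k)" where
  "swv x G = (\<Sum>a\<in>UNIV. \<Sum>b\<in>UNIV. svec (hcomul H x (a, b)) (G (bv a) (bv b)))"

lemma lin_swv: "lin F \<Longrightarrow> F (swv x G) = sw x (\<lambda>p q. F (G p q))"
  unfolding swv_def by (rule lin_sw_vector)

lemma sw_antip2:
  fixes F :: "('i \<Rightarrow> 'k) \<Rightarrow> ('i \<Rightarrow> 'k) \<Rightarrow> 'k"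
  assumes F1: "\<And>y. lin (\<lambda>x. F x y)" and F2: "\<And>x. lin (F x)"
  shows "sw (\<S> (\<S> x)) F = sw x (\<lambda>p q. F (\<S> (\<S> p)) (\<S> (\<S> q)))"
proof -
  have "sw (\<S> (\<S> x)) F = sw (\<S> x) (\<lambda>p q. F (\<S> q) (\<S> p))"
    by (intro sw_antip F1 F2)
  also have "\<dots> = sw x (\<lambda>p q. F (\<S> (\<S> p)) (\<S> (\<S> q)))"
    by (intro sw_antip lin_comp[OF F1] lin_comp[OF F2] linop_intros)
  finally show ?thesis .
qed

text \<open>Cyclicity of the trace for the composite of a left coaction, an operator on the second
  tensor factor, and another left coaction.\<close>

lemma sum_sw_cyclic:
  assumes T: "linop T"
  shows "(\<Sum>k\<in>UNIV. sw (bv k) (\<lambda>p q. sw (T q) (\<lambda>r s. G p r * s k)))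
       = (\<Sum>m\<in>UNIV. sw (bv m) (\<lambda>r s. sw s (\<lambda>p q. G p r * T q m)))"
proof -
  have "(\<Sum>k\<in>UNIV. sw (bv k) (\<lambda>p q. sw (T q) (\<lambda>r s. G p r * s k)))
      = (\<Sum>k\<in>UNIV. \<Sum>m\<in>UNIV. sw (bv k) (\<lambda>p q. sw (bv m) (\<lambda>r s. T q m * (G p r * s k))))"
    by (subst (2) sw_expand) (simp add: sw_sum sw_times)
  also have "\<dots> = (\<Sum>m\<in>UNIV. \<Sum>k\<in>UNIV. sw (bv m) (\<lambda>r s. sw (bv k) (\<lambda>p q. T q m * (G p r * s k))))"
    by (subst sum.swap, rule sum.cong[OF refl], rule sum.cong[OF refl], rule sw_commute)
  also have "\<dots> = (\<Sum>m\<in>UNIV. sw (bv m) (\<lambda>r s. \<Sum>k\<in>UNIV. s k * sw (bv k) (\<lambda>p q. G p r * T q m)))"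
    by (simp add: sw_sum mult_ac flip: sw_times)
  also have "\<dots> = (\<Sum>m\<in>UNIV. sw (bv m) (\<lambda>r s. sw s (\<lambda>p q. G p r * T q m)))"
    by (simp flip: sw_expand)
  finally show ?thesis .
qed

section \<open>The twisted regular trace as a left integral of the dual algebra\<close>

definition lam :: "('i \<Rightarrow> 'k) \<Rightarrow> 'k" where
  "lam h = trace (\<lambda>x. h \<cdot> \<S> (\<S> x))"

lemma lin_lam: "lin lam"
  unfolding lam_def
  by (rule linI) (simp_all add: mul_distrib trace_add trace_svec)

text \<open>Cyclicity of the trace carries left multiplication by \<open>y\<close> past the algebra
  map S^2: thus S^2 is the Nakayama automorphism of the form \<open>lam\<close>.\<close>

lemma lam_cyclic: "lam (y \<cdot> z) = lam (z \<cdot> \<S> (\<S> y))"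
proof -
  have "lam (y \<cdot> z) = trace (\<lambda>x. y \<cdot> (z \<cdot> \<S> (\<S> x)))"
    by (simp add: lam_def mul_assoc)
  also have "\<dots> = trace (\<lambda>x. z \<cdot> \<S> (\<S> (y \<cdot> x)))"
    by (rule trace_comm) (intro linop_intros)+
  also have "\<dots> = lam (z \<cdot> \<S> (\<S> y))"
    by (simp add: lam_def mul_assoc antip_mul)
  finally show ?thesis .
qed

lemma lam_left_integral:
  assumes F: "lin F"
  shows "sw h (\<lambda>p q. F p * lam q) = lam h * F \<one>"
proof -
  define T where "T = (\<lambda>x. h \<cdot> \<S> (\<S> x))"
  have T: "linop T" unfolding T_def by (intro linop_intros)
  \<comment> \<open>Expanding the coproduct of \<open>T x\<^sub>2\<close> produces
    \<open>\<S> (\<S> x\<^sub>2) \<cdot> \<S> x\<^sub>1\<close>, which is the antipode of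
    \<open>x\<^sub>1 \<cdot> \<S> x\<^sub>2\<close> and cancels.\<close>
  have 1: "sw h (\<lambda>p q. F p * (q \<cdot> \<S> (\<S> x)) k) = sw x (\<lambda>x1 x2. sw (T x2) (\<lambda>r s. F (r \<cdot> \<S> x1) * s k))"
    for x k
  proof -
    have a: "sw y (\<lambda>x1 a. F (p \<cdot> \<S> (\<S> a) \<cdot> \<S> x1)) = \<epsilon> y * F p" for p y
    proof -
      have "lin (\<lambda>z. F (p \<cdot> \<S> z))" by (intro lin_comp[OF F] linop_intros)
      from sw_antipode_right[OF this, of y] show ?thesis by (simp add: antip_mul mul_assoc)
    qed
    have "sw x (\<lambda>x1 x2. sw (T x2) (\<lambda>r s. F (r \<cdot> \<S> x1) * s k))
        = sw x (\<lambda>x1 x2. sw h (\<lambda>p q. sw (\<S> (\<S> x2)) (\<lambda>r s. F (p \<cdot> r \<cdot> \<S> x1) * (q \<cdot> s) k)))"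
      unfolding T_def
      by (intro sw_cong sw_mul lin_times lin_comp[OF F] linop_intros lin_coord)
    also have "\<dots> = sw x (\<lambda>x1 x2. sw h (\<lambda>p q. sw x2 (\<lambda>a b.
        F (p \<cdot> \<S> (\<S> a) \<cdot> \<S> x1) * (q \<cdot> \<S> (\<S> b)) k)))"
      by (intro sw_cong sw_antip2 lin_times lin_comp[OF F] lin_comp[OF lin_coord] linop_intros)
    also have "\<dots> = sw h (\<lambda>p q. sw x (\<lambda>x1 x2. sw x2 (\<lambda>a b.
        F (p \<cdot> \<S> (\<S> a) \<cdot> \<S> x1) * (q \<cdot> \<S> (\<S> b)) k)))"
      by (rule sw_commute)
    also have "\<dots> = sw h (\<lambda>p q. sw x (\<lambda>y b. sw y (\<lambda>x1 a.
        F (p \<cdot> \<S> (\<S> a) \<cdot> \<S> x1) * (q \<cdot> \<S> (\<S> b)) k)))"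
      by (intro sw_cong sw_coassoc[symmetric])
    also have "\<dots> = sw h (\<lambda>p q. sw x (\<lambda>y b. \<epsilon> y * (F p * (q \<cdot> \<S> (\<S> b)) k)))"
      unfolding sw_times a by (simp only: mult.assoc)
    also have "\<dots> = sw h (\<lambda>p q. F p * (q \<cdot> \<S> (\<S> x)) k)"
      by (intro sw_cong sw_counit_left lin_times lin_comp[OF lin_coord] linop_intros)
    finally show ?thesis by simp
  qed
  have 2: "sw y (\<lambda>r p. F (r \<cdot> \<S> p)) = \<epsilon> y * F \<one>" for y
    by (rule sw_antipode_right[OF F])
  have "sw h (\<lambda>p q. F p * lam q) = (\<Sum>k\<in>UNIV. sw h (\<lambda>p q. F p * (q \<cdot> \<S> (\<S> (bv k))) k))"
    by (simp add: lam_def trace_def sum_distrib_left sw_sum)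
  \<comment> \<open>Cyclicity of the trace brings \<open>r\<close> next to \<open>\<S> p\<close>,
    where the two are adjacent Sweedler components and cancel; what remains is the trace of
    \<open>T\<close>.\<close>
  also have "\<dots> = (\<Sum>m\<in>UNIV. sw (bv m) (\<lambda>r s. sw s (\<lambda>p q. F (r \<cdot> \<S> p) * T q m)))"
    unfolding 1 by (rule sum_sw_cyclic[OF T])
  also have "\<dots> = (\<Sum>m\<in>UNIV. sw (bv m) (\<lambda>y q. sw y (\<lambda>r p. F (r \<cdot> \<S> p) * T q m)))"
    by (intro sum.cong refl sw_coassoc[symmetric])
  also have "\<dots> = (\<Sum>m\<in>UNIV. sw (bv m) (\<lambda>y q. \<epsilon> y * (F \<one> * T q m)))"
    unfolding sw_times 2 by (simp only: mult.assoc)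
  also have "\<dots> = (\<Sum>m\<in>UNIV. F \<one> * T (bv m) m)"
    by (intro sum.cong refl sw_counit_left lin_times lin_comp[OF lin_coord] T)
  also have "\<dots> = lam h * F \<one>"
    by (simp add: lam_def trace_def T_def sum_distrib_left mult.commute)
  finally show ?thesis .
qed

end

locale semisimple_hopf = hopf H for H :: "('i::finite, 'k::field_char_0) hopf_data" +
  assumes alg_closed: "alg_closed TYPE('k)" and semisimple: "semisimple H"
begin

text \<open>Split the identity as \<open>e + e'\<close> along \<open>L\<close> and a complement
  \<open>L'\<close>. For \<open>l\<close> in \<open>L\<close> the element
  \<open>l \<cdot> e' = l - l \<cdot> e\<close> lies in both ideals, hence is 0.\<close>

lemma left_ideal_unit: "left_ideal H L \<Longrightarrow> \<exists>e\<in>L. \<forall>l\<in>L. l \<cdot> e = l"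
proof -
  assume L: "left_ideal H L"
  then obtain L' where L': "left_ideal H L'" "L \<inter> L' = {0}" "\<forall>x. \<exists>u\<in>L. \<exists>v\<in>L'. x = u + v"
    using semisimple unfolding semisimple_def by meson
  then obtain e e' where e: "e \<in> L" "e' \<in> L'" "\<one> = e + e'" by blast
  have "l \<cdot> e = l" if l: "l \<in> L" for l
  proof -
    have "l = l \<cdot> e + l \<cdot> e'" using e(3) mul_one[of l] by (simp add: mul_distrib)
    then have "l \<cdot> e' = l - l \<cdot> e" by (simp add: algebra_simps)
    moreover have "l - l \<cdot> e \<in> L"
      using L l e(1) by (intro is_subspace_diff) (auto simp: left_ideal_def)
    moreover have "l \<cdot> e' \<in> L'" using L' e by (auto simp: left_ideal_def)
    ultimately have "l - l \<cdot> e = 0" using L'(2) by (metis IntI singletonD)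
    then show ?thesis by simp
  qed
  then show ?thesis using e by blast
qed

text \<open>The left ideal generated by \<open>t\<close> is the line through \<open>t\<close>. It
  has a right unit, yet \<open>t \<cdot> t = 0\<close>.\<close>

lemma left_integral_eps_0:
  assumes "\<And>x. x \<cdot> t = svec (\<epsilon> x) t" "\<epsilon> t = 0"
  shows "t = 0"
proof -
  obtain e where e: "e \<in> range (\<lambda>h. h \<cdot> t)" "\<forall>l\<in>range (\<lambda>h. h \<cdot> t). l \<cdot> e = l"
    using left_ideal_unit[OF left_ideal_principal] by blast
  then obtain h where h: "e = svec (\<epsilon> h) t" using assms by auto
  have "\<one> \<cdot> t \<cdot> e = \<one> \<cdot> t" using e by blast
  then show ?thesis using h assms by simp
qed

text \<open>The component \<open>t\<close> of the identity in a complement of the augmentation ideal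
  works: \<open>x \<cdot> t - svec (\<epsilon> x) t\<close> lies in both the complement and the
  kernel of \<open>\<epsilon>\<close>.\<close>

lemma integral_exists: "\<exists>t. (\<forall>x. x \<cdot> t = svec (\<epsilon> x) t) \<and> \<epsilon> t = 1"
proof -
  have "left_ideal H {x. \<epsilon> x = 0}"
    using lin_0[OF lin_eps[OF linop_id]] linD[OF lin_eps[OF linop_id]]
    by (auto simp: left_ideal_def is_subspace_def)
  then obtain L where L: "left_ideal H L" "{x. \<epsilon> x = 0} \<inter> L = {0}" "\<forall>x. \<exists>u\<in>{x. \<epsilon> x = 0}. \<exists>v\<in>L. x = u + v"
    using semisimple unfolding semisimple_def by meson
  then obtain u t where t: "\<epsilon> u = 0" "t \<in> L" "\<one> = u + t" by blast
  have "\<epsilon> t = 1"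
    using linD(1)[OF lin_eps[OF linop_id], of u t] t by (metis add_0 eps_one)
  moreover have "x \<cdot> t = svec (\<epsilon> x) t" for x
  proof -
    have "x \<cdot> t - svec (\<epsilon> x) t \<in> L"
      using L(1) t by (intro is_subspace_diff) (auto simp: left_ideal_def is_subspace_def)
    moreover have "\<epsilon> (x \<cdot> t - svec (\<epsilon> x) t) = 0"
      by (simp add: lin_diff[OF lin_eps[OF linop_id]] linD[OF lin_eps[OF linop_id]] \<open>\<epsilon> t = 1\<close>)
    ultimately have "x \<cdot> t - svec (\<epsilon> x) t = 0" using L(2) by blast
    then show ?thesis by simp
  qed
  ultimately show ?thesis by blast
qed

definition integ ("\<Lambda>") where "\<Lambda> = (SOME t. (\<forall>x. x \<cdot> t = svec (\<epsilon> x) t) \<and> \<epsilon> t = 1)"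

lemma integ_left [simp]: "x \<cdot> \<Lambda> = svec (\<epsilon> x) \<Lambda>" and eps_integ [simp]: "\<epsilon> \<Lambda> = 1"
  using someI_ex[OF integral_exists] by (auto simp: integ_def)

lemma left_integral_unique:
  assumes "\<And>x. x \<cdot> t = svec (\<epsilon> x) t"
  shows "t = svec (\<epsilon> t) \<Lambda>"
proof -
  have "t - svec (\<epsilon> t) \<Lambda> = 0"
    by (rule left_integral_eps_0)
      (simp_all add: assms mul_distrib svec_distrib mult.commute
        lin_diff[OF lin_eps[OF linop_id]] linD[OF lin_eps[OF linop_id]])
  then show ?thesis by simp
qed

text \<open>\<open>\<Lambda> \<cdot> x\<close> is again a left integral, so it is a multiple of
  \<Lambda>, determined by \<open>\<epsilon>\<close>: the Hopf algebra is unimodular.\<close>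

lemma integ_right [simp]: "\<Lambda> \<cdot> x = svec (\<epsilon> x) \<Lambda>"
  using left_integral_unique[of "\<Lambda> \<cdot> x"] by (simp flip: mul_assoc)

lemma lam_integ [simp]: "lam \<Lambda> = 1"
  unfolding lam_def integ_right eps_antip
  by (simp add: trace_rank_one[OF lin_eps[OF linop_id]])

text \<open>Insert \<open>x\<^sub>2 \<cdot> \<S> x\<^sub>3\<close> into the second factor and absorb
  the coproduct of the remaining part of \<open>x\<close> by
  \<open>\<Lambda> \<cdot> y = svec (\<epsilon> y) \<Lambda>\<close>.\<close>

lemma sw_integ_move:
  fixes G :: "('i \<Rightarrow> 'k) \<Rightarrow> ('i \<Rightarrow> 'k) \<Rightarrow> 'k"
  assumes G1: "\<And>y. lin (\<lambda>x. G x y)" and G2: "\<And>x. lin (G x)"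
  shows "sw \<Lambda> (\<lambda>p q. G (p \<cdot> x) q) = sw \<Lambda> (\<lambda>p q. G p (q \<cdot> \<S> x))"
proof -
  note li = lin_comp[OF G1] lin_comp[OF G2] linop_intros
  have 1: "sw z (\<lambda>x2 x3. G a (q \<cdot> x2 \<cdot> \<S> x3)) = \<epsilon> z * G a q" for z q a
  proof -
    have "lin (\<lambda>z. G a (q \<cdot> z))" by (intro li)
    from sw_antipode_right[OF this, of z] show ?thesis by (simp add: mul_assoc)
  qed
  have 2: "sw \<Lambda> (\<lambda>p q. sw y (\<lambda>x1 x2. G (p \<cdot> x1) (q \<cdot> x2 \<cdot> \<S> x3)))
      = \<epsilon> y * sw \<Lambda> (\<lambda>p q. G p (q \<cdot> \<S> x3))" for y x3
  proof -
    have "sw (\<Lambda> \<cdot> y) (\<lambda>p q. G p (q \<cdot> \<S> x3))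
        = sw \<Lambda> (\<lambda>p q. sw y (\<lambda>x1 x2. G (p \<cdot> x1) (q \<cdot> x2 \<cdot> \<S> x3)))"
      by (intro sw_mul li)
    then show ?thesis by (simp add: linD[OF lin_sw[OF linop_id]])
  qed
  have "sw \<Lambda> (\<lambda>p q. G (p \<cdot> x) q) = sw \<Lambda> (\<lambda>p q. sw x (\<lambda>x1 z. \<epsilon> z * G (p \<cdot> x1) q))"
    by (intro sw_cong sw_counit_right[symmetric] li)
  also have "\<dots> = sw \<Lambda> (\<lambda>p q. sw x (\<lambda>x1 z. sw z (\<lambda>x2 x3. G (p \<cdot> x1) (q \<cdot> x2 \<cdot> \<S> x3))))"
    unfolding 1 ..
  also have "\<dots> = sw \<Lambda> (\<lambda>p q. sw x (\<lambda>y x3. sw y (\<lambda>x1 x2. G (p \<cdot> x1) (q \<cdot> x2 \<cdot> \<S> x3))))"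
    by (intro sw_cong sw_coassoc[symmetric])
  also have "\<dots> = sw x (\<lambda>y x3. sw \<Lambda> (\<lambda>p q. sw y (\<lambda>x1 x2. G (p \<cdot> x1) (q \<cdot> x2 \<cdot> \<S> x3))))"
    by (rule sw_commute)
  also have "\<dots> = sw \<Lambda> (\<lambda>p q. G p (q \<cdot> \<S> x))"
    unfolding 2 by (intro sw_counit_left lin_sw_fun li)
  finally show ?thesis .
qed

text \<open>Moving \<open>x\<close> to the other factor leaves \<open>lam\<close> alone on the
  second component of \<Lambda>, where the integral property applies. Since \<open>x\<close> is
  recovered from \<open>\<S> x\<close>, the antipode is injective.\<close>

lemma sw_lam_antip:
  assumes F: "lin F"
  shows "sw \<Lambda> (\<lambda>p q. lam (q \<cdot> \<S> x) * F p) = F x"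
proof -
  have "sw \<Lambda> (\<lambda>p q. lam (q \<cdot> \<S> x) * F p) = sw \<Lambda> (\<lambda>p q. lam q * F (p \<cdot> x))"
    by (rule sw_integ_move[symmetric]) (intro lin_times F lin_lam)+
  also have "\<dots> = sw \<Lambda> (\<lambda>p q. F (p \<cdot> x) * lam q)" by (simp only: mult.commute)
  also have "\<dots> = lam \<Lambda> * F (\<one> \<cdot> x)"
    by (rule lam_left_integral) (intro lin_comp[OF F] linop_intros)
  finally show ?thesis by simp
qed

lemma antip_eq_0: "\<S> x = 0 \<Longrightarrow> x = 0"
proof (rule vec_eqI)
  fix F :: "('i \<Rightarrow> 'k) \<Rightarrow> 'k" assume F: "lin F" and 0: "\<S> x = 0"
  show "F x = F 0"
    using sw_lam_antip[OF F, of x] by (simp add: 0 lin_0[OF lin_lam] lin_0[OF F] sw_def)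
qed

lemma antip_surj: "\<exists>x. \<S> x = y"
  by (rule linop_injective_imp_surjective[OF linop_antip[OF linop_id] antip_eq_0])

text \<open>Surjectivity of the antipode makes \<open>\<S> \<Lambda>\<close> a left integral as
  well, with the same augmentation.\<close>

lemma antip_integ [simp]: "\<S> \<Lambda> = \<Lambda>"
proof -
  have "x \<cdot> \<S> \<Lambda> = svec (\<epsilon> x) (\<S> \<Lambda>)" for x
  proof -
    obtain y where y: "x = \<S> y" using antip_surj by metis
    have "x \<cdot> \<S> \<Lambda> = \<S> (\<Lambda> \<cdot> y)" by (simp add: y antip_mul del: integ_right)
    then show ?thesis by (simp add: y linopD[OF linop_antip[OF linop_id]])
  qed
  from left_integral_unique[OF this] show ?thesis by simp
qed

lemma lam_nondegenerate: "(\<And>y. lam (y \<cdot> a) = 0) \<Longrightarrow> a = 0"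
proof -
  assume 0: "\<And>y. lam (y \<cdot> a) = 0"
  obtain x where x: "a = \<S> x" using antip_surj by metis
  have "x = 0"
    by (rule vec_eqI) (use sw_lam_antip[of _ x] 0 in \<open>simp add: sw_def lin_0 flip: x\<close>)
  then show ?thesis by (simp add: x linop_0[OF linop_antip[OF linop_id]])
qed

text \<open>The elements \<open>\<S> \<Lambda>\<^sub>1\<close> and \<open>\<Lambda>\<^sub>2\<close>
  are dual bases for the Frobenius form \<open>lam\<close>. The left integral property expands
  \<open>lam (h \<cdot> \<S> p)\<close> so that \<open>\<S> p\<^sub>2\<close> meets \<open>q\<close>
  and cancels.\<close>

lemma lam_dual_basis:
  assumes F: "lin F"
  shows "sw \<Lambda> (\<lambda>p q. lam (h \<cdot> \<S> p) * F q) = F h"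
proof -
  note li = lin_times lin_comp[OF F] lin_comp[OF lin_lam] linop_intros
  have 1: "lam y * F q = sw y (\<lambda>r s. F (r \<cdot> q) * lam s)" for y q
    using lam_left_integral[of "\<lambda>r. F (r \<cdot> q)" y] lin_comp[OF F linop_mul_left[OF linop_id]] by simp
  have 2: "sw y (\<lambda>p2 q. F (h1 \<cdot> \<S> p2 \<cdot> q)) = \<epsilon> y * F h1" for y h1
  proof -
    have "lin (\<lambda>z. F (h1 \<cdot> z))" by (intro li)
    from sw_antipode_left[OF this, of y] show ?thesis by (simp add: mul_assoc)
  qed
  have "sw \<Lambda> (\<lambda>p q. lam (h \<cdot> \<S> p) * F q) = sw \<Lambda> (\<lambda>p q. sw (h \<cdot> \<S> p) (\<lambda>r s. F (r \<cdot> q) * lam s))"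
    by (simp only: 1)
  also have "\<dots> = sw \<Lambda> (\<lambda>p q. sw h (\<lambda>h1 h2. sw (\<S> p) (\<lambda>r s. F (h1 \<cdot> r \<cdot> q) * lam (h2 \<cdot> s))))"
    by (intro sw_cong sw_mul li)
  also have "\<dots> = sw \<Lambda> (\<lambda>p q. sw h (\<lambda>h1 h2. sw p (\<lambda>p1 p2. F (h1 \<cdot> \<S> p2 \<cdot> q) * lam (h2 \<cdot> \<S> p1))))"
    by (intro sw_cong sw_antip li)
  also have "\<dots> = sw h (\<lambda>h1 h2. sw \<Lambda> (\<lambda>p q. sw p (\<lambda>p1 p2. F (h1 \<cdot> \<S> p2 \<cdot> q) * lam (h2 \<cdot> \<S> p1))))"
    by (rule sw_commute)
  also have "\<dots> = sw h (\<lambda>h1 h2. sw \<Lambda> (\<lambda>p1 y. sw y (\<lambda>p2 q. F (h1 \<cdot> \<S> p2 \<cdot> q) * lam (h2 \<cdot> \<S> p1))))"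
    by (intro sw_cong sw_coassoc)
  also have "\<dots> = sw h (\<lambda>h1 h2. sw \<Lambda> (\<lambda>p1 y. \<epsilon> y * (F h1 * lam (h2 \<cdot> \<S> p1))))"
    unfolding sw_times 2 by (simp only: mult.assoc)
  also have "\<dots> = sw h (\<lambda>h1 h2. F h1 * lam (h2 \<cdot> \<S> \<Lambda>))"
    by (intro sw_cong sw_counit_right li)
  also have "\<dots> = sw h (\<lambda>h1 h2. \<epsilon> h2 * F h1)"
    by (simp add: linD[OF lin_lam] mult.commute)
  also have "\<dots> = F h" by (rule sw_counit_right[OF F])
  finally show ?thesis .
qed

lemma functional_eq_lam:
  assumes F: "lin F"
  shows "\<exists>w. \<forall>h. F h = lam (h \<cdot> w)"
proof (intro exI allI)
  fix h
  have "lin (\<lambda>w. lam (h \<cdot> w))" by (intro lin_comp[OF lin_lam] linop_intros)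
  from lin_swv[OF this, of \<Lambda> "\<lambda>p q. svec (F q) (\<S> p)"]
  show "F h = lam (h \<cdot> swv \<Lambda> (\<lambda>p q. svec (F q) (\<S> p)))"
    using lam_dual_basis[OF F, of h] by (simp add: linD[OF lin_lam] mult.commute)
qed

text \<open>The trace written in the dual bases supplied by \<Lambda>, in place of the coordinate
  basis.\<close>

lemma trace_eq_sw:
  assumes f: "linop f"
  shows "trace f = sw \<Lambda> (\<lambda>p q. lam (f q \<cdot> \<S> p))"
proof -
  have "trace f = (\<Sum>i\<in>UNIV. sw \<Lambda> (\<lambda>p q. lam (f (bv i) \<cdot> \<S> p) * q i))"
    unfolding trace_def by (intro sum.cong refl lam_dual_basis[symmetric] lin_coord)
  also have "\<dots> = sw \<Lambda> (\<lambda>p q. \<Sum>i\<in>UNIV. q i * lam (f (bv i) \<cdot> \<S> p))"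
    by (simp add: sw_sum mult.commute)
  also have "\<dots> = sw \<Lambda> (\<lambda>p q. lam (f q \<cdot> \<S> p))"
    by (intro sw_cong lin_expand[symmetric] lin_comp[OF lin_lam] linop_intros f)
  finally show ?thesis .
qed

text \<open>The distinguished grouplike element of \<open>H\<close>, see \<open>lam_right\<close> below.\<close>

definition dgl where "dgl = swv \<Lambda> (\<lambda>p q. svec (lam p) q)"

lemma lin_dgl: "lin F \<Longrightarrow> F dgl = sw \<Lambda> (\<lambda>p q. lam p * F q)"
  by (simp add: dgl_def lin_swv linD)

text \<open>The convolution \<open>\<mu>\<close> of \<open>lam\<close> with \<open>F\<close> is
  again a left integral of the dual algebra. The dual bases show that it is
  \<open>\<mu> \<Lambda>\<close> times \<open>lam\<close>, and \<open>\<mu> \<Lambda>\<close> is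
  \<open>F dgl\<close> by the choice of \<open>dgl\<close>.\<close>

lemma lam_right:
  assumes F: "lin F"
  shows "sw h (\<lambda>p q. lam p * F q) = lam h * F dgl"
proof -
  define \<mu> where "\<mu> = (\<lambda>h. sw h (\<lambda>p q. lam p * F q))"
  have \<mu>: "lin \<mu>" unfolding \<mu>_def by (intro lin_sw linop_intros)
  have li: "sw h (\<lambda>p q. G p * \<mu> q) = \<mu> h * G \<one>" if G: "lin G" for G h
  proof -
    have "sw h (\<lambda>p q. G p * \<mu> q) = sw h (\<lambda>p q. sw q (\<lambda>r s. G p * lam r * F s))"
      by (simp add: \<mu>_def mult.assoc sw_times)
    also have "\<dots> = sw h (\<lambda>y s. sw y (\<lambda>p r. G p * lam r * F s))"
      by (rule sw_coassoc[symmetric])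
    also have "\<dots> = sw h (\<lambda>y s. lam y * G \<one> * F s)"
      by (simp only: sw_times lam_left_integral[OF G])
    also have "\<dots> = sw h (\<lambda>y s. lam y * F s * G \<one>)"
      by (simp only: mult_ac)
    also have "\<dots> = \<mu> h * G \<one>" by (simp add: \<mu>_def sw_times)
    finally show ?thesis .
  qed
  have "\<mu> h = sw \<Lambda> (\<lambda>p q. lam (h \<cdot> \<S> p) * \<mu> q)" by (rule lam_dual_basis[OF \<mu>, symmetric])
  also have "\<dots> = \<mu> \<Lambda> * lam (h \<cdot> \<S> \<one>)"
    by (rule li) (intro lin_comp[OF lin_lam] linop_intros)
  also have "\<mu> \<Lambda> = F dgl" by (simp add: lin_dgl[OF F] \<mu>_def)
  finally show ?thesis by (simp add: \<mu>_def mult.commute)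
qed

lemma eps_dgl [simp]: "\<epsilon> dgl = 1"
proof -
  have "\<epsilon> dgl = sw \<Lambda> (\<lambda>p q. \<epsilon> q * lam p)"
    using lin_dgl[OF lin_eps[OF linop_id]] by (simp add: mult.commute)
  also have "\<dots> = 1" by (simp add: sw_counit_right[OF lin_lam])
  finally show ?thesis .
qed

text \<open>\<open>dgl\<close> is grouplike: after coassociativity, the right-hand behaviour of
  \<open>lam\<close> is used once for each tensor factor.\<close>

lemma sw_dgl:
  assumes F1: "\<And>y. lin (\<lambda>x. F x y)" and F2: "\<And>x. lin (F x)"
  shows "sw dgl F = F dgl dgl"
proof -
  have "sw dgl F = sw \<Lambda> (\<lambda>p q. sw q (\<lambda>r s. lam p * F r s))"
    by (subst lin_dgl[OF lin_sw[OF linop_id]]) (simp add: sw_times)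
  also have "\<dots> = sw \<Lambda> (\<lambda>y s. sw y (\<lambda>p r. lam p * F r s))"
    by (rule sw_coassoc[symmetric])
  also have "\<dots> = sw \<Lambda> (\<lambda>y s. lam y * F dgl s)"
    by (intro sw_cong lam_right F1)
  also have "\<dots> = F dgl dgl" by (simp add: lam_right[OF F2])
  finally show ?thesis .
qed

text \<open>Expand \<open>lam (\<S> h)\<close> in the dual bases; the antipode swaps the two
  components of \<Lambda> and fixes \<Lambda> itself, so \<open>lam_right\<close> evaluates the
  sum.\<close>

lemma lam_antip: "lam (\<S> h) = lam (h \<cdot> dgl)"
proof -
  note li = lin_times lin_comp[OF lin_lam] linop_intros
  have "lam (\<S> h) = sw \<Lambda> (\<lambda>p q. lam (h \<cdot> \<S> p) * lam (\<S> q))"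
    by (rule lam_dual_basis[symmetric]) (intro li)
  also have "\<dots> = sw \<Lambda> (\<lambda>p q. lam (\<S> q) * lam (h \<cdot> \<S> p))"
    by (simp only: mult.commute)
  also have "\<dots> = sw (\<S> \<Lambda>) (\<lambda>p q. lam p * lam (h \<cdot> q))"
    by (rule sw_antip[symmetric]) (intro li)+
  also have "\<dots> = lam \<Lambda> * lam (h \<cdot> dgl)"
    unfolding antip_integ by (rule lam_right) (intro li)
  finally show ?thesis by simp
qed

text \<open>Radford's formula for the fourth power of the antipode, in the unimodular case.\<close>

lemma antip4: "z \<cdot> dgl = dgl \<cdot> \<S> (\<S> (\<S> (\<S> z)))"
proof -
  have "lam (y \<cdot> (z \<cdot> dgl - dgl \<cdot> \<S> (\<S> (\<S> (\<S> z))))) = 0" for y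
  proof -
    \<comment> \<open>Passing an antipode through \<open>lam\<close> costs a factor
      \<open>dgl\<close>, a cyclic rotation costs S^2. Two moves of each kind shift \<open>z\<close>
      past \<open>y\<close> and \<open>dgl\<close> with S^4 applied.\<close>
    have "lam (y \<cdot> z \<cdot> dgl) = lam (\<S> z \<cdot> \<S> y)" by (simp add: antip_mul flip: lam_antip)
    also have "\<dots> = lam (\<S> (\<S> (\<S> z) \<cdot> y))" by (simp add: lam_cyclic[of "\<S> z"] antip_mul)
    also have "\<dots> = lam (\<S> (\<S> z) \<cdot> (y \<cdot> dgl))" by (simp add: lam_antip mul_assoc)
    also have "\<dots> = lam (y \<cdot> dgl \<cdot> \<S> (\<S> (\<S> (\<S> z))))" by (rule lam_cyclic)
    finally show ?thesis by (simp add: mul_distrib lin_diff[OF lin_lam] mul_assoc)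
  qed
  from lam_nondegenerate[OF this] show ?thesis by simp
qed

end

section \<open>Finite order of the antipode\<close>

context hopf
begin

definition grouplike :: "('i \<Rightarrow> 'k) \<Rightarrow> bool" where
  "grouplike x \<longleftrightarrow> x \<noteq> 0 \<and> (\<forall>a b. hcomul H x (a, b) = x a * x b)"

lemma hcomul_eq_sw: "hcomul H x (a, b) = sw x (\<lambda>p q. p a * q b)"
proof -
  have "sw x (\<lambda>p q. p a * q b) = (\<Sum>c\<in>UNIV. (\<Sum>d\<in>UNIV. hcomul H x (c, d) * bv d b) * bv c a)"
    by (simp add: sw_def sum_distrib_left mult_ac)
  then show ?thesis by (simp add: bv_sum)
qed

text \<open>Compare the coproduct of the relation with \<open>a j\<close> times the relation itself.
  The term of \<open>a\<close> disappears and the others acquire the factor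
  \<open>x j - a j\<close>, which is nonzero for some \<open>j\<close> when \<open>x\<close> differs
  from \<open>a\<close>.\<close>

lemma grouplike_independent:
  assumes "finite A" "\<forall>x\<in>A. grouplike x" "(\<Sum>x\<in>A. svec (c x) x) = 0"
  shows "\<forall>x\<in>A. c x = 0"
  using assms
proof (induction A arbitrary: c rule: finite_induct)
  case (insert a A)
  have r: "(\<Sum>x\<in>insert a A. c x * x i) = 0" for i
    using fun_cong[OF insert.prems(2), of i] by (simp add: sum_fun_apply)
  have rr: "(\<Sum>x\<in>insert a A. c x * (x i * x j)) = 0" for i j
  proof -
    have "(\<Sum>x\<in>insert a A. c x * (x i * x j)) = sw (\<Sum>x\<in>insert a A. svec (c x) x) (\<lambda>p q. p i * q j)"
      using insert.prems(1)
      by (simp only: lin_sum[OF lin_sw[OF linop_id]] linD[OF lin_sw[OF linop_id]])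
        (intro sum.cong refl, auto simp: grouplike_def hcomul_eq_sw[symmetric])
    also have "\<dots> = 0" unfolding insert.prems(2) by (rule lin_0[OF lin_sw[OF linop_id]])
    finally show ?thesis .
  qed
  have "(\<Sum>x\<in>A. svec (c x * (x j - a j)) x) = 0" for j
  proof
    fix i
    have "(\<Sum>x\<in>A. svec (c x * (x j - a j)) x) i
        = (\<Sum>x\<in>A. c x * (x i * x j)) - a j * (\<Sum>x\<in>A. c x * x i)"
      by (simp add: sum_fun_apply sum_subtractf sum_distrib_left algebra_simps)
    also have "\<dots> = 0"
    proof -
      have "(\<Sum>x\<in>A. c x * (x i * x j)) = - (c a * (a i * a j))" "(\<Sum>x\<in>A. c x * x i) = - (c a * a i)"
        using rr[of i j] r[of i] insert.hyps by (simp_all add: eq_neg_iff_add_eq_0 add.commute)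
      then show ?thesis by simp
    qed
    finally show "(\<Sum>x\<in>A. svec (c x * (x j - a j)) x) i = 0 i" by simp
  qed
  from insert.IH[OF _ this] insert.prems(1) have "\<forall>x\<in>A. c x * (x j - a j) = 0" for j by simp
  then have cA: "\<forall>x\<in>A. c x = 0"
  proof (intro ballI)
    fix x assume x: "x \<in> A" and *: "\<And>j. \<forall>x\<in>A. c x * (x j - a j) = 0"
    then have "x \<noteq> a" using insert.hyps by auto
    then obtain j where "x j \<noteq> a j" by (auto simp: fun_eq_iff)
    then show "c x = 0" using * x by fastforce
  qed
  have "svec (c a) a = (\<Sum>x\<in>insert a A. svec (c x) x)" using insert.hyps cA by simp
  then have "svec (c a) a = 0" unfolding insert.prems(2) .
  then show ?case using cA insert.prems(1) by (auto simp: svec_eq_0_iff grouplike_def)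
qed simp

lemma grouplike_mul:
  assumes "grouplike x" "grouplike y" "x \<cdot> y \<noteq> 0"
  shows "grouplike (x \<cdot> y)"
proof -
  have gl: "sw z F = F z z" if "grouplike z" "\<And>y. lin (\<lambda>x. F x y)" "\<And>x. lin (F x)" for z F
    using that(1) pairing_tensor[OF that(2,3), of z z] by (simp add: sw_def grouplike_def)
  have "hcomul H (x \<cdot> y) (a, b) = (x \<cdot> y) a * (x \<cdot> y) b" for a b
  proof -
    have "hcomul H (x \<cdot> y) (a, b) = sw x (\<lambda>p q. sw y (\<lambda>r s. (p \<cdot> r) a * (q \<cdot> s) b))"
      unfolding hcomul_eq_sw by (intro sw_mul lin_times lin_coord)
    also have "\<dots> = sw x (\<lambda>p q. (p \<cdot> y) a * (q \<cdot> y) b)"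
      by (intro sw_cong gl assms lin_times lin_comp[OF lin_coord] linop_intros)
    also have "\<dots> = (x \<cdot> y) a * (x \<cdot> y) b"
      by (intro gl assms lin_times lin_comp[OF lin_coord] linop_intros)
    finally show ?thesis .
  qed
  then show ?thesis using assms by (simp add: grouplike_def)
qed

end

context semisimple_hopf
begin

section \<open>Powers of the distinguished grouplike element and the order of S^2\<close>

definition gpow :: "nat \<Rightarrow> 'i \<Rightarrow> 'k" where "gpow n = ((\<lambda>x. dgl \<cdot> x) ^^ n) \<one>"

lemma gpow_simps [simp]: "gpow 0 = \<one>" "gpow (Suc n) = dgl \<cdot> gpow n"
  by (simp_all add: gpow_def)

lemma one_neq_0: "\<one> \<noteq> 0"
  using eps_one lin_0[OF lin_eps[OF linop_id]] zero_neq_one by metis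

lemma eps_gpow: "\<epsilon> (gpow n) = 1"
  by (induction n) auto

lemma grouplike_gpow: "grouplike (gpow n)"
proof (induction n)
  case 0
  have "hcomul H \<one> = tensor \<one> \<one>" using hopf by (auto simp: is_hopf_algebra_def)
  then show ?case using one_neq_0 by (simp add: grouplike_def tensor_def)
next
  case (Suc n)
  have nz: "x \<noteq> 0" if "\<epsilon> x = 1" for x
    using that lin_0[OF lin_eps[OF linop_id]] by auto
  have "hcomul H dgl (a, b) = dgl a * dgl b" for a b
    unfolding hcomul_eq_sw by (intro sw_dgl lin_times lin_coord)
  then have "grouplike dgl" by (simp add: grouplike_def nz)
  then show ?case unfolding gpow_simps using Suc by (intro grouplike_mul nz) (simp_all add: eps_gpow)
qed

lemma dgl_cancel: "dgl \<cdot> x = dgl \<cdot> y \<Longrightarrow> x = y"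
proof -
  have "\<S> dgl \<cdot> dgl = \<one>"
  proof (rule vec_eqI)
    fix F :: "('i \<Rightarrow> 'k) \<Rightarrow> 'k" assume F: "lin F"
    have "sw dgl (\<lambda>p q. F (\<S> p \<cdot> q)) = F (\<S> dgl \<cdot> dgl)"
      by (intro sw_dgl lin_comp[OF F] linop_intros)
    then show "F (\<S> dgl \<cdot> dgl) = F \<one>" by (simp add: sw_antipode_left[OF F])
  qed
  then show "dgl \<cdot> x = dgl \<cdot> y \<Longrightarrow> x = y" by (metis mul_assoc one_mul)
qed

text \<open>Distinct grouplike elements are independent, so two of the first
  \<open>card UNIV + 1\<close> powers agree, and cancellation brings this to a power equal to the
  identity.\<close>

lemma gpow_finite_order: "\<exists>N>0. gpow N = \<one>"
proof -
  have "\<not> inj_on gpow {..card (UNIV :: 'i set)}"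
  proof
    assume inj: "inj_on gpow {..card (UNIV :: 'i set)}"
    let ?A = "gpow ` {..card (UNIV :: 'i set)}"
    have "card (UNIV :: 'i set) < card ?A" using inj by (simp add: card_image)
    from nontrivial_relation[OF _ _ this, of "\<lambda>x. x"] obtain c where
      c: "\<exists>x\<in>?A. c x \<noteq> 0" "\<forall>i. (\<Sum>x\<in>?A. c x * x i) = 0" by auto
    have "(\<Sum>x\<in>?A. svec (c x) x) = 0" using c(2) by (simp add: fun_eq_iff sum_fun_apply)
    from grouplike_independent[OF _ _ this] c(1) show False using grouplike_gpow by auto
  qed
  then obtain i j where "i \<noteq> j" "gpow i = gpow j" by (auto simp: inj_on_def)
  then obtain i n where n: "gpow i = gpow (i + n)" "n > 0"
    by (metis less_imp_add_positive nat_neq_iff)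
  have "gpow i = gpow (i + n) \<Longrightarrow> gpow n = \<one>"
  proof (induction i)
    case (Suc i)
    then show ?case by (metis add_Suc dgl_cancel gpow_simps(2))
  qed simp
  then show ?thesis using n by blast
qed

definition sq :: "('i \<Rightarrow> 'k) \<Rightarrow> ('i \<Rightarrow> 'k)" where "sq x = \<S> (\<S> x)"

lemma linop_sq: "linop sq"
  by (rule linopI) (simp_all add: sq_def linopD[OF linop_antip[OF linop_id]])

lemma sq_mul: "sq (x \<cdot> y) = sq x \<cdot> sq y"
  by (simp add: sq_def antip_mul)

lemma sq_one [simp]: "sq \<one> = \<one>"
  by (simp add: sq_def)

lemma sq_surj: "\<exists>x. sq x = y"
  unfolding sq_def using antip_surj by metis

text \<open>Moving \<open>z\<close> past the \<open>n\<close>-th power of \<open>dgl\<close> applies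
  S^4 to it \<open>n\<close> times; take a power that equals the identity.\<close>

lemma sq_finite_order: "\<exists>M>0. \<forall>x. (sq ^^ M) x = x"
proof -
  obtain N where N: "N > 0" "gpow N = \<one>" using gpow_finite_order by blast
  have "z \<cdot> gpow n = gpow n \<cdot> ((sq ^^ 2) ^^ n) z" for n z
  proof (induction n arbitrary: z)
    case (Suc n)
    have "z \<cdot> gpow (Suc n) = z \<cdot> dgl \<cdot> gpow n" by (simp only: gpow_simps mul_assoc)
    also have "z \<cdot> dgl = dgl \<cdot> (sq ^^ 2) z"
      by (simp only: antip4[of z] sq_def numeral_2_eq_2 funpow.simps o_apply id_apply)
    also have "dgl \<cdot> (sq ^^ 2) z \<cdot> gpow n = dgl \<cdot> ((sq ^^ 2) z \<cdot> gpow n)" by (rule mul_assoc)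
    also have "\<dots> = gpow (Suc n) \<cdot> ((sq ^^ 2) ^^ Suc n) z"
      unfolding Suc by (simp only: gpow_simps mul_assoc funpow_Suc_right o_apply)
    finally show ?case .
  qed simp
  from this[of _ N] have "(sq ^^ (2 * N)) z = z" for z
    by (simp add: N(2) funpow_mult)
  then show ?thesis using N(1) by (intro exI[of _ "2 * N"]) auto
qed

section \<open>Innerness of the squared antipode\<close>

definition chi :: "('i \<Rightarrow> 'k) \<Rightarrow> 'k" where "chi h = trace (\<lambda>x. h \<cdot> x)"

lemma lin_chi: "lin chi"
  by (rule linI) (simp_all add: chi_def trace_def mul_distrib sum.distrib sum_distrib_left)

lemma chi_comm: "chi (x \<cdot> y) = chi (y \<cdot> x)"
proof -
  have "trace (\<lambda>z. x \<cdot> (y \<cdot> z)) = trace (\<lambda>z. y \<cdot> (x \<cdot> z))"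
    by (rule trace_comm) (intro linop_intros)+
  then show ?thesis by (simp add: chi_def trace_def mul_assoc)
qed

text \<open>\<open>chi e\<close> is the rank of left multiplication by \<open>e\<close>; it serves
  as an integer size for idempotents.\<close>

lemma chi_idempotent:
  assumes "e \<cdot> e = e"
  shows "\<exists>r::nat. chi e = of_nat r \<and> (r = 0 \<longrightarrow> e = 0)"
proof -
  have "e \<cdot> (e \<cdot> x) = e \<cdot> x" for x by (simp add: assms flip: mul_assoc)
  from trace_idempotent[OF linop_mul_right[OF linop_id] this] obtain r :: nat
    where "chi e = of_nat r" "r = 0 \<longrightarrow> (\<forall>x. e \<cdot> x = 0)" unfolding chi_def by blast
  then have "r = 0 \<longrightarrow> e \<cdot> \<one> = 0" by blast
  with \<open>chi e = of_nat r\<close> show ?thesis by auto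
qed

text \<open>The right unit \<open>e\<close> of the left ideal generated by \<open>x\<close> is an
  idempotent with \<open>chi e = 0\<close>, hence 0, and so is
  \<open>x = x \<cdot> e\<close>.\<close>

lemma chi_nondegenerate:
  assumes "\<And>h. chi (h \<cdot> x) = 0"
  shows "x = 0"
proof -
  obtain e where e: "e \<in> range (\<lambda>h. h \<cdot> x)" "\<forall>l\<in>range (\<lambda>h. h \<cdot> x). l \<cdot> e = l"
    using left_ideal_unit[OF left_ideal_principal] by blast
  have "chi e = 0" using e(1) assms by auto
  moreover have "e \<cdot> e = e" using e by blast
  ultimately have "e = 0" using chi_idempotent[of e] by auto
  moreover have "\<one> \<cdot> x \<cdot> e = \<one> \<cdot> x" using e(2) by blast
  ultimately show ?thesis by simp
qed

definition frob where "frob = (SOME w. \<forall>h. chi h = lam (h \<cdot> w))"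

lemma chi_eq_lam: "chi h = lam (h \<cdot> frob)"
  unfolding frob_def by (rule someI_ex[OF functional_eq_lam[OF lin_chi], rule_format])

text \<open>\<open>chi\<close> is symmetric while \<open>lam\<close> is symmetric only up to S^2;
  the element comparing the two forms therefore implements S^2.\<close>

lemma mul_frob: "y \<cdot> frob = frob \<cdot> sq y"
proof -
  have "lam (z \<cdot> (y \<cdot> frob - frob \<cdot> sq y)) = 0" for z
  proof -
    have "lam (z \<cdot> (y \<cdot> frob)) = chi (z \<cdot> y)" by (simp add: chi_eq_lam mul_assoc)
    also have "\<dots> = chi (y \<cdot> z)" by (rule chi_comm)
    also have "\<dots> = lam (z \<cdot> (frob \<cdot> sq y))"
      by (simp add: chi_eq_lam mul_assoc sq_def lam_cyclic[of y "z \<cdot> frob"])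
    finally show ?thesis by (simp add: mul_distrib lin_diff[OF lin_lam])
  qed
  from lam_nondegenerate[OF this] show ?thesis by simp
qed

lemma mul_frob_eq_0: "x \<cdot> frob = 0 \<Longrightarrow> x = 0"
  by (rule chi_nondegenerate) (simp add: chi_eq_lam mul_assoc lin_0[OF lin_lam])

lemma frob_mul_eq_0: "frob \<cdot> x = 0 \<Longrightarrow> x = 0"
proof -
  assume 0: "frob \<cdot> x = 0"
  obtain y where y: "x = sq y" using sq_surj by metis
  have "y \<cdot> frob = 0" by (simp only: mul_frob 0 flip: y)
  then have "y = 0" by (rule mul_frob_eq_0)
  then show ?thesis by (simp only: y linop_0[OF linop_sq])
qed

lemma sq_frob [simp]: "sq frob = frob"
proof -
  have "frob \<cdot> (frob - sq frob) = 0" by (simp only: mul_distrib mul_frob[of frob] diff_self)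
  from frob_mul_eq_0[OF this] show ?thesis by (metis eq_iff_diff_eq_0)
qed

section \<open>Decomposition into primitive idempotents\<close>

text \<open>In the corner of \<open>e\<close>, the nonzero element \<open>y\<close> kills
  \<open>v\<close>. The left ideal generated by \<open>y\<close> has a right unit; made fixed under
  \<open>sq\<close> and cut down by \<open>e\<close>, it is an idempotent \<open>a\<close>, nonzero
  because \<open>y \<cdot> a = y\<close> and different from \<open>e\<close> because it kills
  \<open>v\<close>.\<close>

lemma split_idempotent:
  assumes e: "e \<cdot> e = e" "sq e = e" and y: "y \<noteq> 0" "y \<cdot> e = y" "e \<cdot> y = y" "sq y = y"
    and v: "v \<noteq> 0" "e \<cdot> v = v" "y \<cdot> v = 0"
  shows "\<exists>a. a \<cdot> a = a \<and> sq a = a \<and> e \<cdot> a = a \<and> a \<cdot> e = a \<and> a \<noteq> 0 \<and> a \<noteq> e"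
proof -
  obtain M where M: "M > 0" "\<forall>x. (sq ^^ M) x = x" using sq_finite_order by blast
  obtain a0 where a0: "a0 \<in> range (\<lambda>h. h \<cdot> y)" "\<forall>l\<in>range (\<lambda>h. h \<cdot> y). l \<cdot> a0 = l"
    using left_ideal_unit[OF left_ideal_principal] by blast
  have "\<one> \<cdot> y \<cdot> a0 = \<one> \<cdot> y" using a0(2) by blast
  then have ya0: "y \<cdot> a0 = y" by simp
  have ya: "y \<cdot> (sq ^^ i) a0 = y" for i
  proof (induction i)
    case (Suc i)
    have "y \<cdot> (sq ^^ Suc i) a0 = sq (y \<cdot> (sq ^^ i) a0)" by (simp add: sq_mul y)
    then show ?case using Suc y by simp
  qed (simp add: ya0)
  have "\<exists>h. (sq ^^ i) a0 = h \<cdot> y" for i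
  proof (induction i)
    case 0
    then show ?case using a0(1) by auto
  next
    case (Suc i)
    then show ?case using sq_mul y(4) by (metis funpow.simps(2) o_apply)
  qed
  then obtain h where h: "\<And>i. (sq ^^ i) a0 = h i \<cdot> y" by metis
  \<comment> \<open>Right units of the left ideal generated by y form an affine space, so averaging one of them
     over the finite cyclic group generated by sq yields a fixed one.\<close>
  define s where "s = svec (1 / of_nat M) (\<Sum>i<M. (sq ^^ i) a0)"
  have sq_s: "sq s = s"
  proof -
    have "(\<Sum>i<M. (sq ^^ Suc i) a0) + a0 = (\<Sum>i<Suc M. (sq ^^ i) a0)"
      unfolding sum.lessThan_Suc_shift by (simp add: add.commute)
    also have "\<dots> = (\<Sum>i<M. (sq ^^ i) a0) + a0" using M(2) by simp
    finally have "(\<Sum>i<M. sq ((sq ^^ i) a0)) = (\<Sum>i<M. (sq ^^ i) a0)" by simp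
    then show ?thesis by (simp add: s_def linopD[OF linop_sq] linop_sum[OF linop_sq])
  qed
  have ys: "y \<cdot> s = y"
  proof -
    have "y \<cdot> s = svec (1 / of_nat M) (\<Sum>i<M. y)" by (simp add: s_def mul_sum ya)
    then show ?thesis using M(1) by (simp add: fun_eq_iff sum_fun_apply)
  qed
  \<comment> \<open>Exhibits \<open>a\<close> as a left multiple of \<open>y\<close>, which gives
    \<open>a \<cdot> a = a\<close>, \<open>a \<cdot> e = a\<close> and
    \<open>a \<cdot> v = 0\<close>.\<close>
  define k where "k = e \<cdot> svec (1 / of_nat M) (\<Sum>i<M. h i)"
  define a where "a = e \<cdot> s"
  have ak: "a = k \<cdot> y" by (simp add: a_def k_def s_def h mul_sum mul_assoc)
  have yaa: "y \<cdot> a = y" by (simp add: a_def ys y flip: mul_assoc)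
  have "a \<cdot> a = k \<cdot> (y \<cdot> a)" by (subst (1) ak) (rule mul_assoc)
  also have "\<dots> = a" by (simp only: yaa flip: ak)
  finally have "a \<cdot> a = a" .
  moreover have "sq a = a" by (simp add: a_def sq_mul e sq_s)
  moreover have "e \<cdot> a = a" by (simp add: a_def e flip: mul_assoc)
  moreover have "a \<cdot> e = a" by (simp add: ak y mul_assoc)
  moreover have "a \<noteq> 0" using yaa y(1) by auto
  moreover have "a \<noteq> e"
  proof
    assume "a = e"
    moreover have "a \<cdot> v = k \<cdot> (y \<cdot> v)" by (simp only: ak mul_assoc)
    ultimately show False using v by simp
  qed
  ultimately show ?thesis by blast
qed

text \<open>The last clause makes the corner of \<open>p\<close> one-dimensional, so
  \<open>p\<close> is primitive; the eigenvector clause makes \<open>sq\<close> act by a scalar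
  between any two such idempotents.\<close>

definition good :: "('i \<Rightarrow> 'k) \<Rightarrow> bool" where
  "good p \<longleftrightarrow> p \<noteq> 0 \<and> p \<cdot> p = p \<and> sq p = p \<and> (\<exists>\<alpha>. frob \<cdot> p = svec \<alpha> p) \<and>
     (\<forall>x. \<exists>c. p \<cdot> x \<cdot> p = svec c p)"

lemma eigenvector_corner:
  assumes e: "e \<cdot> e = e" "e \<noteq> 0" and x: "e \<cdot> x = x"
  shows "\<exists>v c. v \<noteq> 0 \<and> e \<cdot> v = v \<and> x \<cdot> v = svec c v"
proof -
  have V: "is_subspace {v. e \<cdot> v = v}" by (auto simp: is_subspace_def mul_distrib)
  have "x \<cdot> v \<in> {v. e \<cdot> v = v}" for v by (simp add: x flip: mul_assoc)
  from eigenvector_exists[OF alg_closed linop_mul_right[OF linop_id] V this _ e(2)]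
  show ?thesis using e(1) by blast
qed

text \<open>If \<open>frob \<cdot> e\<close> is no multiple of \<open>e\<close>, subtracting an
  eigenvalue yields a zero divisor of the corner that splits \<open>e\<close>. Otherwise
  \<open>sq\<close> is trivial on the corner, and any non-scalar element of the corner minus an
  eigenvalue does the same.\<close>

lemma not_good_split:
  assumes e: "e \<cdot> e = e" "sq e = e" "e \<noteq> 0" and ng: "\<not> good e"
  shows "\<exists>a. a \<cdot> a = a \<and> sq a = a \<and> e \<cdot> a = a \<and> a \<cdot> e = a \<and> a \<noteq> 0 \<and> a \<noteq> e"
proof -
  have ew: "e \<cdot> frob = frob \<cdot> e" using mul_frob[of e] e by simp
  have ewe: "e \<cdot> (frob \<cdot> e) = frob \<cdot> e"
    by (simp only: ew e flip: mul_assoc) (simp only: mul_assoc e)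
  obtain v z where v: "v \<noteq> 0" "e \<cdot> v = v" "frob \<cdot> e \<cdot> v = svec z v"
  proof -
    from eigenvector_corner[OF e(1,3) ewe] show ?thesis using that by blast
  qed
  show ?thesis
  proof (cases "frob \<cdot> e = svec z e")
    case False
    have "frob \<cdot> e - svec z e \<noteq> 0" using False by simp
    then show ?thesis
    proof (rule split_idempotent[OF e(1,2) _ _ _ _ v(1,2)])
      show "(frob \<cdot> e - svec z e) \<cdot> v = 0" using v by (simp add: mul_distrib)
      show "(frob \<cdot> e - svec z e) \<cdot> e = frob \<cdot> e - svec z e"
        by (simp add: mul_distrib mul_assoc e)
      show "e \<cdot> (frob \<cdot> e - svec z e) = frob \<cdot> e - svec z e"
        by (simp add: mul_distrib e ewe)
      show "sq (frob \<cdot> e - svec z e) = frob \<cdot> e - svec z e"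
        by (simp add: linop_diff[OF linop_sq] linopD[OF linop_sq] sq_mul e)
    qed
  next
    case True
    then obtain x0 where x0: "\<And>c. e \<cdot> x0 \<cdot> e \<noteq> svec c e"
      using ng e unfolding good_def by blast
    define x where "x = e \<cdot> x0 \<cdot> e"
    have ex: "e \<cdot> x = x" "x \<cdot> e = x" by (simp_all add: x_def e mul_assoc) (simp add: e flip: mul_assoc)
    \<comment> \<open>A nonzero scalar can be cancelled, so conjugation by \<open>frob\<close> is
      trivial on the corner and \<open>sq x = x\<close> follows.\<close>
    have z: "z \<noteq> 0" using mul_frob_eq_0[of e] e(3) True by (auto simp: ew)
    have esx: "e \<cdot> sq x = sq x" using sq_mul[of e x] by (simp add: ex e)
    have "svec z (sq x) = svec z (e \<cdot> sq x)" by (simp only: esx)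
    also have "\<dots> = frob \<cdot> e \<cdot> sq x" by (simp only: True mul_simps)
    also have "\<dots> = frob \<cdot> sq x" by (simp only: mul_assoc esx)
    also have "\<dots> = x \<cdot> e \<cdot> frob" by (simp only: ex mul_frob)
    also have "\<dots> = x \<cdot> (e \<cdot> frob)" by (rule mul_assoc)
    also have "\<dots> = svec z x" by (simp only: ew True mul_simps ex)
    finally have sx: "sq x = x" using z by (simp add: fun_eq_iff)
    obtain v c where v: "v \<noteq> 0" "e \<cdot> v = v" "x \<cdot> v = svec c v"
      using eigenvector_corner[of e x] e ex by blast
    have "x - svec c e \<noteq> 0" using x0 by (simp add: x_def)
    then show ?thesis
    proof (rule split_idempotent[OF e(1,2) _ _ _ _ v(1,2)])
      show "(x - svec c e) \<cdot> v = 0" using v by (simp add: mul_distrib)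
      show "(x - svec c e) \<cdot> e = x - svec c e" "e \<cdot> (x - svec c e) = x - svec c e"
        by (simp_all add: mul_distrib e ex)
      show "sq (x - svec c e) = x - svec c e"
        by (simp add: linop_diff[OF linop_sq] linopD[OF linop_sq] e sx)
    qed
  qed
qed

text \<open>Induction on the rank \<open>chi e\<close>: an idempotent that is not good splits into
  two nonzero orthogonal ones, both of smaller rank.\<close>

lemma good_decomposition:
  assumes "e \<cdot> e = e" "sq e = e"
  shows "\<exists>P. finite P \<and> (\<forall>p\<in>P. good p \<and> e \<cdot> p = p \<and> p \<cdot> e = p)
      \<and> (\<forall>p\<in>P. \<forall>q\<in>P. p \<noteq> q \<longrightarrow> p \<cdot> q = 0) \<and> (\<Sum>p\<in>P. p) = e"
proof -
  obtain r where "chi e = of_nat r" using chi_idempotent[OF assms(1)] by blast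
  then show ?thesis using assms
  proof (induction r arbitrary: e rule: less_induct)
    case (less r)
    note e = less.prems
    consider "e = 0" | "good e" | "e \<noteq> 0" "\<not> good e" by blast
    then show ?case
    proof cases
      case 1
      then show ?thesis by (intro exI[of _ "{}"]) auto
    next
      case 2
      then show ?thesis using e by (intro exI[of _ "{e}"]) auto
    next
      case 3
      then obtain a where a: "a \<cdot> a = a" "sq a = a" "e \<cdot> a = a" "a \<cdot> e = a" "a \<noteq> 0" "a \<noteq> e"
        using not_good_split[OF e(2,3)] by blast
      define b where "b = e - a"
      have b: "b \<cdot> b = b" "sq b = b" "e \<cdot> b = b" "b \<cdot> e = b" "b \<noteq> 0" "a \<cdot> b = 0" "b \<cdot> a = 0"
        using a e by (auto simp: b_def mul_distrib linop_diff[OF linop_sq])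
      obtain ra rb where ra: "chi a = of_nat ra" "ra \<noteq> 0" and rb: "chi b = of_nat rb" "rb \<noteq> 0"
        using chi_idempotent[OF a(1)] chi_idempotent[OF b(1)] a b by metis
      have "chi e = chi a + chi b" by (simp add: b_def lin_diff[OF lin_chi])
      then have "r = ra + rb" using e(1) ra rb by (metis of_nat_add of_nat_eq_iff)
      then have lt: "ra < r" "rb < r" using ra rb by auto
      obtain A where A: "finite A" "\<forall>p\<in>A. good p \<and> a \<cdot> p = p \<and> p \<cdot> a = p"
        "\<forall>p\<in>A. \<forall>q\<in>A. p \<noteq> q \<longrightarrow> p \<cdot> q = 0" "(\<Sum>p\<in>A. p) = a"
        using less.IH[OF lt(1) ra(1) a(1,2)] by blast
      obtain B where B: "finite B" "\<forall>p\<in>B. good p \<and> b \<cdot> p = p \<and> p \<cdot> b = p"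
        "\<forall>p\<in>B. \<forall>q\<in>B. p \<noteq> q \<longrightarrow> p \<cdot> q = 0" "(\<Sum>p\<in>B. p) = b"
        using less.IH[OF lt(2) rb(1) b(1,2)] by blast
      have AB: "p \<cdot> q = 0" "q \<cdot> p = 0" if "p \<in> A" "q \<in> B" for p q
      proof -
        have pq: "a \<cdot> p = p" "p \<cdot> a = p" "b \<cdot> q = q" "q \<cdot> b = q" using that A(2) B(2) by auto
        have "p \<cdot> q = p \<cdot> a \<cdot> (b \<cdot> q)" by (simp only: pq)
        also have "\<dots> = p \<cdot> (a \<cdot> b) \<cdot> q" by (simp only: mul_assoc)
        finally have "p \<cdot> q = p \<cdot> (a \<cdot> b) \<cdot> q" .
        then show "p \<cdot> q = 0" by (simp add: b)
        have "q \<cdot> p = q \<cdot> b \<cdot> (a \<cdot> p)" by (simp only: pq)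
        also have "\<dots> = q \<cdot> (b \<cdot> a) \<cdot> p" by (simp only: mul_assoc)
        finally have "q \<cdot> p = q \<cdot> (b \<cdot> a) \<cdot> p" .
        then show "q \<cdot> p = 0" by (simp add: b)
      qed
      have "A \<inter> B = {}" using AB A(2) unfolding good_def by fastforce
      then have s: "(\<Sum>p\<in>A \<union> B. p) = e" using A B by (simp add: sum.union_disjoint b_def)
      have ep: "e \<cdot> p = p \<and> p \<cdot> e = p" if "p \<in> A \<union> B" for p
      proof -
        have *: "e \<cdot> p = p \<and> p \<cdot> e = p" if "d \<cdot> p = p" "p \<cdot> d = p" "e \<cdot> d = d" "d \<cdot> e = d" for d
        proof -
          have "e \<cdot> (d \<cdot> p) = e \<cdot> d \<cdot> p" "p \<cdot> d \<cdot> e = p \<cdot> (d \<cdot> e)"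
            by (simp_all only: mul_assoc)
          then show ?thesis by (simp only: that)
        qed
        show ?thesis using that A(2) B(2) *[of a] *[of b] a b by blast
      qed
      have pq: "\<forall>p\<in>A \<union> B. \<forall>q\<in>A \<union> B. p \<noteq> q \<longrightarrow> p \<cdot> q = 0" using A(3) B(3) AB by blast
      have fin: "finite (A \<union> B)" "\<forall>p\<in>A \<union> B. good p" using A B by auto
      show ?thesis
        by (rule exI[of _ "A \<union> B"]) (intro conjI fin pq s ballI bspec[OF fin(2)] conjunct1[OF ep] conjunct2[OF ep])
    qed
  qed
qed

end

section \<open>Positivity of sums of roots of unity\<close>

text \<open>In the rational group algebra of the group of \<open>M\<close>-th roots of unity, the sum in question is the
  image of an element of the form \<open>\<Sum>\<^sub>C a\<^sub>C a\<^sub>C\<^sup>*\<close>. Multiplication by it is positive definite for the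
  standard inner product, so the element is invertible.\<close>

lemma sum_root_of_unity_ratios_nonzero:
  fixes \<alpha> :: "'a \<Rightarrow> 'k::field_char_0" and r :: "'a \<Rightarrow> 'a"
  assumes P: "finite P" and M: "M > 0" and nz: "\<And>p. p \<in> P \<Longrightarrow> \<alpha> p \<noteq> 0"
    and root: "\<And>p q. p \<in> P \<Longrightarrow> q \<in> P \<Longrightarrow> r p = r q \<Longrightarrow> (\<alpha> q / \<alpha> p) ^ M = 1"
    and rP: "\<And>p. p \<in> P \<Longrightarrow> r p \<in> P" "\<And>p. p \<in> P \<Longrightarrow> r (r p) = r p"
    and p0: "p0 \<in> P" "\<And>p. p \<in> P \<Longrightarrow> r p = r p0 \<Longrightarrow> p = p0"
  shows "(\<Sum>p\<in>P. \<Sum>q\<in>P. if r p = r q then \<alpha> q / \<alpha> p else 0) \<noteq> 0"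
proof
  assume zero: "(\<Sum>p\<in>P. \<Sum>q\<in>P. if r p = r q then \<alpha> q / \<alpha> p else 0) = 0"
  define \<Gamma> where "\<Gamma> = {z::'k. z ^ M = 1}"
  \<comment> \<open>Dividing by the value at the class representative gives a root of unity without
    changing quotients inside a class.\<close>
  define \<beta> where "\<beta> = (\<lambda>p. \<alpha> p / \<alpha> (r p))"
  have fin: "finite \<Gamma>"
  proof -
    have "monom 1 M - 1 \<noteq> (0 :: 'k poly)"
    proof
      assume "monom 1 M - 1 = (0 :: 'k poly)"
      then have "poly (monom 1 M - 1) 0 = (0 :: 'k)" by simp
      then have "(0::'k) ^ M = 1" by (simp add: poly_monom)
      moreover have "(0::'k) ^ M = 0" using M by simp
      ultimately show False by simp
    qed
    then have "finite {z. poly (monom 1 M - 1) z = (0::'k)}" by (rule poly_roots_finite)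
    then show ?thesis by (simp add: \<Gamma>_def poly_monom)
  qed
  have \<Gamma>0: "z \<noteq> 0" if "z \<in> \<Gamma>" for z
  proof
    assume "z = 0"
    then have "z ^ M = 0" using M by simp
    then show False using that unfolding \<Gamma>_def by (metis mem_Collect_eq zero_neq_one)
  qed
  have \<Gamma>: "1 \<in> \<Gamma>" "\<And>z w. z \<in> \<Gamma> \<Longrightarrow> w \<in> \<Gamma> \<Longrightarrow> z * w \<in> \<Gamma>" "\<And>z w. z \<in> \<Gamma> \<Longrightarrow> w \<in> \<Gamma> \<Longrightarrow> z / w \<in> \<Gamma>"
    by (auto simp: \<Gamma>_def power_mult_distrib power_divide)
  have \<beta>: "\<beta> p \<in> \<Gamma>" if "p \<in> P" for p
    using root[of "r p" p] rP that by (simp add: \<Gamma>_def \<beta>_def)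
  note \<beta>0 = \<Gamma>0[OF \<beta>]
  have ratio: "\<alpha> q / \<alpha> p = \<beta> q / \<beta> p" if "p \<in> P" "q \<in> P" "r p = r q" for p q
    using that nz[OF rP(1)] by (simp add: \<beta>_def)
  \<comment> \<open>Column \<delta> of the matrix, over the group algebra of
    \<open>\<Gamma>\<close>, of multiplication by the formal sum of the elements
    \<open>\<beta> q / \<beta> p\<close>.\<close>
  define col :: "'k \<Rightarrow> 'k \<Rightarrow> rat" where
    "col = (\<lambda>\<delta> \<gamma>. \<Sum>p\<in>P. \<Sum>q\<in>P. of_bool (r p = r q \<and> \<gamma> * \<beta> p = \<delta> * \<beta> q))"
  \<comment> \<open>The columns together with the unit vector at 1 are one vector too many, so they
    satisfy a rational relation.\<close>
  let ?v = "\<lambda>a \<gamma>. case a of None \<Rightarrow> of_bool (\<gamma> = 1) | Some \<delta> \<Rightarrow> col \<delta> \<gamma>"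
  let ?A = "insert None (Some ` \<Gamma>)"
  have "card \<Gamma> < card ?A" using fin by (simp add: card_image)
  from nontrivial_relation[OF fin _ this, of ?v] fin obtain c where
    c: "\<exists>a\<in>?A. c a \<noteq> 0" "\<And>\<gamma>. \<gamma> \<in> \<Gamma> \<Longrightarrow> (\<Sum>a\<in>?A. c a * ?v a \<gamma>) = 0" by auto
  define d where "d = (\<lambda>\<delta>. c (Some \<delta>))"
  have rel: "c None * of_bool (\<gamma> = 1) + (\<Sum>\<delta>\<in>\<Gamma>. d \<delta> * col \<delta> \<gamma>) = 0" if "\<gamma> \<in> \<Gamma>" for \<gamma>
    using c(2)[OF that] fin by (simp add: d_def sum.reindex)
  \<comment> \<open>Sending each group element to its value in the field maps column \<delta> to
    \<delta> times the given sum, which is assumed to be 0.\<close>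
  have colsum: "(\<Sum>\<gamma>\<in>\<Gamma>. \<gamma> * of_rat (col \<delta> \<gamma>)) = 0" if \<delta>: "\<delta> \<in> \<Gamma>" for \<delta>
  proof -
    have 1: "(\<Sum>\<gamma>\<in>\<Gamma>. \<gamma> * of_bool (r p = r q \<and> \<gamma> * \<beta> p = \<delta> * \<beta> q))
        = \<delta> * (if r p = r q then \<alpha> q / \<alpha> p else 0)" if "p \<in> P" "q \<in> P" for p q
    proof (cases "r p = r q")
      case True
      have "\<gamma> * \<beta> p = \<delta> * \<beta> q \<longleftrightarrow> \<gamma> = \<delta> * \<beta> q / \<beta> p" for \<gamma>
        using \<beta>0[OF that(1)] by (simp add: eq_divide_eq)
      then have "(\<Sum>\<gamma>\<in>\<Gamma>. \<gamma> * of_bool (r p = r q \<and> \<gamma> * \<beta> p = \<delta> * \<beta> q))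
          = (\<Sum>\<gamma>\<in>\<Gamma>. if \<gamma> = \<delta> * \<beta> q / \<beta> p then \<gamma> else 0)"
        using True by (intro sum.cong) auto
      also have "\<dots> = \<delta> * \<beta> q / \<beta> p"
        using fin \<Gamma> \<beta> that \<delta> by simp
      finally show ?thesis using True ratio[OF that] by simp
    qed simp
    have "(\<Sum>\<gamma>\<in>\<Gamma>. \<gamma> * of_rat (col \<delta> \<gamma>))
        = (\<Sum>\<gamma>\<in>\<Gamma>. \<Sum>p\<in>P. \<Sum>q\<in>P. \<gamma> * of_bool (r p = r q \<and> \<gamma> * \<beta> p = \<delta> * \<beta> q))"
      unfolding col_def of_rat_sum sum_distrib_left by (intro sum.cong refl) (simp add: of_bool_def)
    also have "\<dots> = (\<Sum>p\<in>P. \<Sum>q\<in>P. \<Sum>\<gamma>\<in>\<Gamma>. \<gamma> * of_bool (r p = r q \<and> \<gamma> * \<beta> p = \<delta> * \<beta> q))"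
      by (subst sum.swap, rule sum.cong[OF refl], rule sum.swap)
    also have "\<dots> = (\<Sum>p\<in>P. \<Sum>q\<in>P. \<delta> * (if r p = r q then \<alpha> q / \<alpha> p else 0))"
      by (intro sum.cong refl 1)
    also have "\<dots> = \<delta> * (\<Sum>p\<in>P. \<Sum>q\<in>P. if r p = r q then \<alpha> q / \<alpha> p else 0)"
      by (simp only: sum_distrib_left)
    finally show ?thesis using zero by simp
  qed
  \<comment> \<open>Under the same evaluation the unit vector goes to 1, so it cannot take part in
    the relation.\<close>
  have cNone: "c None = 0"
  proof -
    have "0 = (\<Sum>\<gamma>\<in>\<Gamma>. \<gamma> * of_rat (c None * of_bool (\<gamma> = 1) + (\<Sum>\<delta>\<in>\<Gamma>. d \<delta> * col \<delta> \<gamma>)))"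
      using rel by simp
    also have "\<dots> = (\<Sum>\<gamma>\<in>\<Gamma>. if \<gamma> = 1 then of_rat (c None) else 0)
        + (\<Sum>\<gamma>\<in>\<Gamma>. \<Sum>\<delta>\<in>\<Gamma>. of_rat (d \<delta>) * (\<gamma> * of_rat (col \<delta> \<gamma>)))"
      unfolding sum.distrib[symmetric]
      by (intro sum.cong refl)
        (auto simp: of_rat_add of_rat_mult of_rat_sum sum_distrib_left algebra_simps)
    also have "(\<Sum>\<gamma>\<in>\<Gamma>. \<Sum>\<delta>\<in>\<Gamma>. of_rat (d \<delta>) * (\<gamma> * of_rat (col \<delta> \<gamma>)))
        = (\<Sum>\<delta>\<in>\<Gamma>. of_rat (d \<delta>) * (\<Sum>\<gamma>\<in>\<Gamma>. \<gamma> * of_rat (col \<delta> \<gamma>)))"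
      by (subst sum.swap) (simp only: sum_distrib_left)
    also have "\<dots> = 0" using colsum by simp
    finally show ?thesis using fin \<Gamma>(1) by simp
  qed
  \<comment> \<open>Substitute \<open>\<eta> = \<gamma> * \<beta> p\<close>; the quadratic form of
    the matrix at \<open>d\<close> then becomes a sum of products that can be grouped into
    squares.\<close>
  have shift: "(\<Sum>\<gamma>\<in>\<Gamma>. \<Sum>\<delta>\<in>\<Gamma>. d \<gamma> * d \<delta> * of_bool (\<gamma> * \<beta> p = \<delta> * \<beta> q))
      = (\<Sum>\<eta>\<in>\<Gamma>. d (\<eta> / \<beta> p) * d (\<eta> / \<beta> q))" if "p \<in> P" "q \<in> P" for p q
  proof -
    have "(\<Sum>\<delta>\<in>\<Gamma>. d \<gamma> * d \<delta> * of_bool (\<gamma> * \<beta> p = \<delta> * \<beta> q)) = d \<gamma> * d (\<gamma> * \<beta> p / \<beta> q)"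
      if "\<gamma> \<in> \<Gamma>" for \<gamma>
    proof -
      have "\<gamma> * \<beta> p = \<delta> * \<beta> q \<longleftrightarrow> \<delta> = \<gamma> * \<beta> p / \<beta> q" for \<delta>
        using \<beta>0[OF \<open>q \<in> P\<close>] by (auto simp: eq_divide_eq)
      then have "(\<Sum>\<delta>\<in>\<Gamma>. d \<gamma> * d \<delta> * of_bool (\<gamma> * \<beta> p = \<delta> * \<beta> q))
          = (\<Sum>\<delta>\<in>\<Gamma>. if \<delta> = \<gamma> * \<beta> p / \<beta> q then d \<gamma> * d \<delta> else 0)"
        by (intro sum.cong) auto
      also have "\<dots> = d \<gamma> * d (\<gamma> * \<beta> p / \<beta> q)"
        using fin \<Gamma> \<beta> that \<open>p \<in> P\<close> \<open>q \<in> P\<close> by simp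
      finally show ?thesis .
    qed
    then have "(\<Sum>\<gamma>\<in>\<Gamma>. \<Sum>\<delta>\<in>\<Gamma>. d \<gamma> * d \<delta> * of_bool (\<gamma> * \<beta> p = \<delta> * \<beta> q))
        = (\<Sum>\<gamma>\<in>\<Gamma>. d \<gamma> * d (\<gamma> * \<beta> p / \<beta> q))" by simp
    also have "\<dots> = (\<Sum>\<eta>\<in>\<Gamma>. d (\<eta> / \<beta> p) * d (\<eta> / \<beta> q))"
      by (rule sum.reindex_bij_witness[of _ "\<lambda>\<eta>. \<eta> / \<beta> p" "\<lambda>\<gamma>. \<gamma> * \<beta> p"])
        (use \<beta>0 \<Gamma> \<beta> that in auto)
    finally show ?thesis .
  qed
  define g where "g = (\<lambda>\<eta> p. d (\<eta> / \<beta> p))"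
  define X where "X = (\<lambda>\<eta>. \<Sum>p\<in>P. \<Sum>q\<in>P. of_bool (r p = r q) * (g \<eta> p * g \<eta> q))"
  have "0 = (\<Sum>\<gamma>\<in>\<Gamma>. d \<gamma> * (\<Sum>\<delta>\<in>\<Gamma>. d \<delta> * col \<delta> \<gamma>))"
    using rel cNone by simp
  also have "\<dots> = (\<Sum>\<gamma>\<in>\<Gamma>. \<Sum>\<delta>\<in>\<Gamma>. \<Sum>p\<in>P. \<Sum>q\<in>P.
      of_bool (r p = r q) * (d \<gamma> * d \<delta> * of_bool (\<gamma> * \<beta> p = \<delta> * \<beta> q)))"
    unfolding col_def sum_distrib_left by (intro sum.cong refl) (simp add: of_bool_def)
  also have "\<dots> = (\<Sum>p\<in>P. \<Sum>q\<in>P. \<Sum>\<gamma>\<in>\<Gamma>. \<Sum>\<delta>\<in>\<Gamma>.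
      of_bool (r p = r q) * (d \<gamma> * d \<delta> * of_bool (\<gamma> * \<beta> p = \<delta> * \<beta> q)))"
    by (rule sum_swap_pairs)
  also have "\<dots> = (\<Sum>p\<in>P. \<Sum>q\<in>P. \<Sum>\<eta>\<in>\<Gamma>. of_bool (r p = r q) * (g \<eta> p * g \<eta> q))"
    unfolding g_def
    by (rule sum.cong[OF refl], rule sum.cong[OF refl]) (simp only: shift flip: sum_distrib_left)
  also have "\<dots> = (\<Sum>\<eta>\<in>\<Gamma>. X \<eta>)"
  proof -
    have "(\<Sum>\<eta>\<in>\<Gamma>. X \<eta>) = (\<Sum>p\<in>P. \<Sum>\<eta>\<in>\<Gamma>. \<Sum>q\<in>P. of_bool (r p = r q) * (g \<eta> p * g \<eta> q))"
      unfolding X_def by (rule sum.swap)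
    also have "\<dots> = (\<Sum>p\<in>P. \<Sum>q\<in>P. \<Sum>\<eta>\<in>\<Gamma>. of_bool (r p = r q) * (g \<eta> p * g \<eta> q))"
      by (rule sum.cong[OF refl], rule sum.swap)
    finally show ?thesis by simp
  qed
  finally have X0: "(\<Sum>\<eta>\<in>\<Gamma>. X \<eta>) = 0" by simp
  \<comment> \<open>Grouping by classes turns \<open>X \<eta>\<close> into a sum of rational
    squares, and the class of \<open>p0\<close> contributes a single term.\<close>
  have Xge: "(g \<eta> p0)\<^sup>2 \<le> X \<eta>" for \<eta>
  proof -
    define Y where "Y = (\<lambda>s. \<Sum>p\<in>P. of_bool (r p = s) * g \<eta> p)"
    have "X \<eta> = (\<Sum>p\<in>P. \<Sum>q\<in>P. \<Sum>s\<in>P. of_bool (r p = s) * g \<eta> p * (of_bool (r q = s) * g \<eta> q))"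
      unfolding X_def
    proof (intro sum.cong refl)
      fix p q assume p: "p \<in> P"
      have "(\<Sum>s\<in>P. of_bool (r p = s) * g \<eta> p * (of_bool (r q = s) * g \<eta> q))
          = (\<Sum>s\<in>P. if s = r p then of_bool (r q = s) * (g \<eta> p * g \<eta> q) else 0)"
        by (intro sum.cong) auto
      also have "\<dots> = of_bool (r p = r q) * (g \<eta> p * g \<eta> q)"
        using P rP(1)[OF p] by (auto simp: of_bool_def)
      finally show "of_bool (r p = r q) * (g \<eta> p * g \<eta> q)
          = (\<Sum>s\<in>P. of_bool (r p = s) * g \<eta> p * (of_bool (r q = s) * g \<eta> q))" by simp
    qed
    also have "\<dots> = (\<Sum>p\<in>P. \<Sum>s\<in>P. \<Sum>q\<in>P. of_bool (r p = s) * g \<eta> p * (of_bool (r q = s) * g \<eta> q))"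
      by (rule sum.cong[OF refl], rule sum.swap)
    also have "\<dots> = (\<Sum>s\<in>P. \<Sum>p\<in>P. \<Sum>q\<in>P. of_bool (r p = s) * g \<eta> p * (of_bool (r q = s) * g \<eta> q))"
      by (rule sum.swap)
    also have "\<dots> = (\<Sum>s\<in>P. (Y s)\<^sup>2)"
      by (simp only: Y_def power2_eq_square sum_product)
    finally have "X \<eta> = (\<Sum>s\<in>P. (Y s)\<^sup>2)" .
    moreover have "(Y (r p0))\<^sup>2 \<le> (\<Sum>s\<in>P. (Y s)\<^sup>2)"
      by (rule member_le_sum) (use P p0 rP in auto)
    moreover have "Y (r p0) = g \<eta> p0"
    proof -
      have "Y (r p0) = (\<Sum>p\<in>P. if p = p0 then g \<eta> p else 0)"
        unfolding Y_def using p0(2) by (intro sum.cong) auto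
      then show ?thesis using P p0(1) by simp
    qed
    ultimately show ?thesis by simp
  qed
  have "X \<eta> = 0" if "\<eta> \<in> \<Gamma>" for \<eta>
    using X0 fin that by (metis Xge order_trans sum_nonneg_eq_0_iff zero_le_power2)
  then have g0: "g \<eta> p0 = 0" if "\<eta> \<in> \<Gamma>" for \<eta>
    using Xge[of \<eta>] that by simp
  have "d \<gamma> = 0" if "\<gamma> \<in> \<Gamma>" for \<gamma>
    using g0[of "\<gamma> * \<beta> p0"] that \<Gamma>(2) \<beta>[OF p0(1)] \<beta>0[OF p0(1)] by (simp add: g_def)
  then show False using c(1) cNone by (auto simp: d_def)
qed

section \<open>The antipode is an involution\<close>

context semisimple_hopf
begin

text \<open>For good idempotents this is isomorphism of the simple left ideals generated by
  \<open>p\<close> and \<open>q\<close>, that is, membership in one matrix block.\<close>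

definition linked :: "('i \<Rightarrow> 'k) \<Rightarrow> ('i \<Rightarrow> 'k) \<Rightarrow> bool" where
  "linked p q \<longleftrightarrow> (\<exists>x. p \<cdot> x \<cdot> q \<noteq> 0)"

text \<open>A nonzero \<open>a\<close> between \<open>p\<close> and \<open>q\<close> satisfies
  \<open>a \<cdot> (h \<cdot> a) = a\<close> for some \<open>h\<close>, by the right unit of its
  left ideal. With \<open>b = q \<cdot> h \<cdot> p\<close>, both products lie in one-dimensional
  corners, and \<open>a \<cdot> (b \<cdot> a) = a\<close> makes the scalars 1.\<close>

lemma linked_iso:
  assumes p: "good p" and q: "good q" and pq: "linked p q"
  shows "\<exists>a b. p \<cdot> a = a \<and> a \<cdot> q = a \<and> q \<cdot> b = b \<and> b \<cdot> p = b \<and> a \<cdot> b = p \<and> b \<cdot> a = q"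
proof -
  have pp: "p \<cdot> p = p" and qq: "q \<cdot> q = q" using p q by (auto simp: good_def)
  obtain x where x: "p \<cdot> x \<cdot> q \<noteq> 0" using pq by (auto simp: linked_def)
  define a where "a = p \<cdot> x \<cdot> q"
  have pa: "p \<cdot> a = a" by (simp only: a_def pp flip: mul_assoc)
  have aq: "a \<cdot> q = a" by (simp only: a_def qq mul_assoc)
  obtain e where e: "e \<in> range (\<lambda>h. h \<cdot> a)" "\<forall>l\<in>range (\<lambda>h. h \<cdot> a). l \<cdot> e = l"
    using left_ideal_unit[OF left_ideal_principal] by blast
  then obtain h where h: "e = h \<cdot> a" by blast
  have "\<one> \<cdot> a \<cdot> e = \<one> \<cdot> a" using e(2) by blast
  then have aha: "a \<cdot> (h \<cdot> a) = a" using h by simp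
  define b where "b = q \<cdot> h \<cdot> p"
  have qb: "q \<cdot> b = b" by (simp only: b_def qq flip: mul_assoc)
  have bp: "b \<cdot> p = b" by (simp only: b_def pp mul_assoc)
  have "a \<cdot> q \<cdot> (h \<cdot> (p \<cdot> a)) = a" by (simp only: aq pa aha)
  then have aba: "a \<cdot> (b \<cdot> a) = a" by (simp only: b_def mul_assoc)
  have "p \<cdot> (a \<cdot> b) \<cdot> p = p \<cdot> a \<cdot> (b \<cdot> p)" by (simp only: mul_assoc)
  then have "p \<cdot> (a \<cdot> b) \<cdot> p = a \<cdot> b" by (simp only: pa bp)
  then obtain c where c: "a \<cdot> b = svec c p" using p unfolding good_def by metis
  have "a = a \<cdot> b \<cdot> a" by (simp only: mul_assoc aba)
  then have "a = svec c a" by (simp only: c mul_simps pa)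
  then have "c = 1" using x unfolding a_def[symmetric] by (auto simp: fun_eq_iff)
  have "q \<cdot> (b \<cdot> a) \<cdot> q = q \<cdot> b \<cdot> (a \<cdot> q)" by (simp only: mul_assoc)
  then have "q \<cdot> (b \<cdot> a) \<cdot> q = b \<cdot> a" by (simp only: qb aq)
  then obtain d where d: "b \<cdot> a = svec d q" using q unfolding good_def by metis
  have "a = svec d a" using aba by (simp only: d mul_simps aq)
  then have "d = 1" using x unfolding a_def[symmetric] by (auto simp: fun_eq_iff)
  show ?thesis using pa aq qb bp c d \<open>c = 1\<close> \<open>d = 1\<close> by auto
qed

lemma linked_refl: "good p \<Longrightarrow> linked p p"
  unfolding linked_def good_def by metis

lemma linked_sym: "good p \<Longrightarrow> good q \<Longrightarrow> linked p q \<Longrightarrow> linked q p"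
proof -
  assume g: "good p" "good q" "linked p q"
  obtain a b where ab: "q \<cdot> b = b" "b \<cdot> p = b" "a \<cdot> b = p" using linked_iso[OF g] by blast
  have "q \<cdot> b \<cdot> p = b" by (simp only: ab)
  moreover have "b \<noteq> 0" using ab g(1) unfolding good_def by auto
  ultimately show ?thesis unfolding linked_def by metis
qed

lemma linked_trans:
  assumes g: "good p" "good q" "good s" and "linked p q" "linked q s"
  shows "linked p s"
proof -
  obtain a b where ab: "p \<cdot> a = a" "a \<cdot> q = a" "a \<cdot> b = p"
    using linked_iso[OF g(1,2) assms(4)] by blast
  obtain c d where cd: "c \<cdot> s = c" "c \<cdot> d = q"
    using linked_iso[OF g(2,3) assms(5)] by blast
  have "a \<cdot> c \<cdot> (d \<cdot> b) = a \<cdot> (c \<cdot> d) \<cdot> b" by (simp only: mul_assoc)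
  also have "\<dots> = p" by (simp only: cd ab)
  finally have nz: "a \<cdot> c \<noteq> 0" using g(1) unfolding good_def by auto
  have "p \<cdot> (a \<cdot> c) \<cdot> s = p \<cdot> a \<cdot> (c \<cdot> s)" by (simp only: mul_assoc)
  also have "\<dots> = a \<cdot> c" by (simp only: ab cd)
  finally show ?thesis using nz unfolding linked_def by metis
qed

text \<open>Cyclicity along \<open>a\<close> and \<open>b\<close> replaces \<open>q\<close> by
  \<open>p\<close>, and the projection onto the corner of \<open>p\<close> has rank one.\<close>

lemma trace_corner:
  assumes g: "good p" "good q"
  shows "trace (\<lambda>x. p \<cdot> x \<cdot> q) = (if linked p q then 1 else 0)"
proof (cases "linked p q")
  case True
  obtain a b where ab: "a \<cdot> q = a" "b \<cdot> a = q" "a \<cdot> b = p" "b \<cdot> p = b"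
    using linked_iso[OF g True] by blast
  have pp: "p \<cdot> p = p" "p \<noteq> 0" using g by (auto simp: good_def)
  obtain i where i: "p i \<noteq> 0" using pp by (auto simp: fun_eq_iff)
  define \<phi> where "\<phi> = (\<lambda>x. (p \<cdot> x \<cdot> p) i / p i)"
  have \<phi>: "lin \<phi>"
    by (rule linI) (simp_all add: \<phi>_def mul_distrib add_divide_distrib)
  have \<phi>p: "\<phi> p = 1" using i by (simp add: \<phi>_def pp)
  have "p \<cdot> x \<cdot> p = svec (\<phi> x) p" for x
  proof -
    obtain c where c: "p \<cdot> x \<cdot> p = svec c p" using g unfolding good_def by metis
    then show ?thesis using i by (simp add: \<phi>_def)
  qed
  then have "trace (\<lambda>x. p \<cdot> x \<cdot> p) = trace (\<lambda>x. svec (\<phi> x) p)" by simp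
  also have "\<dots> = 1" by (simp add: trace_rank_one[OF \<phi>] \<phi>p)
  finally have 1: "trace (\<lambda>x. p \<cdot> x \<cdot> p) = 1" .
  have "trace (\<lambda>x. p \<cdot> x \<cdot> q) = trace (\<lambda>x. p \<cdot> x \<cdot> b \<cdot> a)"
    by (simp only: mul_assoc ab)
  also have "\<dots> = trace (\<lambda>x. p \<cdot> (x \<cdot> a) \<cdot> b)"
    by (rule trace_comm[of "\<lambda>y. y \<cdot> a" "\<lambda>x. p \<cdot> x \<cdot> b"]) (intro linop_intros)+
  also have "\<dots> = trace (\<lambda>x. p \<cdot> x \<cdot> p)"
    by (simp only: mul_assoc ab)
  finally show ?thesis using 1 True by simp
next
  case False
  then have "p \<cdot> x \<cdot> q = 0" for x by (simp add: linked_def)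
  then show ?thesis using False by (simp add: trace_def)
qed

section \<open>Eigenvalues of S^2 between primitive idempotents and the trace of S^2\<close>

definition evalue where "evalue p = (SOME \<alpha>. frob \<cdot> p = svec \<alpha> p)"

lemma evalue:
  assumes "good p"
  shows "frob \<cdot> p = svec (evalue p) p" "p \<cdot> frob = svec (evalue p) p" "evalue p \<noteq> 0"
proof -
  show 1: "frob \<cdot> p = svec (evalue p) p"
    using assms unfolding good_def evalue_def by (metis (mono_tags, lifting) someI_ex)
  have "sq p = p" using assms by (simp add: good_def)
  then show 2: "p \<cdot> frob = svec (evalue p) p" using mul_frob[of p] 1 by simp
  show "evalue p \<noteq> 0"
  proof
    assume "evalue p = 0"
    then have "p \<cdot> frob = 0" using 2 by simp
    then have "p = 0" by (rule mul_frob_eq_0)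
    then show False using assms by (simp add: good_def)
  qed
qed

text \<open>Right multiplication of \<open>p \<cdot> x \<cdot> q\<close> by \<open>frob\<close> is
  the eigenvalue of \<open>q\<close>; moved to the left by \<open>mul_frob\<close>, it is the
  eigenvalue of \<open>p\<close> with \<open>sq\<close> applied.\<close>

lemma sq_corner:
  assumes g: "good p" "good q"
  shows "sq (p \<cdot> x \<cdot> q) = svec (evalue q / evalue p) (p \<cdot> x \<cdot> q)"
proof -
  let ?y = "p \<cdot> x \<cdot> q"
  have "sq p = p" using g by (simp add: good_def)
  then have psy: "p \<cdot> sq ?y = sq ?y"
    using g by (simp add: sq_mul good_def flip: mul_assoc)
  have "?y \<cdot> frob = svec (evalue q) ?y" by (simp add: mul_assoc evalue(2)[OF g(2)])
  moreover have "?y \<cdot> frob = svec (evalue p) (sq ?y)"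
  proof -
    have "?y \<cdot> frob = frob \<cdot> (p \<cdot> sq ?y)" by (simp only: mul_frob psy)
    also have "\<dots> = svec (evalue p) (p \<cdot> sq ?y)"
      by (simp only: evalue(1)[OF g(1)] mul_simps flip: mul_assoc)
    finally show ?thesis by (simp only: psy)
  qed
  ultimately have "svec (1 / evalue p) (svec (evalue p) (sq ?y)) = svec (1 / evalue p) (svec (evalue q) ?y)"
    by simp
  then show ?thesis using evalue(3)[OF g(1)] by simp
qed

definition prims where
  "prims = (SOME P. finite P \<and> (\<forall>p\<in>P. good p) \<and> (\<forall>p\<in>P. \<forall>q\<in>P. p \<noteq> q \<longrightarrow> p \<cdot> q = 0) \<and> (\<Sum>p\<in>P. p) = \<one>)"

lemma prims:
  "finite prims" "p \<in> prims \<Longrightarrow> good p" "p \<in> prims \<Longrightarrow> q \<in> prims \<Longrightarrow> p \<noteq> q \<Longrightarrow> p \<cdot> q = 0"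
  "(\<Sum>p\<in>prims. p) = \<one>"
proof -
  have "\<exists>P. finite P \<and> (\<forall>p\<in>P. good p) \<and> (\<forall>p\<in>P. \<forall>q\<in>P. p \<noteq> q \<longrightarrow> p \<cdot> q = 0) \<and> (\<Sum>p\<in>P. p) = \<one>"
    using good_decomposition[OF one_mul sq_one] by metis
  from someI_ex[OF this, folded prims_def]
  show "finite prims" "p \<in> prims \<Longrightarrow> good p" "p \<in> prims \<Longrightarrow> q \<in> prims \<Longrightarrow> p \<noteq> q \<Longrightarrow> p \<cdot> q = 0"
    "(\<Sum>p\<in>prims. p) = \<one>" by blast+
qed

lemma trace_sq: "trace sq = (\<Sum>p\<in>prims. \<Sum>q\<in>prims. if linked p q then evalue q / evalue p else 0)"
proof -
  have "sq x = (\<Sum>p\<in>prims. \<Sum>q\<in>prims. sq (p \<cdot> x \<cdot> q))" for x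
  proof -
    have "x = (\<Sum>p\<in>prims. p) \<cdot> x \<cdot> (\<Sum>p\<in>prims. p)" by (simp add: prims)
    also have "\<dots> = (\<Sum>p\<in>prims. \<Sum>q\<in>prims. p \<cdot> x \<cdot> q)"
      by (simp only: mul_sum) (rule sum.swap)
    finally have "sq x = sq (\<Sum>p\<in>prims. \<Sum>q\<in>prims. p \<cdot> x \<cdot> q)" by simp
    then show ?thesis by (simp only: linop_sum[OF linop_sq])
  qed
  then have "sq = (\<lambda>x. \<Sum>p\<in>prims. \<Sum>q\<in>prims. sq (p \<cdot> x \<cdot> q))" by (rule ext)
  then have "trace sq = trace (\<lambda>x. \<Sum>p\<in>prims. \<Sum>q\<in>prims. sq (p \<cdot> x \<cdot> q))"
    by (rule arg_cong)
  also have "\<dots> = (\<Sum>p\<in>prims. \<Sum>q\<in>prims. trace (\<lambda>x. sq (p \<cdot> x \<cdot> q)))"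
    by (simp only: trace_sum)
  also have "\<dots> = (\<Sum>p\<in>prims. \<Sum>q\<in>prims. if linked p q then evalue q / evalue p else 0)"
  proof (intro sum.cong refl)
    fix p q assume "p \<in> prims" "q \<in> prims"
    then have g: "good p" "good q" by (simp_all only: prims(2))
    show "trace (\<lambda>x. sq (p \<cdot> x \<cdot> q)) = (if linked p q then evalue q / evalue p else 0)"
      by (simp add: sq_corner[OF g] trace_svec trace_corner[OF g])
  qed
  finally show ?thesis .
qed

text \<open>The block of the trivial representation. Some \<open>p\<close> has
  \<open>\<epsilon> p\<close> nonzero, and since \<open>p \<cdot> \<Lambda> \<cdot> p\<close> is a
  multiple of \<open>p\<close>, this \<open>p\<close> is a multiple of \<Lambda>. Another
  \<open>q\<close> is orthogonal to it, so \<open>\<epsilon> q = 0\<close> and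
  \<open>q \<cdot> x \<cdot> p = 0\<close>.\<close>

lemma trivial_prim: "\<exists>p\<in>prims. \<forall>q\<in>prims. linked q p \<longrightarrow> q = p"
proof -
  have "(\<Sum>p\<in>prims. \<epsilon> p) = 1"
    using lin_sum[OF lin_eps[OF linop_id], of "\<lambda>p. p" prims] by (simp add: prims)
  then obtain p where p: "p \<in> prims" "\<epsilon> p \<noteq> 0" by (metis sum.neutral zero_neq_one)
  have "\<exists>c. p \<cdot> \<Lambda> \<cdot> p = svec c p" using prims(2)[OF p(1)] unfolding good_def by blast
  then obtain c where c: "svec (\<epsilon> p * \<epsilon> p) \<Lambda> = svec c p" by auto
  have "\<Lambda> \<noteq> 0" using eps_integ lin_0[OF lin_eps[OF linop_id]] zero_neq_one by metis
  then have "c \<noteq> 0" using c p by (auto simp: svec_eq_0_iff)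
  define t where "t = \<epsilon> p * \<epsilon> p / c"
  have "svec (1 / c) (svec (\<epsilon> p * \<epsilon> p) \<Lambda>) = svec (1 / c) (svec c p)" using c by simp
  then have pt: "p = svec t \<Lambda>" using \<open>c \<noteq> 0\<close> by (simp add: t_def)
  have "q = p" if q: "q \<in> prims" "linked q p" for q
  proof (rule ccontr)
    assume "q \<noteq> p"
    then have "q \<cdot> p = 0" using prims(3) q p by blast
    then have "svec (\<epsilon> q) p = 0" by (simp add: pt mult.commute)
    moreover have "p \<noteq> 0" using prims(2)[OF p(1)] by (simp add: good_def)
    ultimately have "\<epsilon> q = 0" by (simp add: svec_eq_0_iff)
    then have "q \<cdot> x \<cdot> p = 0" for x by (simp add: pt)
    then show False using q(2) by (simp add: linked_def)
  qed
  then show ?thesis using p by blast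
qed

lemma trace_sq_nonzero: "trace sq \<noteq> 0"
proof -
  obtain M where M: "M > 0" "\<forall>x. (sq ^^ M) x = x" using sq_finite_order by blast
  obtain p0 where p0: "p0 \<in> prims" "\<forall>q\<in>prims. linked q p0 \<longrightarrow> q = p0" using trivial_prim by blast
  \<comment> \<open>Linked idempotents satisfy equivalent predicates here, so the choice operator
    returns one common representative per class.\<close>
  define r where "r = (\<lambda>p. SOME q. q \<in> prims \<and> linked q p)"
  have r: "r p \<in> prims" "linked (r p) p" if "p \<in> prims" for p
  proof -
    have "\<exists>q. q \<in> prims \<and> linked q p" using that linked_refl prims(2) by blast
    from someI_ex[OF this] show "r p \<in> prims" "linked (r p) p" by (auto simp: r_def)
  qed
  have r_eq: "r p = r q \<longleftrightarrow> linked p q" if "p \<in> prims" "q \<in> prims" for p q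
  proof
    assume "r p = r q"
    then have "linked p (r q)" "linked (r q) q" using r that linked_sym prims(2) by metis+
    then show "linked p q" using linked_trans prims(2) r that by blast
  next
    assume *: "linked p q"
    have "s \<in> prims \<and> linked s p \<longleftrightarrow> s \<in> prims \<and> linked s q" for s
      using * that linked_trans linked_sym prims(2) by blast
    then show "r p = r q" by (simp add: r_def)
  qed
  have "(\<Sum>p\<in>prims. \<Sum>q\<in>prims. if r p = r q then evalue q / evalue p else 0) \<noteq> 0"
  proof (rule sum_root_of_unity_ratios_nonzero[OF prims(1) M(1)])
    show "p0 \<in> prims" by fact
    show "evalue p \<noteq> 0" "r p \<in> prims" if "p \<in> prims" for p
      using that evalue(3) prims(2) r by auto
    show "r (r p) = r p" if "p \<in> prims" for p
      using r_eq[OF r(1)[OF that] that] r(2)[OF that] by simp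
    show "p = p0" if "p \<in> prims" "r p = r p0" for p
      using r_eq[OF that(1) p0(1)] that p0(2) by blast
    show "(evalue q / evalue p) ^ M = 1" if pq: "p \<in> prims" "q \<in> prims" "r p = r q" for p q
    proof -
      obtain x where x: "p \<cdot> x \<cdot> q \<noteq> 0" using pq r_eq by (auto simp: linked_def)
      define y where "y = p \<cdot> x \<cdot> q"
      define t where "t = evalue q / evalue p"
      have t: "sq y = svec t y" unfolding y_def t_def using sq_corner pq prims(2) by blast
      have "(sq ^^ n) y = svec (t ^ n) y" for n
      proof (induction n)
        case (Suc n)
        have "(sq ^^ Suc n) y = sq (svec (t ^ n) y)" by (simp only: funpow.simps o_apply Suc)
        also have "\<dots> = svec (t ^ Suc n) y"
          by (simp only: linopD[OF linop_sq] t svec_simps power_Suc2)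
        finally show ?case .
      qed simp
      then have "svec (t ^ M) y = y" using M(2) by metis
      then show ?thesis using x unfolding t_def[symmetric] y_def[symmetric] by (auto simp: fun_eq_iff)
    qed
  qed
  moreover have "(\<Sum>p\<in>prims. \<Sum>q\<in>prims. if r p = r q then evalue q / evalue p else 0) = trace sq"
    unfolding trace_sq by (intro sum.cong refl) (simp add: r_eq)
  ultimately show ?thesis by simp
qed

section \<open>Consequences of the nonvanishing trace\<close>

lemma lam_one: "lam \<one> = trace sq"
  by (simp add: lam_def trace_def sq_def)

text \<open>Evaluating \<open>lam_right\<close> at the identity gives
  \<open>lam \<one> * F dgl = lam \<one> * F \<one>\<close>, and \<open>lam \<one>\<close> is the
  nonzero trace of S^2. So \<open>dgl\<close> is the identity and Radford's formula reads S^4 =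
  id.\<close>

lemma sq_sq [simp]: "sq (sq x) = x"
proof -
  have "dgl = \<one>"
  proof (rule vec_eqI)
    fix F :: "('i \<Rightarrow> 'k) \<Rightarrow> 'k" assume F: "lin F"
    have "sw \<one> (\<lambda>p q. lam p * F q) = lam \<one> * F \<one>"
      by (intro sw_one lin_times lin_comp[OF F] lin_comp[OF lin_lam] linop_intros)
    then show "F dgl = F \<one>" using lam_right[OF F, of \<one>] trace_sq_nonzero by (simp add: lam_one)
  qed
  then show ?thesis using antip4[of x] by (simp add: sq_def)
qed

text \<open>On characters this says that the regular module absorbs tensor factors. The proof
  rotates the trace as for \<open>lam\<close>, starting from \<open>h\<^sub>1 \<cdot> x\<close>
  paired with \<open>h\<^sub>2\<close> rewritten through the coproduct of
  \<open>h \<cdot> x\<^sub>1\<close>; the symmetry of \<open>F\<close> allows the final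
  cancellation.\<close>

lemma chi_convolution:
  assumes F: "lin F" and comm: "\<And>x y. F (x \<cdot> y) = F (y \<cdot> x)"
  shows "sw h (\<lambda>p q. chi p * F q) = F \<one> * chi h"
proof -
  define T where "T = (\<lambda>x. h \<cdot> x)"
  have T: "linop T" unfolding T_def by (intro linop_intros)
  note li = lin_times lin_comp[OF F] lin_comp[OF lin_coord] linop_intros
  have 1: "sw h (\<lambda>p q. (p \<cdot> x) k * F q) = sw x (\<lambda>x1 x2. sw (T x1) (\<lambda>r s. r k * F (s \<cdot> \<S> x2)))" for x k
  proof -
    have a: "sw y (\<lambda>b x2. F (q \<cdot> b \<cdot> \<S> x2)) = \<epsilon> y * F q" for q y
    proof -
      have "lin (\<lambda>z. F (q \<cdot> z))" by (intro li)
      from sw_antipode_right[OF this, of y] show ?thesis by (simp add: mul_assoc)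
    qed
    have "sw x (\<lambda>x1 x2. sw (T x1) (\<lambda>r s. r k * F (s \<cdot> \<S> x2)))
        = sw x (\<lambda>x1 x2. sw h (\<lambda>p q. sw x1 (\<lambda>a b. (p \<cdot> a) k * F (q \<cdot> b \<cdot> \<S> x2))))"
      unfolding T_def by (intro sw_cong sw_mul li lin_coord)
    also have "\<dots> = sw h (\<lambda>p q. sw x (\<lambda>x1 x2. sw x1 (\<lambda>a b. (p \<cdot> a) k * F (q \<cdot> b \<cdot> \<S> x2))))"
      by (rule sw_commute)
    also have "\<dots> = sw h (\<lambda>p q. sw x (\<lambda>a y. sw y (\<lambda>b x2. (p \<cdot> a) k * F (q \<cdot> b \<cdot> \<S> x2))))"
      by (intro sw_cong sw_coassoc)
    also have "\<dots> = sw h (\<lambda>p q. sw x (\<lambda>a y. \<epsilon> y * ((p \<cdot> a) k * F q)))"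
      unfolding sw_times a by (simp only: mult.left_commute)
    also have "\<dots> = sw h (\<lambda>p q. (p \<cdot> x) k * F q)"
      by (intro sw_cong sw_counit_right li)
    finally show ?thesis by simp
  qed
  have 2: "sw y (\<lambda>q s. F (s \<cdot> \<S> q)) = \<epsilon> y * F \<one>" for y
    unfolding comm[of _ "\<S> _"] by (rule sw_antipode_left[OF F])
  have "sw h (\<lambda>p q. chi p * F q) = (\<Sum>k\<in>UNIV. sw h (\<lambda>p q. (p \<cdot> bv k) k * F q))"
    by (simp add: chi_def trace_def sum_distrib_right sw_sum)
  also have "\<dots> = (\<Sum>k\<in>UNIV. sw (bv k) (\<lambda>x1 x2. sw (T x1) (\<lambda>r s. r k * F (s \<cdot> \<S> x2))))"
    unfolding 1 ..
  also have "\<dots> = (\<Sum>k\<in>UNIV. \<Sum>m\<in>UNIV. sw (bv k) (\<lambda>x1 x2. sw (bv m) (\<lambda>r s. T x1 m * (r k * F (s \<cdot> \<S> x2)))))"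
    by (subst (2) sw_expand) (simp add: sw_sum sw_times)
  also have "\<dots> = (\<Sum>m\<in>UNIV. \<Sum>k\<in>UNIV. sw (bv m) (\<lambda>r s. sw (bv k) (\<lambda>x1 x2. T x1 m * (r k * F (s \<cdot> \<S> x2)))))"
    by (subst sum.swap, rule sum.cong[OF refl], rule sum.cong[OF refl], rule sw_commute)
  also have "\<dots> = (\<Sum>m\<in>UNIV. sw (bv m) (\<lambda>r s. \<Sum>k\<in>UNIV. r k * sw (bv k) (\<lambda>x1 x2. T x1 m * F (s \<cdot> \<S> x2))))"
    by (simp add: sw_sum mult_ac flip: sw_times)
  also have "\<dots> = (\<Sum>m\<in>UNIV. sw (bv m) (\<lambda>r s. sw r (\<lambda>x1 x2. T x1 m * F (s \<cdot> \<S> x2))))"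
    by (simp flip: sw_expand)
  also have "\<dots> = (\<Sum>m\<in>UNIV. sw (bv m) (\<lambda>x1 y. sw y (\<lambda>x2 s. T x1 m * F (s \<cdot> \<S> x2))))"
    by (intro sum.cong refl sw_coassoc)
  also have "\<dots> = (\<Sum>m\<in>UNIV. sw (bv m) (\<lambda>x1 y. \<epsilon> y * (F \<one> * T x1 m)))"
    unfolding sw_times 2 by (simp only: mult_ac)
  also have "\<dots> = (\<Sum>m\<in>UNIV. F \<one> * T (bv m) m)"
    by (intro sum.cong refl sw_counit_right lin_times lin_comp[OF lin_coord] T)
  also have "\<dots> = F \<one> * chi h"
    by (simp add: chi_def trace_def T_def sum_distrib_left)
  finally show ?thesis .
qed

lemma chi_sq: "chi (sq q) = chi q"
proof -
  have "chi (sq q) = trace (\<lambda>x. sq (q \<cdot> sq x))" by (simp add: chi_def trace_def sq_mul)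
  also have "\<dots> = trace (\<lambda>x. q \<cdot> sq (sq x))"
    by (rule trace_comm[of sq "\<lambda>x. q \<cdot> sq x"]) (intro linop_sq linop_mul_right)+
  finally show ?thesis by (simp add: chi_def trace_def)
qed

text \<open>\<open>A\<close> and \<open>B\<close> project onto the eigenspaces of \<open>sq\<close>
  for 1 and -1 inside the image of \<open>P\<close>; \<open>a\<close> and \<open>b\<close> are their
  ranks.\<close>

lemma trace_involution_integral:
  assumes P: "linop P" "\<And>x. P (P x) = P x" "\<And>x. P (sq x) = sq (P x)"
  shows "\<exists>(a::nat) b. trace P = of_nat a + of_nat b \<and> trace (\<lambda>x. sq (P x)) = of_nat a - of_nat b
     \<and> (a = 0 \<longrightarrow> (\<forall>x. sq (P x) = - P x)) \<and> (b = 0 \<longrightarrow> (\<forall>x. sq (P x) = P x))"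
proof -
  define A where "A = (\<lambda>x. svec (1/2) (P x + sq (P x)))"
  define B where "B = (\<lambda>x. svec (1/2) (P x - sq (P x)))"
  note sqP = linop_comp[OF linop_sq P(1)]
  note ps = linopD[OF P(1)] linop_diff[OF P(1)] linopD[OF linop_sq] linop_diff[OF linop_sq] P(2,3) sq_sq
  have A: "linop A" "A (A x) = A x" for x
    unfolding A_def by (intro linop_svec linop_add P sqP, simp only: ps) (simp add: fun_eq_iff field_simps)
  have B: "linop B" "B (B x) = B x" for x
    unfolding B_def by (intro linop_svec linop_diff_op P sqP, simp only: ps) (simp add: fun_eq_iff field_simps)
  obtain a where a: "trace A = of_nat a" "a = 0 \<longrightarrow> (\<forall>x. A x = 0)" using trace_idempotent[OF A] by blast
  obtain b where b: "trace B = of_nat b" "b = 0 \<longrightarrow> (\<forall>x. B x = 0)" using trace_idempotent[OF B] by blast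
  have "of_nat a + of_nat b = trace P" "of_nat a - of_nat b = trace (\<lambda>x. sq (P x))"
    unfolding a(1)[symmetric] b(1)[symmetric] A_def B_def trace_svec trace_add trace_diff
    by (simp_all add: field_simps)
  moreover have "sq (P x) = - P x" if "a = 0" for x
    using a(2) that by (auto simp: A_def svec_eq_0_iff add_eq_0_iff)
  moreover have "sq (P x) = P x" if "b = 0" for x
    using b(2) that by (auto simp: B_def svec_eq_0_iff)
  ultimately show ?thesis by metis
qed

text \<open>Larson and Radford: the normalised regular character \<open>chi / n\<close> is an idempotent of the dual
  algebra. The trace of the squared antipode on the corresponding ideal is an integer and equals
  the full trace divided by \<open>n\<close>; since the full trace is nonzero and at most \<open>n\<close> in absolute
  value, it must be \<open>n\<close>.\<close>

lemma antipode_involutive: "\<S> (\<S> x) = x"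
proof -
  define n where "n = card (UNIV :: 'i set)"
  have n: "n > 0" by (simp add: n_def card_gt_0_iff)
  have chi1: "chi \<one> = of_nat n" by (simp add: chi_def trace_def n_def bv_def)
  \<comment> \<open>The action of the dual element \<open>chi / n\<close> on the Hopf algebra,
    sending \<open>x\<close> to \<open>x\<^sub>1\<close> weighted by
    \<open>chi x\<^sub>2 / n\<close>. It is idempotent because \<open>chi\<close> convolved with
    itself is \<open>n\<close> times \<open>chi\<close>.\<close>
  define P where "P = (\<lambda>x. svec (1 / of_nat n) (swv x (\<lambda>p q. svec (chi q) p)))"
  have FP: "F (P x) = 1 / of_nat n * sw x (\<lambda>p q. chi q * F p)" if F: "lin F" for F x
    unfolding P_def by (simp add: linD[OF F] lin_swv[OF F])
  have linP: "linop P"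
  proof (rule linopI)
    show "P (x + y) = P x + P y" for x y
      by (rule vec_eqI) (simp add: FP linD linD[OF lin_sw[OF linop_id]] distrib_left)
    show "P (svec c x) = svec c (P x)" for c x
      by (rule vec_eqI) (simp add: FP linD linD[OF lin_sw[OF linop_id]])
  qed
  have PP: "P (P x) = P x" for x
  proof (rule vec_eqI)
    fix F :: "('i \<Rightarrow> 'k) \<Rightarrow> 'k" assume F: "lin F"
    have "F (P (P x)) = 1 / of_nat n * (1 / of_nat n * sw x (\<lambda>p q. chi q * sw p (\<lambda>r s. chi s * F r)))"
      by (subst FP[OF F], subst FP[OF lin_sw[OF linop_id]]) (rule refl)
    also have "sw x (\<lambda>p q. chi q * sw p (\<lambda>r s. chi s * F r)) = sw x (\<lambda>p q. sw p (\<lambda>r s. chi s * chi q * F r))"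
      by (simp only: mult_ac flip: sw_times)
    also have "\<dots> = sw x (\<lambda>r y. sw y (\<lambda>s q. chi s * chi q * F r))"
      by (rule sw_coassoc)
    also have "\<dots> = sw x (\<lambda>r y. of_nat n * (chi y * F r))"
      unfolding sw_times chi_convolution[OF lin_chi chi_comm] chi1 by (simp only: sw_times mult.assoc)
    also have "\<dots> = of_nat n * sw x (\<lambda>r y. chi y * F r)" by (rule sw_times)
    finally show "F (P (P x)) = F (P x)" using n by (simp add: FP[OF F])
  qed
  have Psq: "P (sq x) = sq (P x)" for x
  proof (rule vec_eqI)
    fix F :: "('i \<Rightarrow> 'k) \<Rightarrow> 'k" assume F: "lin F"
    have "sw (sq x) (\<lambda>p q. chi q * F p) = sw x (\<lambda>p q. chi (sq q) * F (sq p))"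
      unfolding sq_def by (intro sw_antip2 lin_times lin_comp[OF lin_chi] lin_comp[OF F] linop_intros)
    then show "F (P (sq x)) = F (sq (P x))"
      using FP[OF lin_comp[OF F linop_sq], of x] by (simp add: FP[OF F] chi_sq)
  qed
  have "trace (\<lambda>x. sq (P x)) = lam \<one> / of_nat n"
  proof -
    \<comment> \<open>\<open>sq r \<cdot> \<S> p\<close> is the antipode of
      \<open>p \<cdot> \<S> r\<close>, so in the dual bases the trace collapses to
      \<open>lam \<one>\<close> times \<open>chi \<Lambda>\<close>, divided by
      \<open>n\<close>.\<close>
    have a: "sw y (\<lambda>p r. lam (sq r \<cdot> \<S> p)) = \<epsilon> y * lam \<one>" for y
    proof -
      have "lin (\<lambda>z. lam (\<S> z))" by (intro lin_comp[OF lin_lam] linop_intros)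
      from sw_antipode_right[OF this, of y] show ?thesis by (simp add: sq_def antip_mul)
    qed
    have "trace (\<lambda>x. sq (P x)) = sw \<Lambda> (\<lambda>p q. lam (sq (P q) \<cdot> \<S> p))"
      by (rule trace_eq_sw[OF linop_comp[OF linop_sq linP]])
    also have "\<dots> = sw \<Lambda> (\<lambda>p q. 1 / of_nat n * sw q (\<lambda>r s. chi s * lam (sq r \<cdot> \<S> p)))"
      by (intro sw_cong FP lin_comp[OF lin_lam] linop_mul_left linop_sq)
    also have "\<dots> = 1 / of_nat n * sw \<Lambda> (\<lambda>p q. sw q (\<lambda>r s. chi s * lam (sq r \<cdot> \<S> p)))"
      by (rule sw_times)
    also have "sw \<Lambda> (\<lambda>p q. sw q (\<lambda>r s. chi s * lam (sq r \<cdot> \<S> p)))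
        = sw \<Lambda> (\<lambda>y s. sw y (\<lambda>p r. chi s * lam (sq r \<cdot> \<S> p)))"
      by (rule sw_coassoc[symmetric])
    also have "\<dots> = sw \<Lambda> (\<lambda>y s. \<epsilon> y * (lam \<one> * chi s))"
      unfolding sw_times a by (simp only: mult_ac)
    also have "\<dots> = lam \<one> * chi \<Lambda>" by (intro sw_counit_left lin_times lin_chi)
    also have "chi \<Lambda> = 1"
    proof -
      have "chi \<Lambda> = trace (\<lambda>x. svec (\<epsilon> x) \<Lambda>)" by (simp add: chi_def trace_def)
      then show ?thesis by (simp add: trace_rank_one[OF lin_eps[OF linop_id]])
    qed
    finally show ?thesis by simp
  qed
  moreover obtain a b where "trace (\<lambda>x. sq (P x)) = of_nat a - of_nat b"
    using trace_involution_integral[OF linP PP Psq] by blast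
  moreover obtain c d where cd: "trace (\<lambda>x :: 'i \<Rightarrow> 'k. x) = of_nat c + of_nat d" "trace sq = of_nat c - of_nat d"
    "c = 0 \<longrightarrow> (\<forall>x. sq x = - x)" "d = 0 \<longrightarrow> (\<forall>x. sq x = x)"
    using trace_involution_integral[OF linop_id] by blast
  ultimately have "of_nat c - of_nat d = of_nat n * (of_nat a - of_nat b :: 'k)"
    using n by (simp add: lam_one)
  then have "(of_int (int c - int d) :: 'k) = of_int (int n * (int a - int b))" by simp
  then have 1: "int c - int d = int n * (int a - int b)" by (simp only: of_int_eq_iff)
  have "(of_nat n :: 'k) = of_nat (c + d)" using cd(1) by (simp add: trace_id n_def)
  then have 2: "n = c + d" by (simp only: of_nat_eq_iff)
  have "c \<noteq> d" using cd(2) trace_sq_nonzero by auto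
  then have "int a - int b \<noteq> 0" using 1 by auto
  then have "int n * 1 \<le> int n * \<bar>int a - int b\<bar>" by (intro mult_left_mono) auto
  also have "\<dots> = \<bar>int c - int d\<bar>" by (simp add: 1 abs_mult)
  finally have "c = 0 \<or> d = 0" using 2 by auto
  \<comment> \<open>Otherwise S^2 would be -id, although it fixes the identity.\<close>
  moreover have "c \<noteq> 0"
  proof
    assume "c = 0"
    then have "sq \<one> = - \<one>" using cd(3) by blast
    then have "\<one> i = - \<one> i" for i by (metis sq_one fun_Compl_def uminus_apply)
    then have "\<one> = 0" by (auto simp: fun_eq_iff)
    then show False using one_neq_0 by blast
  qed
  ultimately have "sq x = x" using cd(4) by blast
  then show ?thesis by (simp add: sq_def)
qed

end

section \<open>Characters and trace functions\<close>

text \<open>One instance covers vectors, tensors and functionals, since all of them are functions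
  into the field.\<close>

interpretation fun_space: vector_space "svec :: 'k::field \<Rightarrow> ('a \<Rightarrow> 'k) \<Rightarrow> ('a \<Rightarrow> 'k)"
  by unfold_locales (auto simp: fun_eq_iff algebra_simps)

lemma subspace_fun_space: "fun_space.subspace V \<longleftrightarrow> is_subspace V"
  by (simp add: fun_space.subspace_def is_subspace_def)

lemma tspan_eq: "tspan S = fun_space.span S"
  by (simp add: tspan_def)

lemma tspan_induct:
  assumes "x \<in> tspan S" "is_subspace V" "S \<subseteq> V"
  shows "x \<in> V"
  using fun_space.span_minimal[of S V] assms by (auto simp: tspan_eq subspace_fun_space)

text \<open>Compose \<open>f\<close> with a linear retraction onto \<open>K\<close>.\<close>

lemma linear_extension:
  assumes K: "is_subspace K" and f: "lin_on K f"
  shows "\<exists>F. lin F \<and> (\<forall>x\<in>K. F x = f x)"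
proof -
  interpret vector_space_pair "svec :: 'b::field \<Rightarrow> ('a \<Rightarrow> 'b) \<Rightarrow> ('a \<Rightarrow> 'b)" "svec :: 'b \<Rightarrow> ('a \<Rightarrow> 'b) \<Rightarrow> ('a \<Rightarrow> 'b)"
    by unfold_locales
  obtain g where g: "range g \<subseteq> K" "Vector_Spaces.linear svec svec g" "\<forall>v\<in>K. g (id v) = v"
    using linear_exists_left_inverse_on[OF fun_space.linear_id, of K] K
    by (auto simp: subspace_fun_space)
  interpret g: Vector_Spaces.linear svec svec g by fact
  have gK: "g x \<in> K" for x using g(1) by auto
  have "lin (\<lambda>x. f (g x))"
    using f gK by (intro linI) (simp_all add: g.add g.scale lin_on_def)
  then show ?thesis using g(3) by auto
qed

context semisimple_hopf
begin

text \<open>The character of the left ideal generated by an idempotent \<open>p\<close>: right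
  multiplication by \<open>p\<close> projects onto it.\<close>

definition left_char :: "('i \<Rightarrow> 'k) \<Rightarrow> ('i \<Rightarrow> 'k) \<Rightarrow> 'k" where
  "left_char p h = trace (\<lambda>x. h \<cdot> x \<cdot> p)"

lemma left_char_is_character:
  assumes pp: "p \<cdot> p = p"
  shows "\<exists>n \<rho>. left_char p = character UNIV n \<rho> \<and> is_rep H UNIV n \<rho>"
proof -
  have "x \<cdot> p \<cdot> p = x \<cdot> p" for x by (simp only: mul_assoc pp)
  from idempotent_operator_decomp[OF linop_mul_left[OF linop_id] this]
  obtain n :: nat and \<phi> v where
    d: "\<forall>m<n. lin (\<phi> m)" "\<forall>m<n. \<forall>l<n. \<phi> m (v l) = of_bool (m = l)"
       "\<forall>x. x \<cdot> p = (\<Sum>m<n. svec (\<phi> m x) (v m))" by blast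
  have vp: "v l \<cdot> p = v l" if "l < n" for l
  proof -
    have "v l \<cdot> p = (\<Sum>m<n. if m = l then v m else 0)"
      unfolding d(3)[rule_format] by (rule sum.cong[OF refl]) (use d(2) that in auto)
    then show ?thesis using that by simp
  qed
  \<comment> \<open>The vectors \<open>v l\<close> form a basis of the left ideal of
    \<open>p\<close> with coordinates \<open>\<phi> m\<close>; this is the matrix of left
    multiplication in it.\<close>
  define \<rho> where "\<rho> = (\<lambda>h m l. \<phi> m (h \<cdot> v l))"
  have "is_rep H UNIV n \<rho>"
    unfolding is_rep_def
  proof (intro allI impI conjI ballI)
    fix m l assume m: "m < n" and l: "l < n"
    have \<phi>l: "lin (\<phi> m)" using d(1) m by blast
    have lin: "lin (\<lambda>h. \<phi> m (h \<cdot> v l))" by (intro lin_comp[OF \<phi>l] linop_intros)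
    show "\<rho> (x + y) m l = \<rho> x m l + \<rho> y m l" for x y unfolding \<rho>_def by (rule linD[OF lin])
    show "\<rho> (svec c x) m l = c * \<rho> x m l" for c x unfolding \<rho>_def by (rule linD[OF lin])
    show "\<rho> \<one> m l = (if m = l then 1 else 0)" using d m l by (simp add: \<rho>_def)
    show "\<rho> (x \<cdot> y) m l = (\<Sum>r<n. \<rho> x m r * \<rho> y r l)" for x y
    proof -
      have "x \<cdot> y \<cdot> v l = x \<cdot> (y \<cdot> v l \<cdot> p)" using vp[OF l] by (simp only: mul_assoc)
      also have "\<dots> = (\<Sum>r<n. svec (\<phi> r (y \<cdot> v l)) (x \<cdot> v r))" by (simp only: d(3) mul_sum mul_simps)
      finally show ?thesis
        by (simp add: \<rho>_def lin_sum[OF \<phi>l] linD[OF \<phi>l] mult.commute)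
    qed
  qed
  moreover have "left_char p = character UNIV n \<rho>"
  proof
    fix h
    have "h \<cdot> x \<cdot> p = (\<Sum>m<n. svec (\<phi> m x) (h \<cdot> v m))" for x
    proof -
      have "h \<cdot> x \<cdot> p = h \<cdot> (x \<cdot> p)" by (rule mul_assoc)
      also have "\<dots> = (\<Sum>m<n. svec (\<phi> m x) (h \<cdot> v m))" by (simp only: d(3) mul_sum mul_simps)
      finally show ?thesis .
    qed
    then have "(\<lambda>x. h \<cdot> x \<cdot> p) = (\<lambda>x. \<Sum>m<n. svec (\<phi> m x) (h \<cdot> v m))" by (rule ext)
    then have "left_char p h = trace (\<lambda>x. \<Sum>m<n. svec (\<phi> m x) (h \<cdot> v m))"
      unfolding left_char_def by (rule arg_cong)
    also have "\<dots> = (\<Sum>m<n. \<phi> m (h \<cdot> v m))"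
      unfolding trace_sum using d(1) by (intro sum.cong refl trace_rank_one) auto
    finally show "left_char p h = character UNIV n \<rho> h"
      by (simp add: character_def zrestr_def \<rho>_def)
  qed
  ultimately show ?thesis by blast
qed

definition trace_function :: "(('i \<Rightarrow> 'k) \<Rightarrow> 'k) \<Rightarrow> bool" where
  "trace_function f \<longleftrightarrow> lin f \<and> (\<forall>x y. f (x \<cdot> y) = f (y \<cdot> x))"

lemma trace_function_of_character:
  assumes "is_rep H UNIV n \<rho>"
  shows "trace_function (character UNIV n \<rho>)"
proof -
  have 1: "\<rho> (x + y) p q = \<rho> x p q + \<rho> y p q" "\<rho> (svec c x) p q = c * \<rho> x p q"
    "\<rho> (x \<cdot> y) p q = (\<Sum>r<n. \<rho> x p r * \<rho> y r q)" if "p < n" "q < n" for p q x y c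
    using assms that unfolding is_rep_def by blast+
  have "(\<Sum>p<n. \<rho> (x \<cdot> y) p p) = (\<Sum>p<n. \<rho> (y \<cdot> x) p p)" for x y
  proof -
    have "(\<Sum>p<n. \<rho> (x \<cdot> y) p p) = (\<Sum>p<n. \<Sum>r<n. \<rho> x p r * \<rho> y r p)" by (simp add: 1)
    also have "\<dots> = (\<Sum>r<n. \<Sum>p<n. \<rho> y r p * \<rho> x p r)" by (subst sum.swap) (simp only: mult.commute)
    also have "\<dots> = (\<Sum>p<n. \<rho> (y \<cdot> x) p p)" by (simp add: 1)
    finally show ?thesis .
  qed
  then show ?thesis
    by (auto simp: trace_function_def character_def zrestr_def 1 sum.distrib sum_distrib_left intro!: linI)
qed

lemma trace_function_of_char_ring: "f \<in> char_ring H UNIV \<Longrightarrow> trace_function f"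
proof -
  assume f: "f \<in> char_ring H UNIV"
  have "is_subspace {f. trace_function f}"
    by (simp add: is_subspace_def trace_function_def lin_on_def algebra_simps)
  then have "f \<in> {f. trace_function f}"
    by (rule tspan_induct[OF f[unfolded char_ring_def]]) (auto intro: trace_function_of_character)
  then show ?thesis by simp
qed

text \<open>A trace function is determined by its values on the primitive idempotents:
  \<open>f h\<close> is the sum of \<open>coef q h * f q\<close>. These values are constant on
  linked classes, and \<open>left_char p\<close> sums the coefficients over the class of
  \<open>p\<close>. Dividing by the class size \<open>N p\<close> corrects for each class being
  counted once per member.\<close>

lemma char_ring_of_trace_function:
  assumes f: "trace_function f"
  shows "f \<in> char_ring H UNIV"
proof -
  have fl: "lin f" and fc: "\<And>x y. f (x \<cdot> y) = f (y \<cdot> x)" using f by (auto simp: trace_function_def)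
  define coef where "coef = (\<lambda>q h. SOME c. q \<cdot> h \<cdot> q = svec c q)"
  have coef: "q \<cdot> h \<cdot> q = svec (coef q h) q" if "q \<in> prims" for q h
  proof -
    have "\<exists>c. q \<cdot> h \<cdot> q = svec c q" using prims(2)[OF that] unfolding good_def by blast
    then show ?thesis unfolding coef_def by (rule someI_ex)
  qed
  have idem: "q \<cdot> q = q" if "q \<in> prims" for q using prims(2)[OF that] unfolding good_def by blast
  define \<kappa> :: "('i \<Rightarrow> 'k) \<Rightarrow> ('i \<Rightarrow> 'k) \<Rightarrow> 'k" where "\<kappa> = (\<lambda>p q. of_bool (linked p q))"
  define N where "N = (\<lambda>p. \<Sum>q\<in>prims. \<kappa> q p)"
  have char: "left_char p h = (\<Sum>q\<in>prims. coef q h * \<kappa> q p)" if p: "p \<in> prims" for p h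
  proof -
    have "h \<cdot> x \<cdot> p = (\<Sum>q\<in>prims. q \<cdot> (h \<cdot> x \<cdot> p))" for x
      by (simp only: prims(4) one_mul flip: mul_sum)
    then have "(\<lambda>x. h \<cdot> x \<cdot> p) = (\<lambda>x. \<Sum>q\<in>prims. q \<cdot> (h \<cdot> x \<cdot> p))" by (rule ext)
    then have "left_char p h = trace (\<lambda>x. \<Sum>q\<in>prims. q \<cdot> (h \<cdot> x \<cdot> p))"
      unfolding left_char_def by (rule arg_cong)
    also have "\<dots> = (\<Sum>q\<in>prims. trace (\<lambda>x. q \<cdot> (h \<cdot> x \<cdot> p)))" by (rule trace_sum)
    also have "\<dots> = (\<Sum>q\<in>prims. coef q h * \<kappa> q p)"
    proof (rule sum.cong[OF refl])
      fix q assume q: "q \<in> prims"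
      have "trace (\<lambda>x. q \<cdot> (h \<cdot> x \<cdot> p)) = trace (\<lambda>x. q \<cdot> (q \<cdot> (h \<cdot> x \<cdot> p)))"
        by (simp only: idem[OF q] flip: mul_assoc)
      also have "\<dots> = trace (\<lambda>x. q \<cdot> (h \<cdot> (q \<cdot> x) \<cdot> p))"
        by (rule trace_comm[of "\<lambda>x. q \<cdot> x" "\<lambda>x. q \<cdot> (h \<cdot> x \<cdot> p)"]) (intro linop_intros)+
      also have "\<dots> = trace (\<lambda>x. svec (coef q h) (q \<cdot> x \<cdot> p))"
        by (simp only: coef[OF q] mul_simps flip: mul_assoc)
      also have "\<dots> = coef q h * \<kappa> q p"
        using trace_corner[OF prims(2)[OF q] prims(2)[OF p]] by (simp add: trace_svec \<kappa>_def)
      finally show "trace (\<lambda>x. q \<cdot> (h \<cdot> x \<cdot> p)) = coef q h * \<kappa> q p" .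
    qed
    finally show ?thesis .
  qed
  have lk: "N p = N q" "f p = f q" if pq: "p \<in> prims" "q \<in> prims" "linked q p" for p q
  proof -
    note g = prims(2)[OF pq(1)] prims(2)[OF pq(2)]
    have "linked s p = linked s q" if "s \<in> prims" for s
      using linked_trans linked_sym prims(2)[OF that] g pq(3) by blast
    then show "N p = N q" by (simp add: N_def \<kappa>_def)
    obtain a b where "a \<cdot> b = q" "b \<cdot> a = p" using linked_iso[OF g(2) g(1) pq(3)] by blast
    then show "f p = f q" using fc[of a b] by simp
  qed
  have N0: "N p \<noteq> 0" if p: "p \<in> prims" for p
  proof -
    have "N p = of_nat (card {q \<in> prims. linked q p})"
      by (simp add: N_def \<kappa>_def of_bool_def prims(1) flip: sum.inter_filter)
    moreover have "p \<in> {q \<in> prims. linked q p}" using p linked_refl prims(2) by simp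
    ultimately show ?thesis using prims(1) by (auto simp: card_eq_0_iff)
  qed
  have sym: "\<kappa> q p = \<kappa> p q" if "p \<in> prims" "q \<in> prims" for p q
    using that linked_sym prims(2) by (auto simp: \<kappa>_def)
  have "f = (\<Sum>p\<in>prims. svec (f p / N p) (left_char p))"
  proof
    fix h
    have "f h = (\<Sum>q\<in>prims. f (h \<cdot> q))"
      using lin_sum[OF fl, of "\<lambda>q. h \<cdot> q" prims] by (simp add: prims(4) flip: mul_sum)
    also have "\<dots> = (\<Sum>q\<in>prims. coef q h * f q)"
    proof (rule sum.cong[OF refl])
      fix q assume q: "q \<in> prims"
      have "f (h \<cdot> q) = f (h \<cdot> q \<cdot> q)" by (simp only: mul_assoc idem[OF q])
      also have "\<dots> = f (q \<cdot> (h \<cdot> q))" by (rule fc)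
      also have "\<dots> = f (q \<cdot> h \<cdot> q)" by (simp only: mul_assoc)
      also have "\<dots> = coef q h * f q" by (simp only: coef[OF q] linD[OF fl])
      finally show "f (h \<cdot> q) = coef q h * f q" .
    qed
    also have "\<dots> = (\<Sum>q\<in>prims. \<Sum>p\<in>prims. f p / N p * (coef q h * \<kappa> q p))"
    proof (rule sum.cong[OF refl])
      fix q assume q: "q \<in> prims"
      have "(\<Sum>p\<in>prims. f p / N p * (coef q h * \<kappa> q p)) = (\<Sum>p\<in>prims. f q / N q * coef q h * \<kappa> p q)"
      proof (rule sum.cong[OF refl])
        fix p assume p: "p \<in> prims"
        show "f p / N p * (coef q h * \<kappa> q p) = f q / N q * coef q h * \<kappa> p q"
        proof (cases "linked q p")
          case True
          show ?thesis by (simp only: lk[OF p q True] sym[OF p q] mult.assoc)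
        next
          case False
          then show ?thesis using sym[OF p q] by (simp add: \<kappa>_def)
        qed
      qed
      also have "\<dots> = f q / N q * coef q h * N q" by (simp only: N_def sum_distrib_left)
      also have "\<dots> = coef q h * f q" using N0[OF q] by simp
      finally show "coef q h * f q = (\<Sum>p\<in>prims. f p / N p * (coef q h * \<kappa> q p))" by simp
    qed
    also have "\<dots> = (\<Sum>p\<in>prims. f p / N p * left_char p h)"
      by (subst sum.swap) (simp add: char sum_distrib_left)
    finally show "f h = (\<Sum>p\<in>prims. svec (f p / N p) (left_char p)) h" by (simp add: sum_fun_apply)
  qed
  also have "\<dots> \<in> char_ring H UNIV"
    unfolding char_ring_def tspan_eq
    using left_char_is_character[OF idem]
    by (intro fun_space.span_sum fun_space.span_scale fun_space.span_base) blast
  finally show ?thesis .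
qed

section \<open>Trace functions, the adjoint action and convolution\<close>

lemma hadj_eq_swv: "hadj H h x = swv h (\<lambda>p q. p \<cdot> x \<cdot> \<S> q)"
  by (simp add: hadj_def swv_def)

lemma conv_eq_sw: "conv H F G = (\<lambda>x. sw x (\<lambda>p q. F p * G q))"
  by (simp add: conv_def sw_def mult.assoc)

text \<open>The trace property brings \<open>\<S> a\<^sub>2\<close> in front of
  \<open>a\<^sub>1\<close>. Because S^2 = id, the product is
  \<open>\<S> (\<S> a\<^sub>1 \<cdot> a\<^sub>2)\<close>, which collapses.\<close>

lemma trace_function_adj:
  assumes "trace_function f"
  shows "f (hadj H a x) = \<epsilon> a * f x"
proof -
  have fl: "lin f" and fc: "\<And>x y. f (x \<cdot> y) = f (y \<cdot> x)" using assms by (auto simp: trace_function_def)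
  have "f (hadj H a x) = sw a (\<lambda>p q. f (p \<cdot> x \<cdot> \<S> q))" by (simp only: hadj_eq_swv lin_swv[OF fl])
  also have "\<dots> = sw a (\<lambda>p q. f (\<S> (\<S> p \<cdot> q) \<cdot> x))"
  proof (rule sw_cong)
    fix p q
    have "f (p \<cdot> x \<cdot> \<S> q) = f (\<S> q \<cdot> (p \<cdot> x))" by (rule fc)
    then show "f (p \<cdot> x \<cdot> \<S> q) = f (\<S> (\<S> p \<cdot> q) \<cdot> x)"
      by (simp only: antip_mul antipode_involutive mul_assoc)
  qed
  also have "\<dots> = \<epsilon> a * f (\<S> \<one> \<cdot> x)"
    by (rule sw_antipode_left) (intro lin_comp[OF fl] linop_intros)
  finally show ?thesis by simp
qed

text \<open>\<open>sw_integ_move\<close> carries \<open>x\<close> from the first component of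
  \<Lambda> to the second, inside the antipode; it comes out as \<open>\<S> (\<S> x) = x\<close> to
  the right of \<open>y\<close>.\<close>

lemma trace_function_average:
  assumes F: "lin F"
  shows "trace_function (\<lambda>x. F (hadj H \<Lambda> x))"
proof -
  note li = lin_comp[OF F] linop_intros
  have e: "F (hadj H \<Lambda> x) = sw \<Lambda> (\<lambda>p q. F (p \<cdot> x \<cdot> \<S> q))" for x
    by (simp only: hadj_eq_swv lin_swv[OF F])
  have "sw \<Lambda> (\<lambda>p q. F (p \<cdot> (x \<cdot> y) \<cdot> \<S> q)) = sw \<Lambda> (\<lambda>p q. F (p \<cdot> (y \<cdot> x) \<cdot> \<S> q))" for x y
  proof -
    have "sw \<Lambda> (\<lambda>p q. F (p \<cdot> x \<cdot> y \<cdot> \<S> q)) = sw \<Lambda> (\<lambda>p q. F (p \<cdot> y \<cdot> \<S> (q \<cdot> \<S> x)))"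
      by (rule sw_integ_move) (intro li)+
    then show ?thesis by (simp only: antip_mul antipode_involutive mul_assoc)
  qed
  moreover have "lin (\<lambda>x. sw \<Lambda> (\<lambda>p q. F (p \<cdot> x \<cdot> \<S> q)))" by (intro lin_sw_fun li)
  ultimately show ?thesis by (simp add: trace_function_def e)
qed

lemma trace_function_conv:
  assumes "trace_function F" "trace_function G"
  shows "trace_function (conv H F G)"
proof -
  have F: "lin F" "\<And>x y. F (x \<cdot> y) = F (y \<cdot> x)" and G: "lin G" "\<And>x y. G (x \<cdot> y) = G (y \<cdot> x)"
    using assms by (auto simp: trace_function_def)
  have m: "sw (x \<cdot> y) (\<lambda>p q. F p * G q) = sw x (\<lambda>p q. sw y (\<lambda>r s. F (p \<cdot> r) * G (q \<cdot> s)))" for x y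
    by (intro sw_mul lin_times F(1) G(1))
  have "sw (x \<cdot> y) (\<lambda>p q. F p * G q) = sw (y \<cdot> x) (\<lambda>p q. F p * G q)" for x y
  proof -
    have "sw (x \<cdot> y) (\<lambda>p q. F p * G q) = sw x (\<lambda>p q. sw y (\<lambda>r s. F (r \<cdot> p) * G (s \<cdot> q)))"
      unfolding m by (intro sw_cong arg_cong2[of _ _ _ _ "(*)"] F(2) G(2))
    also have "\<dots> = sw (y \<cdot> x) (\<lambda>p q. F p * G q)" unfolding m by (rule sw_commute)
    finally show ?thesis .
  qed
  then show ?thesis
    by (simp add: trace_function_def conv_eq_sw lin_sw[OF linop_id])
qed

section \<open>Restriction to a normal Hopf subalgebra\<close>

context
  fixes K assumes K: "normal_hopf_subalgebra H K"
begin

lemma subspace_K: "is_subspace K" and hadj_K: "x \<in> K \<Longrightarrow> hadj H a x \<in> K"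
  and comul_K: "x \<in> K \<Longrightarrow> hcomul H x \<in> tspan {tensor u v | u v. u \<in> K \<and> v \<in> K}"
  using K by (auto simp: normal_hopf_subalgebra_def hopf_subalgebra_def)

lemma restrict_trace_function:
  assumes "trace_function f"
  shows "zrestr f K \<in> inv_set H K"
proof -
  have "lin f" using assms by (simp add: trace_function_def)
  then have "zrestr f K \<in> dual_sp K"
    using subspace_K by (auto simp: dual_sp_def lin_on_def zrestr_def is_subspace_def)
  then show ?thesis
    by (simp add: inv_set_def zrestr_def hadj_K trace_function_adj[OF assms])
qed

text \<open>Averaging an arbitrary linear extension over \<Lambda> leaves it unchanged on
  \<open>K\<close>: normality keeps \<open>hadj H \<Lambda> x\<close> in \<open>K\<close>, where
  invariance and \<open>\<epsilon> \<Lambda> = 1\<close> apply.\<close>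

lemma inv_set_extend:
  assumes f: "f \<in> inv_set H K"
  shows "\<exists>F. trace_function F \<and> zrestr F K = f"
proof -
  have "lin_on K f" and f0: "\<And>x. x \<notin> K \<Longrightarrow> f x = 0" and fi: "\<And>a x. x \<in> K \<Longrightarrow> f (hadj H a x) = \<epsilon> a * f x"
    using f by (auto simp: inv_set_def dual_sp_def)
  then obtain F where F: "lin F" "\<forall>x\<in>K. F x = f x" using linear_extension[OF subspace_K] by blast
  have "zrestr (\<lambda>x. F (hadj H \<Lambda> x)) K = f"
    using F(2) f0 fi by (auto simp: zrestr_def fun_eq_iff hadj_K)
  then show ?thesis using trace_function_average[OF F(1)] by blast
qed

lemma restrict_image: "(\<lambda>\<chi>. zrestr \<chi> K) ` char_ring H UNIV = inv_set H K"
  using restrict_trace_function trace_function_of_char_ring inv_set_extend char_ring_of_trace_function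
  by blast

text \<open>Every invariant functional is a restriction from the whole algebra, and the restriction
  of a character is the character of the restricted representation.\<close>

lemma inv_set_char_ring: "inv_set H K \<subseteq> char_ring H K"
proof
  fix f assume "f \<in> inv_set H K"
  then obtain \<chi> where \<chi>: "\<chi> \<in> char_ring H UNIV" "f = zrestr \<chi> K" using restrict_image by blast
  have "is_subspace {\<chi>. zrestr \<chi> K \<in> char_ring H K}"
  proof -
    have "zrestr (0 :: ('i \<Rightarrow> 'k) \<Rightarrow> 'k) K = 0" "zrestr (x + y) K = zrestr x K + zrestr y K"
      "zrestr (svec c x) K = svec c (zrestr x K)" for x y :: "('i \<Rightarrow> 'k) \<Rightarrow> 'k" and c
      by (auto simp: zrestr_def fun_eq_iff)
    then show ?thesis
      by (simp add: is_subspace_def char_ring_def tspan_eq fun_space.span_zero fun_space.span_add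
          fun_space.span_scale)
  qed
  moreover have "{character UNIV n \<rho> |n \<rho>. is_rep H UNIV n \<rho>} \<subseteq> {\<chi>. zrestr \<chi> K \<in> char_ring H K}"
  proof safe
    fix n \<rho> assume "is_rep H UNIV n \<rho>"
    then have "is_rep H K n \<rho>" unfolding is_rep_def by blast
    moreover have "zrestr (character UNIV n \<rho>) K = character K n \<rho>"
      by (auto simp: zrestr_def character_def fun_eq_iff)
    ultimately show "zrestr (character UNIV n \<rho>) K \<in> char_ring H K"
      unfolding char_ring_def tspan_eq by (intro fun_space.span_base) auto
  qed
  ultimately have "\<chi> \<in> {\<chi>. zrestr \<chi> K \<in> char_ring H K}"
    by (rule tspan_induct[OF \<chi>(1)[unfolded char_ring_def]])
  then show "f \<in> char_ring H K" using \<chi>(2) by simp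
qed

text \<open>Well-definedness of the product of the dual of \<open>K\<close>: the coproduct of an
  element of \<open>K\<close> lies in the span of tensors from \<open>K\<close>, on which the two
  pairings agree.\<close>

lemma conv_restrict_cong:
  fixes F G F' G' :: "('i \<Rightarrow> 'k) \<Rightarrow> 'k"
  assumes "lin F" "lin G" "lin F'" "lin G'" and "zrestr F K = zrestr F' K" "zrestr G K = zrestr G' K"
  shows "zrestr (conv H F G) K = zrestr (conv H F' G') K"
proof -
  have FF: "F x = F' x" "G x = G' x" if "x \<in> K" for x
    using fun_cong[OF assms(5), of x] fun_cong[OF assms(6), of x] that by (auto simp: zrestr_def)
  define pr where "pr = (\<lambda>(F :: ('i \<Rightarrow> 'k) \<Rightarrow> 'k) (G :: ('i \<Rightarrow> 'k) \<Rightarrow> 'k) t. \<Sum>a\<in>UNIV. \<Sum>b\<in>UNIV. t (a, b) * (F (bv a) * G (bv b)) :: 'k)"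
  have pr: "pr F G (tensor u v) = F u * G v" if "lin F" "lin G" for F G u v
    using pairing_tensor[of "\<lambda>x y. F x * G y" u v] that by (simp add: pr_def tensor_def lin_times)
  have "conv H F G x = conv H F' G' x" if x: "x \<in> K" for x
  proof -
    have "is_subspace {t. pr F G t = pr F' G' t}"
      by (auto simp: is_subspace_def pr_def distrib_right sum.distrib mult.assoc simp flip: sum_distrib_left)
    moreover have "{tensor u v | u v. u \<in> K \<and> v \<in> K} \<subseteq> {t. pr F G t = pr F' G' t}"
      using assms(1-4) FF by (auto simp: pr)
    ultimately have "hcomul H x \<in> {t. pr F G t = pr F' G' t}"
      by (rule tspan_induct[OF comul_K[OF x]])
    then show ?thesis by (simp add: conv_def pr_def mult.assoc)
  qed
  then show ?thesis by (auto simp: zrestr_def)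
qed

text \<open>The given extensions may be replaced by trace functions, whose convolution is again a
  trace function.\<close>

lemma conv_inv_set:
  assumes "zrestr F K \<in> inv_set H K" "zrestr G K \<in> inv_set H K" "lin F" "lin G"
  shows "zrestr (conv H F G) K \<in> inv_set H K"
proof -
  obtain F' where F': "trace_function F'" "zrestr F' K = zrestr F K" using inv_set_extend[OF assms(1)] by blast
  obtain G' where G': "trace_function G'" "zrestr G' K = zrestr G K" using inv_set_extend[OF assms(2)] by blast
  have "lin F'" "lin G'" using F' G' by (auto simp: trace_function_def)
  then have "zrestr (conv H F G) K = zrestr (conv H F' G') K"
    using F'(2) G'(2) assms by (intro conv_restrict_cong) auto
  then show ?thesis using restrict_trace_function[OF trace_function_conv[OF F'(1) G'(1)]] by simp
qed

text \<open>The counit is the identity of the convolution product, so the invariant functionals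
  contain the unit of the dual of \<open>K\<close>.\<close>

lemma eps_inv_set: "zrestr \<epsilon> K \<in> inv_set H K"
  by (rule restrict_trace_function) (simp add: trace_function_def lin_eps[OF linop_id])

lemma inv_set_subspace:
  assumes "f \<in> inv_set H K" "g \<in> inv_set H K"
  shows "f + g \<in> inv_set H K" "(\<lambda>x. c * f x) \<in> inv_set H K"
  using assms by (auto simp: inv_set_def dual_sp_def lin_on_def algebra_simps)

end

end

theorem theorem4p11:
  fixes H :: "('i::finite, 'k::field_char_0) hopf_data"
    and K :: "('i \<Rightarrow> 'k) set"
  assumes "alg_closed TYPE('k)"
    and "is_hopf_algebra H"
    and "semisimple H"
    and "normal_hopf_subalgebra H K"
  shows "(\<lambda>\<chi>. zrestr \<chi> K) ` char_ring H UNIV = inv_set H K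
    \<and> inv_set H K \<subseteq> char_ring H K
    \<and> zrestr (heps H) K \<in> inv_set H K
    \<and> (\<forall>f\<in>inv_set H K. \<forall>g\<in>inv_set H K. \<forall>c.
          f + g \<in> inv_set H K \<and> (\<lambda>x. c * f x) \<in> inv_set H K)
    \<and> (\<forall>f\<in>inv_set H K. \<forall>g\<in>inv_set H K. \<forall>F G.
          lin_on UNIV F \<and> lin_on UNIV G \<and> zrestr F K = f \<and> zrestr G K = g
          \<longrightarrow> zrestr (conv H F G) K \<in> inv_set H K)"
proof -
  interpret semisimple_hopf H by unfold_locales fact+
  note K = assms(4)
  show ?thesis
    by (intro conjI ballI allI impI restrict_image[OF K] inv_set_char_ring[OF K] eps_inv_set[OF K]
        inv_set_subspace[OF K] conv_inv_set[OF K]) auto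
qed

end
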